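(* Let $d, s$ be integers with $1 \le s \le d-1$ and let $\eta > 0$. There exists $n_0 = n_0(d, \eta)$ such that for all integers $n \ge n_0$ and all integers $k$ with $d+1 \le k \le n^s$ there exists a set $S \subseteq [n]^d$ of size at least $(1-\eta)\, k\, n^{d-s}$ such that each $s$-dimensional affine subspace of $\mathbb{R}^d$ contains at most $k$ points of $S$.
   Context: $[n] = \{1, \ldots, n\}$, and $[n]^d$ is regarded as a subset of $\mathbb{R}^d$. The threshold $n_0$ depends only on $d$ and $\eta$ (not on $k$ or $s$). *)

theory Defs
  imports "HOL-Analysis.Analysis"
begin

definition grid :: "nat \<Rightarrow> (real ^ 'd::finite) set" where
  "grid n = {x. \<forall>i. x $ i \<in> real ` {1..n}}"

end

theory Submission
  imports Defs
begin

text \<open>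
  Fix \<open>d\<close> and \<open>\<eta>\<close>. Every \<open>s\<close>-flat that contains too many points of a set may be taken to be spanned by
  grid points, and then it is \<open>x + span B\<close> for a basis \<open>B\<close> of integer vectors such that the number of
  grid points on it is \<open>O(n\<^sup>s / h)\<close>, where \<open>h\<close> is the product of the sup norms of the vectors in \<open>B\<close>.
  The sum of \<open>1 / h\<^sup>k\<close> over all integer bases converges as soon as \<open>k \<ge> d + 1\<close>; this is where the
  threshold comes from. A random set of density about \<open>k / n\<^sup>s\<close> contains more than \<open>k\<close> points of
  a given flat with probability \<open>O(1 / h\<^sup>k)\<close>, so all but finitely many directions can be repaired
  by deleting few points.

  For the finitely many exceptional directions the expected number of points on a flat is close
  to \<open>k\<close>. If \<open>k\<close> is large, concentration of the binomial distribution suffices. If \<open>k\<close> is bounded,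
  consider the hypergraph whose edges are the points of a torus slightly larger than \<open>[n]\<^sup>d\<close> and whose
  vertices are the residue classes of flats in the exceptional directions. It is regular with
  small codegrees, so a semi-random nibble yields an almost perfect random matching, and the
  probability that it contains a given set of \<open>u\<close> points is at most \<open>(2 / n\<^sup>s)\<^sup>u\<close>. The union of \<open>k\<close>
  independent such matchings has at most \<open>k\<close> points on every exceptional flat and is random
  enough for the deletion argument in all other directions.
\<close>


section \<open>Finite expectations and random subsets\<close>

text \<open>The sum of \<open>1 / infnorm v ^ k\<close> over nonzero integer vectors converges
  exactly for exponents above the dimension, whence \<open>d + 1\<close>. Independent sampling is
  too weak for bounded \<open>k\<close>: a count of mean near \<open>k\<close> fluctuates by about
  the square root of \<open>k\<close>, so a constant proportion of the points would be lost.
  Matchings cap the exceptional directions deterministically instead. The grid itself gives no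
  regular hypergraph, because parallel flats meet it in very different numbers of points; residue
  classes modulo \<open>M\<close> all have exactly \<open>M ^ s\<close> points, provided that
  \<open>M\<close> is 1 modulo a fixed number that absorbs all denominators. For bounded
  \<open>k\<close> the deletion argument uses joint moments of order \<open>k + 1\<close>, and the
  analysis of the nibble is arranged to control such moments. Expectations are encoded as positive
  normalised linear functionals, so that successive random choices are composed as functionals.
  Uniformity in \<open>k\<close> comes from the fact that large \<open>k\<close> begins at a
  constant independent of \<open>n\<close>.\<close>

locale averaging =
  fixes \<Omega> :: "'s set" and E :: "('s \<Rightarrow> real) \<Rightarrow> real"
  assumes finite_space: "finite \<Omega>"
    and add: "E (\<lambda>x. f x + g x) = E f + E g"
    and scale: "E (\<lambda>x. c * f x) = c * E f"
    and mono: "(\<And>x. x \<in> \<Omega> \<Longrightarrow> f x \<le> g x) \<Longrightarrow> E f \<le> E g"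
    and one: "E (\<lambda>_. 1) = 1"
begin

lemma const: "E (\<lambda>_. c) = c"
  using scale[of c "\<lambda>_. 1"] one by simp

lemma cong: "(\<And>x. x \<in> \<Omega> \<Longrightarrow> f x = g x) \<Longrightarrow> E f = E g"
  by (intro antisym mono) auto

lemma diff: "E (\<lambda>x. f x - g x) = E f - E g"
  using add[of f "\<lambda>x. (-1) * g x"] scale[of "-1" g] by simp

lemma sum: "finite A \<Longrightarrow> E (\<lambda>x. \<Sum>a\<in>A. f a x) = (\<Sum>a\<in>A. E (f a))"
  by (induction A rule: finite_induct) (simp_all add: const add)

lemma nonneg: "(\<And>x. x \<in> \<Omega> \<Longrightarrow> 0 \<le> f x) \<Longrightarrow> 0 \<le> E f"
  using mono[of "\<lambda>_. 0" f] by (simp add: const)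

lemma zero: "(\<And>x. x \<in> \<Omega> \<Longrightarrow> f x = 0) \<Longrightarrow> E f = 0"
  using cong[of f "\<lambda>_. 0"] by (simp add: const)

lemma ex_ge: "\<exists>x\<in>\<Omega>. E f \<le> f x"
proof (rule ccontr)
  assume neg: "\<not> ?thesis"
  \<comment> \<open>On an empty space \<open>mono\<close> would hold vacuously and give 1 \<le>
    0.\<close>
  have ne: "\<Omega> \<noteq> {}"
    using mono[of "\<lambda>_. 1" "\<lambda>_. 0"] by (auto simp: const)
  define M where "M = Max (f ` \<Omega>)"
  have "E f \<le> E (\<lambda>_. M)"
    by (rule mono) (simp add: M_def finite_space)
  also have "\<dots> = M" by (rule const)
  also have "M \<in> f ` \<Omega>"
    unfolding M_def using ne finite_space by (intro Max_in) auto
  then have "M < E f" using neg by force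
  finally show False by simp
qed

text \<open>A two-stage experiment: \<open>x\<close> is drawn first, then \<open>y\<close> from a
  law that may depend on \<open>x\<close>. In this way the rounds of the nibble and the unions of
  matchings remain expectations.\<close>

lemma compose:
  assumes F: "\<And>x. x \<in> \<Omega> \<Longrightarrow> averaging \<Omega>1 (F x)"
    and h: "\<And>x y. x \<in> \<Omega> \<Longrightarrow> y \<in> \<Omega>1 \<Longrightarrow> h x y \<in> \<Omega>2"
    and fin: "finite \<Omega>2"
  shows "averaging \<Omega>2 (\<lambda>f. E (\<lambda>x. F x (\<lambda>y. f (h x y))))"
proof
  fix f g and c :: real
  show "E (\<lambda>x. F x (\<lambda>y. f (h x y) + g (h x y))) =
      E (\<lambda>x. F x (\<lambda>y. f (h x y))) + E (\<lambda>x. F x (\<lambda>y. g (h x y)))"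
    unfolding add[symmetric] by (rule cong) (simp add: averaging.add[OF F])
  show "E (\<lambda>x. F x (\<lambda>y. c * f (h x y))) = c * E (\<lambda>x. F x (\<lambda>y. f (h x y)))"
    unfolding scale[symmetric] by (rule cong) (simp add: averaging.scale[OF F])
  show "E (\<lambda>x. F x (\<lambda>y. f (h x y))) \<le> E (\<lambda>x. F x (\<lambda>y. g (h x y)))"
    if "\<And>x. x \<in> \<Omega>2 \<Longrightarrow> f x \<le> g x"
    by (rule mono, rule averaging.mono[OF F]) (use that h in auto)
  have "E (\<lambda>x. F x (\<lambda>y. 1)) = E (\<lambda>x. 1)"
    by (rule cong) (simp add: averaging.one[OF F])
  then show "E (\<lambda>x. F x (\<lambda>y. 1)) = 1" by (simp add: one)
qed (fact fin)

lemma map: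
  assumes "\<And>x. x \<in> \<Omega> \<Longrightarrow> h x \<in> \<Omega>2" "finite \<Omega>2"
  shows "averaging \<Omega>2 (\<lambda>f. E (\<lambda>x. f (h x)))"
  by unfold_locales (auto simp: assms add scale one intro: mono)

end

section \<open>Independent random subsets\<close>

definition bern :: "'a set \<Rightarrow> real \<Rightarrow> ('a set \<Rightarrow> real) \<Rightarrow> real" where
  "bern P p f = (\<Sum>B\<in>Pow P. p ^ card B * (1 - p) ^ card (P - B) * f B)"

text \<open>Independence as an algebraic identity: multiplying out the product on the right gives
  one term for each subset of \<open>P\<close>.\<close>

lemma bern_prod:
  assumes "finite P"
  shows "bern P p (\<lambda>B. \<Prod>x\<in>P. if x \<in> B then a x else b x) = (\<Prod>x\<in>P. p * a x + (1 - p) * b x)"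
proof -
  have "bern P p (\<lambda>B. \<Prod>x\<in>P. if x \<in> B then a x else b x) =
      (\<Sum>B\<in>Pow P. (\<Prod>x\<in>B. p * a x) * (\<Prod>x\<in>P - B. (1 - p) * b x))"
    unfolding bern_def
  proof (rule sum.cong[OF refl])
    fix B assume B: "B \<in> Pow P"
    then have fB: "finite B" using assms finite_subset by auto
    have "(\<Prod>x\<in>P. if x \<in> B then a x else b x) =
        (\<Prod>x\<in>B. if x \<in> B then a x else b x) * (\<Prod>x\<in>P - B. if x \<in> B then a x else b x)"
      using B assms by (subst prod.subset_diff[of B P]) (auto simp: mult.commute)
    also have "\<dots> = (\<Prod>x\<in>B. a x) * (\<Prod>x\<in>P - B. b x)"
      by (intro arg_cong2[where f = "(*)"] prod.cong) auto
    finally show "p ^ card B * (1 - p) ^ card (P - B) * (\<Prod>x\<in>P. if x \<in> B then a x else b x) =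
        (\<Prod>x\<in>B. p * a x) * (\<Prod>x\<in>P - B. (1 - p) * b x)"
      by (simp add: prod.distrib)
  qed
  then show ?thesis using assms by (simp add: prod_add)
qed

lemma averaging_bern:
  assumes "finite P" "0 \<le> p" "p \<le> 1"
  shows "averaging (Pow P) (bern P p)"
proof
  show "finite (Pow P)" using assms by simp
  show "bern P p (\<lambda>x. f x + g x) = bern P p f + bern P p g" for f g
    by (simp add: bern_def sum.distrib algebra_simps)
  show "bern P p (\<lambda>x. c * f x) = c * bern P p f" for c f
    by (simp add: bern_def sum_distrib_left algebra_simps)
  show "bern P p f \<le> bern P p g" if "\<And>x. x \<in> Pow P \<Longrightarrow> f x \<le> g x" for f g
    unfolding bern_def using that assms by (intro sum_mono mult_left_mono) auto
  show "bern P p (\<lambda>_. 1) = 1"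
    using bern_prod[OF assms(1), of p "\<lambda>_. 1" "\<lambda>_. 1"] by simp
qed

lemma prod_if_subset:
  fixes c d :: real
  assumes "finite P" "J \<subseteq> P"
  shows "(\<Prod>x\<in>P. if x \<in> J then c else d) = c ^ card J * d ^ card (P - J)"
proof -
  have "(\<Prod>x\<in>P. if x \<in> J then c else d) =
      (\<Prod>x\<in>J. if x \<in> J then c else d) * (\<Prod>x\<in>P - J. if x \<in> J then c else d)"
    using assms by (subst prod.subset_diff[of J P]) (auto simp: mult.commute)
  also have "\<dots> = (\<Prod>x\<in>J. c) * (\<Prod>x\<in>P - J. d)"
    by (intro arg_cong2[where f = "(*)"] prod.cong) auto
  finally show ?thesis by simp
qed

text \<open>The indicator of the event is a product of one factor per point, so
  \<open>bern_prod\<close> evaluates it.\<close>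

lemma bern_in_out:
  assumes "finite P" "J \<subseteq> P" "K \<subseteq> P" "J \<inter> K = {}"
  shows "bern P p (\<lambda>B. of_bool (J \<subseteq> B \<and> B \<inter> K = {})) = p ^ card J * (1 - p) ^ card K"
proof -
  have eq: "(\<Prod>x\<in>P. if x \<in> B then of_bool (x \<notin> K) else of_bool (x \<notin> J)) =
      (of_bool (J \<subseteq> B \<and> B \<inter> K = {}) :: real)" for B
  proof (cases "J \<subseteq> B \<and> B \<inter> K = {}")
    case True
    then show ?thesis by (auto intro!: prod.neutral)
  next
    case False
    then have "\<exists>x\<in>P. (if x \<in> B then of_bool (x \<notin> K) else of_bool (x \<notin> J)) = (0 :: real)"
      using assms by auto
    then show ?thesis using False assms(1) by (simp add: prod_zero)
  qed
  have "bern P p (\<lambda>B. of_bool (J \<subseteq> B \<and> B \<inter> K = {})) =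
      (\<Prod>x\<in>P. p * of_bool (x \<notin> K) + (1 - p) * of_bool (x \<notin> J))"
    unfolding bern_prod[OF assms(1), symmetric] eq ..
  also have "\<dots> = (\<Prod>x\<in>P. (if x \<in> J then p else 1) * (if x \<in> K then 1 - p else 1))"
    using assms(4) by (intro prod.cong) auto
  also have "\<dots> = p ^ card J * (1 - p) ^ card K"
    using assms by (simp add: prod.distrib prod_if_subset)
  finally show ?thesis .
qed

section \<open>The nibble\<close>

text \<open>Edges are indexed by \<open>P\<close>, and \<open>e x\<close> is the vertex set of the
  edge \<open>x\<close>. Thus \<open>m\<close> is the uniformity, \<open>N\<close> the degree and
  \<open>L\<close> a codegree bound. The condition 2 \<le> \<open>N\<close> keeps
  \<open>1 - 1 / N\<close> away from 0.\<close>

definition regular_hyp :: "'a set \<Rightarrow> ('a \<Rightarrow> 'v set) \<Rightarrow> nat \<Rightarrow> nat \<Rightarrow> nat \<Rightarrow> bool" where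
  "regular_hyp P e m N L \<longleftrightarrow> finite P \<and> 1 \<le> m \<and> 2 \<le> N \<and> 1 \<le> L \<and>
     (\<forall>x\<in>P. finite (e x) \<and> card (e x) = m) \<and>
     (\<forall>v\<in>\<Union>(e ` P). card {x\<in>P. v \<in> e x} = N) \<and>
     (\<forall>v w. v \<noteq> w \<longrightarrow> card {x\<in>P. v \<in> e x \<and> w \<in> e x} \<le> L)"

definition matchings :: "'a set \<Rightarrow> ('a \<Rightarrow> 'v set) \<Rightarrow> 'a set set" where
  "matchings P e = {S. S \<subseteq> P \<and> pairwise (\<lambda>x y. disjnt (e x) (e y)) S}"

text \<open>When activated edges collide, all of them are dropped. This is wasteful, but apart from
  a condition on \<open>S\<close>, acceptance of given edges then only prescribes which edges lie in
  \<open>B\<close> and which do not.\<close>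

definition accepted :: "('a \<Rightarrow> 'v set) \<Rightarrow> 'a set \<Rightarrow> 'a set \<Rightarrow> 'a set" where
  "accepted e S B = {x\<in>B. disjnt (e x) (\<Union>(e ` S)) \<and> (\<forall>y\<in>B. y \<noteq> x \<longrightarrow> disjnt (e x) (e y))}"

text \<open>Every round activates edges from all of \<open>P\<close>, and edges already blocked by
  \<open>S\<close> still cause collisions. The collision probability is then the same in each round,
  and no residual hypergraph with changing degrees has to be followed.\<close>

fun nibble :: "'a set \<Rightarrow> ('a \<Rightarrow> 'v set) \<Rightarrow> nat \<Rightarrow> nat \<Rightarrow> ('a set \<Rightarrow> real) \<Rightarrow> real" where
  "nibble P e N 0 f = f {}"
| "nibble P e N (Suc t) f =
     nibble P e N t (\<lambda>S. bern P (1 / real N) (\<lambda>B. f (S \<union> accepted e S B)))"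

lemma matchings_empty: "{} \<in> matchings P e"
  by (simp add: matchings_def)

lemma finite_matchings: "finite P \<Longrightarrow> finite (matchings P e)"
  by (rule finite_subset[of _ "Pow P"]) (auto simp: matchings_def)

lemma matchings_subset: "S \<in> matchings P e \<Longrightarrow> T \<subseteq> S \<Longrightarrow> T \<in> matchings P e"
  unfolding matchings_def using pairwise_subset by blast

lemma matchings_disjnt:
  "S \<in> matchings P e \<Longrightarrow> x \<in> S \<Longrightarrow> y \<in> S \<Longrightarrow> x \<noteq> y \<Longrightarrow> e x \<inter> e y = {}"
  unfolding matchings_def by (auto simp: pairwise_def disjnt_def)

lemma matchings_Un_accepted:
  assumes "S \<in> matchings P e" "B \<subseteq> P"
  shows "S \<union> accepted e S B \<in> matchings P e"
  using assms unfolding matchings_def accepted_def pairwise_def disjnt_def by auto blast+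

lemma averaging_nibble:
  assumes "finite P" "2 \<le> N"
  shows "averaging (matchings P e) (nibble P e N t)"
proof (induction t)
  case 0
  show ?case
    by standard (auto simp: finite_matchings assms matchings_empty)
next
  case (Suc t)
  have "averaging (Pow P) (bern P (1 / real N))"
    using assms by (intro averaging_bern) auto
  then have "averaging (matchings P e)
      (\<lambda>f. nibble P e N t (\<lambda>S. bern P (1 / real N) (\<lambda>B. f (S \<union> accepted e S B))))"
    using assms by (intro averaging.compose[OF Suc]) (auto simp: finite_matchings matchings_Un_accepted)
  then show ?case by simp
qed

text \<open>Error constants, in units of \<open>L / N\<close>, for \<open>u\<close> prescribed edges
  and \<open>r\<close> vertices to be left uncovered. The summands of the recursion stem from
  dropping one vertex, from covering it by one more edge, and from the at most
  \<open>(r + u * m) * L\<close> edges at this vertex that are lost.\<close>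

fun unc_const :: "nat \<Rightarrow> (nat \<Rightarrow> real) \<Rightarrow> nat \<Rightarrow> nat \<Rightarrow> real" where
  "unc_const m c 0 u = c u"
| "unc_const m c (Suc r) u = unc_const m c r u + unc_const m c r (Suc u) + real (r + u * m)"

lemma unc_const_nonneg: "(\<And>u. 0 \<le> c u) \<Longrightarrow> 0 \<le> unc_const m c r u"
  by (induction r arbitrary: u) auto

locale regular_hypergraph =
  fixes P :: "'a set" and e :: "'a \<Rightarrow> 'v set" and m N L :: nat
  assumes hyp: "regular_hyp P e m N L"
begin

definition "\<delta> = real L / real N"

lemma finP: "finite P" and m1: "1 \<le> m" and N2: "2 \<le> N" and L1: "1 \<le> L"
  and fine: "x \<in> P \<Longrightarrow> finite (e x)" and carde: "x \<in> P \<Longrightarrow> card (e x) = m"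
  and degree: "v \<in> \<Union>(e ` P) \<Longrightarrow> card {x\<in>P. v \<in> e x} = N"
  and codegree: "v \<noteq> w \<Longrightarrow> card {x\<in>P. v \<in> e x \<and> w \<in> e x} \<le> L"
  using hyp unfolding regular_hyp_def by auto

lemma \<delta>_nonneg: "0 \<le> \<delta>" by (simp add: \<delta>_def)

lemma N_pos: "0 < real N" using N2 by simp

lemma ene: "x \<in> P \<Longrightarrow> e x \<noteq> {}"
  using carde m1 by fastforce

lemma mat_sub: "X \<in> matchings P e \<Longrightarrow> X \<subseteq> P"
  by (simp add: matchings_def)

lemma mat_fin: "X \<in> matchings P e \<Longrightarrow> finite X"
  using mat_sub finP finite_subset by blast

lemma card_Union_e: "X \<in> matchings P e \<Longrightarrow> card (\<Union>(e ` X)) = m * card X"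
proof -
  assume X: "X \<in> matchings P e"
  have "card (\<Union>(e ` X)) = (\<Sum>x\<in>X. card (e x))"
    using X matchings_disjnt[OF X] mat_sub[OF X] fine mat_fin[OF X]
    by (intro card_UN_disjoint) auto
  also have "\<dots> = (\<Sum>x\<in>X. m)"
    using mat_sub[OF X] carde by (intro sum.cong) auto
  finally show ?thesis by simp
qed

text \<open>Induction on \<open>R\<close>: a vertex lies on at most one edge of a matching, so the event that it is covered splits
  into the disjoint events that one of its \<open>N\<close> edges is chosen.\<close>

lemma uncovered_stats:
  fixes c :: "nat \<Rightarrow> real"
  assumes E: "averaging (matchings P e) E" and \<sigma>: "0 \<le> \<sigma>" "\<sigma> \<le> 1" and c: "\<And>u. 0 \<le> c u"
    and pts: "\<And>X. X \<in> matchings P e \<Longrightarrow>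
      \<bar>real N ^ card X * E (\<lambda>S. of_bool (X \<subseteq> S)) - \<sigma> ^ card X\<bar> \<le> c (card X) * \<delta>"
  shows "finite R \<Longrightarrow> R \<subseteq> \<Union>(e ` P) \<Longrightarrow> X \<in> matchings P e \<Longrightarrow> R \<inter> \<Union>(e ` X) = {} \<Longrightarrow>
      \<bar>real N ^ card X * E (\<lambda>S. of_bool (X \<subseteq> S \<and> R \<inter> \<Union>(e ` S) = {}))
        - \<sigma> ^ card X * (1 - \<sigma>) ^ card R\<bar> \<le> unc_const m c (card R) (card X) * \<delta>"
proof (induction R arbitrary: X rule: finite_induct)
  case empty
  then show ?case using pts[of X] by simp
next
  case (insert v R)
  interpret averaging "matchings P e" E by (rule E)
  define u r where "u = card X" and "r = card R"
  define \<tau> where "\<tau> = \<sigma> ^ Suc u * (1 - \<sigma>) ^ r"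
  have \<tau>: "0 \<le> \<tau>" "\<tau> \<le> 1"
    using \<sigma> by (auto simp: \<tau>_def intro!: mult_le_one power_le_one simp del: power_Suc)
  define f where "f = (\<lambda>Y S. of_bool (Y \<subseteq> S \<and> R \<inter> \<Union>(e ` S) = {}) :: real)"
  define D where "D = {y\<in>P. v \<in> e y}"
  define Z where "Z = R \<union> \<Union>(e ` X)"
  define G where "G = {y\<in>D. e y \<inter> Z = {}}"
  have finD: "finite D" and finG: "finite G" using finP by (auto simp: D_def G_def)
  have cardD: "card D = N" using degree insert.prems(1) by (simp add: D_def)
  have X: "X \<subseteq> P" "finite X" using mat_sub mat_fin insert.prems by auto
  have vX: "v \<notin> \<Union>(e ` X)" using insert.prems by auto
  have finZ: "finite Z" unfolding Z_def using insert.hyps X fine by auto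
  have cardZ: "card Z \<le> r + u * m"
    unfolding Z_def using card_Un_le[of R "\<Union>(e ` X)"] card_Union_e[OF insert.prems(2)]
    by (simp add: r_def u_def mult.commute)
  \<comment> \<open>A lost edge contains \<open>v\<close> and a further vertex of \<open>Z\<close>,
    so the codegree bound applies once for each vertex of \<open>Z\<close>.\<close>
  have bad: "card (D - G) \<le> (r + u * m) * L"
  proof -
    have "D - G = (\<Union>w\<in>Z. {y\<in>P. v \<in> e y \<and> w \<in> e y})"
      by (auto simp: D_def G_def)
    also have "card \<dots> \<le> (\<Sum>w\<in>Z. card {y\<in>P. v \<in> e y \<and> w \<in> e y})"
      by (rule card_UN_le[OF finZ])
    also have "\<dots> \<le> (\<Sum>w\<in>Z. L)"
      using vX insert.hyps by (intro sum_mono codegree) (auto simp: Z_def)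
    also have "\<dots> \<le> (r + u * m) * L" using cardZ by simp
    finally show ?thesis .
  qed
  have cardG: "card G \<le> N" using card_mono[OF finD, of G] cardD by (auto simp: G_def)
  have cardG': "real N - real (card G) \<le> real (r + u * m) * real L"
  proof -
    have "card D = card G + card (D - G)"
      using finD by (metis (no_types, lifting) G_def card_Diff_subset card_mono finG le_add_diff_inverse mem_Collect_eq subsetI)
    then have "real N - real (card G) = real (card (D - G))" using cardD by simp
    also have "\<dots> \<le> real ((r + u * m) * L)" using bad by (simp only: of_nat_le_iff)
    finally show ?thesis by simp
  qed
  have "E (\<lambda>S. of_bool (X \<subseteq> S \<and> insert v R \<inter> \<Union>(e ` S) = {})) =
      E (\<lambda>S. f X S - (\<Sum>y\<in>D. f (insert y X) S))"
  proof (rule cong)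
    fix S assume S: "S \<in> matchings P e"
    have SP: "S \<subseteq> P" by (rule mat_sub[OF S])
    show "of_bool (X \<subseteq> S \<and> insert v R \<inter> \<Union>(e ` S) = {}) = f X S - (\<Sum>y\<in>D. f (insert y X) S)"
    proof (cases "\<exists>y\<in>S. v \<in> e y")
      case True
      then obtain y where y: "y \<in> S" "v \<in> e y" by blast
      have yD: "y \<in> D" using y SP by (auto simp: D_def)
      have "(\<Sum>z\<in>D. f (insert z X) S) = (\<Sum>z\<in>{y}. f (insert z X) S)"
      proof (rule sum.mono_neutral_right[OF finD])
        show "\<forall>z\<in>D - {y}. f (insert z X) S = 0"
          using matchings_disjnt[OF S, of y] y by (auto simp: f_def D_def)
      qed (use yD in auto)
      then show ?thesis using y by (auto simp: f_def)
    next
      case False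
      then have "(\<Sum>z\<in>D. f (insert z X) S) = 0"
        by (intro sum.neutral) (auto simp: f_def D_def)
      then show ?thesis using False by (auto simp: f_def)
    qed
  qed
  also have "\<dots> = E (f X) - (\<Sum>y\<in>D. E (f (insert y X)))"
    by (simp add: diff sum finD)
  \<comment> \<open>An edge outside \<open>G\<close> meets \<open>R\<close>, which has to stay
    uncovered, or meets an edge of \<open>X\<close>, from which it differs because \<open>X\<close>
    does not cover \<open>v\<close>. A matching allows neither.\<close>
  also have "(\<Sum>y\<in>D. E (f (insert y X))) = (\<Sum>y\<in>G. E (f (insert y X)))"
  proof (rule sum.mono_neutral_right[OF finD])
    show "\<forall>y\<in>D - G. E (f (insert y X)) = 0"
    proof
      fix y assume y: "y \<in> D - G"
      show "E (f (insert y X)) = 0"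
      proof (rule zero)
        fix S assume S: "S \<in> matchings P e"
        have "y \<notin> X" using y vX by (auto simp: D_def)
        then show "f (insert y X) S = 0"
          using y matchings_disjnt[OF S, of y] by (fastforce simp: f_def D_def G_def Z_def)
      qed
    qed
  qed (auto simp: G_def)
  finally have main: "E (\<lambda>S. of_bool (X \<subseteq> S \<and> insert v R \<inter> \<Union>(e ` S) = {})) =
      E (f X) - (\<Sum>y\<in>G. E (f (insert y X)))" .
  have "R \<subseteq> \<Union>(e ` P)" using insert.prems by auto
  note IH = insert.IH[OF this]
  have 1: "\<bar>real N ^ u * E (f X) - \<sigma> ^ u * (1 - \<sigma>) ^ r\<bar> \<le> unc_const m c r u * \<delta>"
    using IH[of X] insert.prems by (auto simp: f_def u_def r_def)
  have 2: "\<bar>real N ^ Suc u * E (f (insert y X)) - \<tau>\<bar> \<le> unc_const m c r (Suc u) * \<delta>" if "y \<in> G" for y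
  proof -
    have y: "y \<in> P" "v \<in> e y" "e y \<inter> R = {}" "\<And>x. x \<in> X \<Longrightarrow> e y \<inter> e x = {}"
      using that by (auto simp: G_def D_def Z_def)
    have "y \<notin> X" using y vX by auto
    then have cu: "card (insert y X) = Suc u" using X by (simp add: u_def)
    have "insert y X \<in> matchings P e"
      using insert.prems y unfolding matchings_def pairwise_def disjnt_def by blast
    moreover have "R \<inter> \<Union>(e ` insert y X) = {}" using y insert.prems by auto
    ultimately show ?thesis using IH[of "insert y X"] unfolding cu by (simp add: f_def r_def \<tau>_def)
  qed
  \<comment> \<open>Passing from \<open>card G\<close> to \<open>N\<close> costs at most
    \<open>(r + u * m) * L\<close> terms of size \<open>\<tau> / N\<close>, which accounts for the
    last summand of \<open>unc_const\<close>.\<close>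
  have 3: "\<bar>real N ^ u * (\<Sum>y\<in>G. E (f (insert y X))) - \<tau>\<bar>
      \<le> (unc_const m c r (Suc u) + real (r + u * m)) * \<delta>"
  proof -
    have "real N ^ u * (\<Sum>y\<in>G. E (f (insert y X))) - \<tau> =
        ((\<Sum>y\<in>G. real N ^ Suc u * E (f (insert y X)) - \<tau>) - (real N - real (card G)) * \<tau>) / real N"
      using N_pos by (simp add: sum_subtractf sum_distrib_left[symmetric] field_simps)
    also have "\<bar>\<dots>\<bar> \<le> (\<bar>\<Sum>y\<in>G. real N ^ Suc u * E (f (insert y X)) - \<tau>\<bar> + (real N - real (card G)) * \<tau>) / real N"
    proof -
      have "0 \<le> (real N - real (card G)) * \<tau>" using cardG \<tau> by simp
      then show ?thesis using N_pos by (simp add: abs_divide divide_right_mono)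
    qed
    also have "\<dots> \<le> (real N * (unc_const m c r (Suc u) * \<delta>) + real (r + u * m) * real L) / real N"
    proof (intro divide_right_mono add_mono)
      have "\<bar>\<Sum>y\<in>G. real N ^ Suc u * E (f (insert y X)) - \<tau>\<bar> \<le> (\<Sum>y\<in>G. unc_const m c r (Suc u) * \<delta>)"
        using 2 by (intro order.trans[OF sum_abs] sum_mono) auto
      also have "\<dots> \<le> real N * (unc_const m c r (Suc u) * \<delta>)"
        using cardG unc_const_nonneg[of c m r "Suc u"] c \<delta>_nonneg by (simp add: mult_right_mono)
      finally show "\<bar>\<Sum>y\<in>G. real N ^ Suc u * E (f (insert y X)) - \<tau>\<bar> \<le> real N * (unc_const m c r (Suc u) * \<delta>)" .
      have "(real N - real (card G)) * \<tau> \<le> (real N - real (card G)) * 1"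
        using \<tau> cardG by (intro mult_left_mono) auto
      then show "(real N - real (card G)) * \<tau> \<le> real (r + u * m) * real L" using cardG' by simp
    qed simp
    also have "\<dots> = (unc_const m c r (Suc u) + real (r + u * m)) * \<delta>"
      using N_pos by (simp add: \<delta>_def field_simps)
    finally show ?thesis .
  qed
  have "\<sigma> ^ u * (1 - \<sigma>) ^ r - \<tau> = \<sigma> ^ u * (1 - \<sigma>) ^ Suc r"
    by (simp add: \<tau>_def algebra_simps)
  moreover have "card (insert v R) = Suc r" using insert.hyps by (simp add: r_def)
  ultimately show ?case
    unfolding main u_def[symmetric] using 1 3 by (simp add: algebra_simps abs_le_iff)
qed

end

section \<open>One round of the nibble\<close>

text \<open>There is one error for each of the \<open>2 ^ u\<close> sets of edges that may be new in
  this round, and the sum over all sizes \<open>j\<close> dominates the error of each size. The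
  first summand comes from \<open>avoid_prob\<close>, the second from
  \<open>uncovered_stats\<close>.\<close>

definition round_const :: "nat \<Rightarrow> (nat \<Rightarrow> real) \<Rightarrow> nat \<Rightarrow> real" where
  "round_const m c u = 2 ^ u * (\<Sum>j\<le>u. real ((m * j)\<^sup>2 + j) + unc_const m c (m * j) (u - j))"

context regular_hypergraph
begin

definition touching :: "'v set \<Rightarrow> 'a set" where
  "touching W = {y\<in>P. e y \<inter> W \<noteq> {}}"

text \<open>Counting edges vertex by vertex gives \<open>card W * N\<close>; the overcount is at
  most one codegree for each pair of vertices of \<open>W\<close>.\<close>

lemma card_touching:
  assumes "finite W" "W \<subseteq> \<Union>(e ` P)"
  shows "card (touching W) \<le> card W * N \<and> card W * N \<le> card (touching W) + (card W)\<^sup>2 * L"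
  using assms
proof (induction W rule: finite_induct)
  case empty
  then show ?case by (simp add: touching_def)
next
  case (insert v W)
  define D where "D = {y\<in>P. v \<in> e y}"
  have D: "finite D" "card D = N" using finP degree insert.prems by (auto simp: D_def)
  have fin: "finite (touching W)" using finP by (simp add: touching_def)
  have eq: "touching (insert v W) = D \<union> touching W" by (auto simp: touching_def D_def)
  have "D \<inter> touching W = (\<Union>w\<in>W. {y\<in>P. v \<in> e y \<and> w \<in> e y})"
    by (auto simp: D_def touching_def)
  also have "card \<dots> \<le> (\<Sum>w\<in>W. card {y\<in>P. v \<in> e y \<and> w \<in> e y})"
    by (rule card_UN_le) (rule insert.hyps)
  also have "\<dots> \<le> (\<Sum>w\<in>W. L)"
    using insert.hyps by (intro sum_mono codegree) auto
  finally have int: "card (D \<inter> touching W) \<le> card W * L" by simp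
  have un: "card D + card (touching W) = card (D \<union> touching W) + card (D \<inter> touching W)"
    by (rule card_Un_Int) (use D fin in auto)
  have IH: "card (touching W) \<le> card W * N" "card W * N \<le> card (touching W) + (card W)\<^sup>2 * L"
    using insert by auto
  have "(card W)\<^sup>2 * L + card W * L \<le> (Suc (card W))\<^sup>2 * L"
    by (simp add: power2_eq_square algebra_simps)
  then show ?case
    unfolding eq card_insert_disjoint[OF insert.hyps] using un int IH D by (simp add: algebra_simps)
qed

text \<open>An activated edge outside \<open>J\<close> that touches \<open>J\<close> eliminates a
  member of \<open>J\<close>, while members of \<open>J\<close> never collide with each other. For
  fixed \<open>S\<close> the event is therefore of the kind computed by
  \<open>bern_in_out\<close>.\<close>

lemma accepted_iff:
  assumes "S \<in> matchings P e" "J \<in> matchings P e" "B \<subseteq> P"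
  shows "J \<subseteq> accepted e S B \<longleftrightarrow> \<Union>(e ` J) \<inter> \<Union>(e ` S) = {} \<and> J \<subseteq> B \<and> B \<inter> (touching (\<Union>(e ` J)) - J) = {}"
proof
  assume J: "J \<subseteq> accepted e S B"
  have "y \<in> J" if "y \<in> B" "x \<in> J" "e y \<inter> e x \<noteq> {}" for x y
    using J that unfolding accepted_def disjnt_def by (cases "y = x") blast+
  then have "B \<inter> (touching (\<Union>(e ` J)) - J) = {}"
    unfolding touching_def by blast
  then show "\<Union>(e ` J) \<inter> \<Union>(e ` S) = {} \<and> J \<subseteq> B \<and> B \<inter> (touching (\<Union>(e ` J)) - J) = {}"
    using J by (auto simp: accepted_def disjnt_def)
next
  assume A: "\<Union>(e ` J) \<inter> \<Union>(e ` S) = {} \<and> J \<subseteq> B \<and> B \<inter> (touching (\<Union>(e ` J)) - J) = {}"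
  show "J \<subseteq> accepted e S B"
  proof
    fix x assume x: "x \<in> J"
    have "disjnt (e x) (e y)" if y: "y \<in> B" "y \<noteq> x" for y
    proof (rule ccontr)
      assume n: "\<not> disjnt (e x) (e y)"
      then have "y \<in> touching (\<Union>(e ` J))"
        using y assms x by (auto simp: touching_def disjnt_def)
      then have "y \<in> J" using A y by auto
      then show False using matchings_disjnt[OF assms(2) x, of y] n y by (auto simp: disjnt_def)
    qed
    then show "x \<in> accepted e S B" using A x unfolding accepted_def disjnt_def by blast
  qed
qed

text \<open>The sum runs over the part \<open>J\<close> of \<open>X\<close> that is new in this
  round. Only \<open>J = X \<inter> accepted e S B\<close> can contribute: edges are nonempty, so an
  edge of \<open>S\<close> blocks itself and is never accepted again.\<close>

lemma round_expand:
  assumes "S \<in> matchings P e" "X \<in> matchings P e"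
  shows "bern P p (\<lambda>B. of_bool (X \<subseteq> S \<union> accepted e S B)) =
    (\<Sum>J\<in>Pow X. of_bool (X - J \<subseteq> S \<and> \<Union>(e ` J) \<inter> \<Union>(e ` S) = {}) *
      (p ^ card J * (1 - p) ^ card (touching (\<Union>(e ` J)) - J)))"
proof -
  have XP: "X \<subseteq> P" "finite X" using assms mat_sub mat_fin by auto
  have pw: "of_bool (X \<subseteq> S \<union> accepted e S B) = (\<Sum>J\<in>Pow X.
      of_bool (X - J \<subseteq> S \<and> \<Union>(e ` J) \<inter> \<Union>(e ` S) = {}) *
      (of_bool (J \<subseteq> B \<and> B \<inter> (touching (\<Union>(e ` J)) - J) = {}) :: real))" if B: "B \<subseteq> P" for B
  proof -
    have disj: "x \<notin> accepted e S B" if "x \<in> S" for x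
    proof
      assume "x \<in> accepted e S B"
      then have "e x = {}" "x \<in> P" using that B by (auto simp: accepted_def disjnt_def)
      then show False using ene by auto
    qed
    have "(\<Sum>J\<in>Pow X. of_bool (X - J \<subseteq> S \<and> \<Union>(e ` J) \<inter> \<Union>(e ` S) = {}) *
        (of_bool (J \<subseteq> B \<and> B \<inter> (touching (\<Union>(e ` J)) - J) = {}) :: real)) =
        (\<Sum>J\<in>Pow X. if J = X \<inter> accepted e S B then of_bool (X \<subseteq> S \<union> accepted e S B) else 0)"
    proof (rule sum.cong[OF refl])
      fix J assume J: "J \<in> Pow X"
      then have "J \<in> matchings P e" using matchings_subset assms by auto
      note iff = accepted_iff[OF assms(1) this B]
      have "(X - J \<subseteq> S \<and> J \<subseteq> accepted e S B) \<longleftrightarrow> (J = X \<inter> accepted e S B \<and> X \<subseteq> S \<union> accepted e S B)"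
        using J disj by auto
      then show "of_bool (X - J \<subseteq> S \<and> \<Union>(e ` J) \<inter> \<Union>(e ` S) = {}) *
          (of_bool (J \<subseteq> B \<and> B \<inter> (touching (\<Union>(e ` J)) - J) = {}) :: real) =
          (if J = X \<inter> accepted e S B then of_bool (X \<subseteq> S \<union> accepted e S B) else 0)"
        using iff by (auto simp flip: of_bool_conj)
    qed
    also have "\<dots> = of_bool (X \<subseteq> S \<union> accepted e S B)"
      using XP by (subst sum.delta) auto
    finally show ?thesis by simp
  qed
  have "bern P p (\<lambda>B. of_bool (X \<subseteq> S \<union> accepted e S B)) = bern P p (\<lambda>B. (\<Sum>J\<in>Pow X.
      of_bool (X - J \<subseteq> S \<and> \<Union>(e ` J) \<inter> \<Union>(e ` S) = {}) *
      (of_bool (J \<subseteq> B \<and> B \<inter> (touching (\<Union>(e ` J)) - J) = {}))))"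
    unfolding bern_def by (rule sum.cong[OF refl]) (simp only: pw Pow_iff)
  also have "\<dots> = (\<Sum>J\<in>Pow X. of_bool (X - J \<subseteq> S \<and> \<Union>(e ` J) \<inter> \<Union>(e ` S) = {}) *
      bern P p (\<lambda>B. of_bool (J \<subseteq> B \<and> B \<inter> (touching (\<Union>(e ` J)) - J) = {})))"
    unfolding bern_def sum_distrib_left by (subst sum.swap) (simp add: mult_ac)
  also have "\<dots> = (\<Sum>J\<in>Pow X. of_bool (X - J \<subseteq> S \<and> \<Union>(e ` J) \<inter> \<Union>(e ` S) = {}) *
      (p ^ card J * (1 - p) ^ card (touching (\<Union>(e ` J)) - J)))"
    using XP by (intro sum.cong refl arg_cong2[where f = "(*)"] bern_in_out finP)
      (auto simp: touching_def)
  finally show ?thesis .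
qed

text \<open>The idealised probability that an activated edge survives the collisions: about
  \<open>m * N\<close> edges meet its \<open>m\<close> vertices, each activated with probability
  \<open>1 / N\<close>.\<close>

definition \<theta> :: real where "\<theta> = (1 - 1 / real N) ^ (m * N)"

lemma \<theta>_bounds: "0 \<le> \<theta>" "\<theta> \<le> 1"
  using N2 by (auto simp: \<theta>_def intro!: power_le_one)

text \<open>The true exponent falls short of \<open>m * j * N\<close> by some \<open>b\<close>, at
  most \<open>(m * j)\<^sup>2 * L\<close> for double counting plus \<open>j\<close> for the edges of
  \<open>J\<close> themselves. By Bernoulli's inequality this changes the power by at most
  \<open>b / N\<close>.\<close>

lemma avoid_prob:
  assumes "J \<in> matchings P e"
  shows "\<bar>(1 - 1 / real N) ^ card (touching (\<Union>(e ` J)) - J) - \<theta> ^ card J\<bar>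
    \<le> real ((m * card J)\<^sup>2 + card J) * \<delta>"
proof -
  let ?W = "\<Union>(e ` J)"
  define q where "q = 1 - 1 / real N"
  have q: "0 \<le> q" "q \<le> 1" using N2 by (auto simp: q_def)
  define A where "A = card (touching ?W - J)"
  define j where "j = card J"
  have JP: "J \<subseteq> P" "finite J" using mat_sub mat_fin assms by auto
  have finW: "finite ?W" "?W \<subseteq> \<Union>(e ` P)" using JP fine by auto
  have cW: "card ?W = m * j" using card_Union_e[OF assms] by (simp add: j_def)
  have sub: "J \<subseteq> touching ?W" using JP ene by (auto simp: touching_def)
  have fint: "finite (touching ?W)" using finP by (simp add: touching_def)
  have "A = card (touching ?W) - j" unfolding A_def j_def by (rule card_Diff_subset) (use JP sub in auto)
  moreover have "j \<le> card (touching ?W)" unfolding j_def by (rule card_mono) (use fint sub in auto)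
  moreover note card_touching[OF finW, unfolded cW]
  ultimately have A: "A \<le> m * j * N" "m * j * N \<le> A + ((m * j)\<^sup>2 * L + j)" by auto
  define b where "b = m * j * N - A"
  have b: "m * j * N = A + b" "b \<le> (m * j)\<^sup>2 * L + j" using A by (auto simp: b_def)
  have "q ^ A - q ^ (m * j * N) = q ^ A * (1 - q ^ b)"
    by (simp only: b(1) power_add) (simp add: algebra_simps)
  moreover have "0 \<le> q ^ A" "q ^ A \<le> 1" "q ^ b \<le> 1" using q by (auto intro: power_le_one)
  moreover have "1 - q ^ b \<le> real b * (1 / real N)"
    using Bernoulli_inequality[of "- 1 / real N" b] N2 by (simp add: q_def)
  ultimately have "\<bar>q ^ A - q ^ (m * j * N)\<bar> \<le> real b * (1 / real N)"
    using mult_mono[of "q ^ A" 1 "1 - q ^ b" "real b * (1 / real N)"] by (simp add: abs_mult)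
  also have "\<dots> \<le> real (((m * j)\<^sup>2 + j) * L) * (1 / real N)"
  proof (intro mult_right_mono)
    have "j * 1 \<le> j * L" using L1 by (intro mult_left_mono) auto
    then have "b \<le> ((m * j)\<^sup>2 + j) * L" using b(2) unfolding add_mult_distrib by linarith
    then show "real b \<le> real (((m * j)\<^sup>2 + j) * L)" by (simp only: of_nat_le_iff)
  qed simp
  finally show ?thesis
    unfolding A_def q_def j_def by (simp add: \<theta>_def \<delta>_def mult.assoc mult.commute[of N] flip: power_mult)
qed

lemma round_stats:
  fixes c :: "nat \<Rightarrow> real"
  assumes E: "averaging (matchings P e) E" and \<sigma>: "0 \<le> \<sigma>" "\<sigma> \<le> 1" and c: "\<And>u. 0 \<le> c u"
    and pts: "\<And>X. X \<in> matchings P e \<Longrightarrow>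
      \<bar>real N ^ card X * E (\<lambda>S. of_bool (X \<subseteq> S)) - \<sigma> ^ card X\<bar> \<le> c (card X) * \<delta>"
    and X: "X \<in> matchings P e"
  shows "\<bar>real N ^ card X * E (\<lambda>S. bern P (1 / real N) (\<lambda>B. of_bool (X \<subseteq> S \<union> accepted e S B)))
      - (\<sigma> + \<theta> * (1 - \<sigma>) ^ m) ^ card X\<bar> \<le> round_const m c (card X) * \<delta>"
proof -
  interpret averaging "matchings P e" E by (rule E)
  define p where "p = 1 / real N"
  define u where "u = card X"
  have Xf: "finite X" "X \<subseteq> P" using mat_sub mat_fin X by auto
  define F where "F = (\<lambda>J. E (\<lambda>S. of_bool (X - J \<subseteq> S \<and> \<Union>(e ` J) \<inter> \<Union>(e ` S) = {})))"
  define q where "q = (\<lambda>J. (1 - p) ^ card (touching (\<Union>(e ` J)) - J))"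
  define g where "g = (\<lambda>j. real ((m * j)\<^sup>2 + j) + unc_const m c (m * j) (u - j))"
  have g0: "0 \<le> g j" for j using unc_const_nonneg[of c] c by (simp add: g_def)
  have "E (\<lambda>S. bern P p (\<lambda>B. of_bool (X \<subseteq> S \<union> accepted e S B))) = (\<Sum>J\<in>Pow X. F J * (p ^ card J * q J))"
  proof -
    have "E (\<lambda>S. bern P p (\<lambda>B. of_bool (X \<subseteq> S \<union> accepted e S B))) =
        E (\<lambda>S. \<Sum>J\<in>Pow X. (p ^ card J * q J) * of_bool (X - J \<subseteq> S \<and> \<Union>(e ` J) \<inter> \<Union>(e ` S) = {}))"
      by (rule cong) (simp add: round_expand X q_def mult.commute)
    also have "\<dots> = (\<Sum>J\<in>Pow X. (p ^ card J * q J) * F J)"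
      using Xf by (simp only: sum finite_Pow_iff scale F_def)
    finally show ?thesis by (simp only: mult.commute)
  qed
  then have eq: "real N ^ u * E (\<lambda>S. bern P p (\<lambda>B. of_bool (X \<subseteq> S \<union> accepted e S B))) =
      (\<Sum>J\<in>Pow X. (real N ^ (u - card J) * F J) * q J)"
  proof -
    have "real N ^ u * (F J * (p ^ card J * q J)) = (real N ^ (u - card J) * F J) * q J" if "J \<in> Pow X" for J
    proof -
      have "card J \<le> u" using that Xf by (auto simp: u_def card_mono)
      then have "real N ^ u = real N ^ (u - card J) * real N ^ card J" by (simp flip: power_add)
      moreover have "real N ^ card J * p ^ card J = 1" using N_pos by (simp add: p_def flip: power_mult_distrib)
      ultimately show ?thesis by (simp add: mult_ac) 
    qed
    then show ?thesis unfolding \<open>E _ = _\<close> sum_distrib_left by (intro sum.cong) auto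
  qed
  \<comment> \<open>Each edge of \<open>X\<close> is either old, with weight
    \<open>\<sigma>\<close>, or new, with weight \<open>\<theta> * (1 - \<sigma>) ^ m\<close>, where
    the power stands for its \<open>m\<close> vertices being uncovered.\<close>
  have target: "(\<sigma> + \<theta> * (1 - \<sigma>) ^ m) ^ u = (\<Sum>J\<in>Pow X. (\<sigma> ^ (u - card J) * (1 - \<sigma>) ^ (m * card J)) * \<theta> ^ card J)"
  proof -
    have "(\<sigma> + \<theta> * (1 - \<sigma>) ^ m) ^ u = (\<Prod>x\<in>X. \<theta> * (1 - \<sigma>) ^ m + \<sigma>)" by (simp add: u_def add.commute)
    also have "\<dots> = (\<Sum>J\<in>Pow X. (\<Prod>x\<in>J. \<theta> * (1 - \<sigma>) ^ m) * (\<Prod>x\<in>X - J. \<sigma>))"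
      by (rule prod_add) (rule Xf(1))
    also have "\<dots> = (\<Sum>J\<in>Pow X. (\<sigma> ^ (u - card J) * (1 - \<sigma>) ^ (m * card J)) * \<theta> ^ card J)"
      using Xf by (intro sum.cong refl)
        (auto simp: u_def card_Diff_subset finite_subset power_mult_distrib power_mult)
    finally show ?thesis .
  qed
  have summand: "\<bar>(real N ^ (u - card J) * F J) * q J - (\<sigma> ^ (u - card J) * (1 - \<sigma>) ^ (m * card J)) * \<theta> ^ card J\<bar>
      \<le> (\<Sum>j\<le>u. g j) * \<delta>" if "J \<in> Pow X" for J
  proof -
    define a where "a = real N ^ (u - card J) * F J"
    define \<alpha> where "\<alpha> = \<sigma> ^ (u - card J) * (1 - \<sigma>) ^ (m * card J)"
    have J: "J \<subseteq> X" "finite J" using that Xf finite_subset by auto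
    have ju: "card J \<le> u" using J Xf by (auto simp: u_def card_mono)
    have Jm: "J \<in> matchings P e" and XJm: "X - J \<in> matchings P e" using matchings_subset[OF X J(1)] matchings_subset[OF X Diff_subset] by auto
    have cXJ: "card (X - J) = u - card J" using J by (simp add: card_Diff_subset u_def)
    have disj: "\<Union>(e ` J) \<inter> \<Union>(e ` (X - J)) = {}" using matchings_disjnt[OF X] J by blast
    have W: "finite (\<Union>(e ` J))" "\<Union>(e ` J) \<subseteq> \<Union>(e ` P)" using J Xf fine by auto
    have 1: "\<bar>a - \<alpha>\<bar> \<le> unc_const m c (m * card J) (u - card J) * \<delta>"
      using uncovered_stats[OF E \<sigma> c pts W XJm disj]
      unfolding cXJ card_Union_e[OF Jm] a_def \<alpha>_def F_def .
    have 2: "\<bar>q J - \<theta> ^ card J\<bar> \<le> real ((m * card J)\<^sup>2 + card J) * \<delta>"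
      using avoid_prob[OF Jm] by (simp add: q_def p_def)
    have q: "0 \<le> q J" "q J \<le> 1" using N2 by (auto simp: q_def p_def intro!: power_le_one)
    have \<alpha>: "0 \<le> \<alpha>" "\<alpha> \<le> 1" using \<sigma> by (auto simp: \<alpha>_def intro!: mult_le_one power_le_one)
    have "a * q J - \<alpha> * \<theta> ^ card J = (a - \<alpha>) * q J + \<alpha> * (q J - \<theta> ^ card J)" by (simp add: algebra_simps)
    also have "\<bar>\<dots>\<bar> \<le> \<bar>a - \<alpha>\<bar> * q J + \<alpha> * \<bar>q J - \<theta> ^ card J\<bar>"
      using q \<alpha> by (intro order.trans[OF abs_triangle_ineq]) (simp add: abs_mult)
    also have "\<dots> \<le> \<bar>a - \<alpha>\<bar> * 1 + 1 * \<bar>q J - \<theta> ^ card J\<bar>"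
      using q \<alpha> by (intro add_mono mult_left_mono mult_right_mono) auto
    also have "\<dots> \<le> g (card J) * \<delta>" using 1 2 by (simp add: g_def algebra_simps)
    also have "\<dots> \<le> (\<Sum>j\<le>u. g j) * \<delta>"
      using ju g0 \<delta>_nonneg by (intro mult_right_mono member_le_sum) auto
    finally show ?thesis by (simp add: a_def \<alpha>_def)
  qed
  have "\<bar>real N ^ u * E (\<lambda>S. bern P p (\<lambda>B. of_bool (X \<subseteq> S \<union> accepted e S B))) - (\<sigma> + \<theta> * (1 - \<sigma>) ^ m) ^ u\<bar>
      \<le> (\<Sum>J\<in>Pow X. (\<Sum>j\<le>u. g j) * \<delta>)"
    unfolding eq target sum_subtractf[symmetric]
    using summand by (intro order.trans[OF sum_abs] sum_mono) auto
  also have "\<dots> = round_const m c u * \<delta>"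
    using Xf by (simp add: card_Pow u_def round_const_def g_def)
  finally show ?thesis by (simp add: p_def u_def)
qed

end

section \<open>The density recursion over many rounds\<close>

text \<open>Heuristically the fraction of covered vertices after \<open>t\<close> rounds, or equally
  the degree times the probability that a given edge has been chosen.\<close>

fun density :: "nat \<Rightarrow> real \<Rightarrow> nat \<Rightarrow> real" where
  "density m \<theta> 0 = 0"
| "density m \<theta> (Suc t) = density m \<theta> t + \<theta> * (1 - density m \<theta> t) ^ m"

lemma density_bounds:
  assumes "1 \<le> m" "0 \<le> \<theta>" "\<theta> \<le> 1"
  shows "0 \<le> density m \<theta> t \<and> density m \<theta> t \<le> 1"
proof (induction t)
  case (Suc t)
  define f where "f = 1 - density m \<theta> t"
  have f: "0 \<le> f" "f \<le> 1" using Suc by (auto simp: f_def)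
  have "f ^ m \<le> f ^ 1" using f assms by (intro power_decreasing) auto
  then have "\<theta> * f ^ m \<le> 1 * f" using f assms by (intro mult_mono) auto
  moreover have "0 \<le> \<theta> * f ^ m" using f assms by simp
  ultimately show ?case using Suc by (simp add: f_def[symmetric]) (simp add: f_def)
qed simp

text \<open>As long as the density is below \<open>1 - \<epsilon>\<close>, a round adds at least
  \<open>\<kappa>\<close>. The number of rounds has to be uniform in \<open>\<theta>\<close>, which
  varies with the degree of the hypergraph.\<close>

lemma density_large:
  assumes m: "1 \<le> m" and \<epsilon>: "0 < \<epsilon>" and \<theta>0: "0 < \<theta>0"
  obtains T where "\<And>\<theta>. \<theta>0 \<le> \<theta> \<Longrightarrow> \<theta> \<le> 1 \<Longrightarrow> 1 - \<epsilon> \<le> density m \<theta> T"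
proof -
  define \<kappa> where "\<kappa> = \<theta>0 * \<epsilon> ^ m"
  have \<kappa>: "0 < \<kappa>" using \<epsilon> \<theta>0 by (simp add: \<kappa>_def)
  have step: "min (1 - \<epsilon>) (real t * \<kappa>) \<le> density m \<theta> t" if \<theta>: "\<theta>0 \<le> \<theta>" "\<theta> \<le> 1" for \<theta> t
  proof (induction t)
    case 0
    then show ?case by simp
  next
    case (Suc t)
    have \<theta>': "0 \<le> \<theta>" using \<theta> \<theta>0 by simp
    note b = density_bounds[OF m \<theta>' \<theta>(2), of t]
    show ?case
    proof (cases "1 - \<epsilon> \<le> density m \<theta> t")
      case True
      moreover have "0 \<le> \<theta> * (1 - density m \<theta> t) ^ m" using b \<theta>' by simp
      ultimately show ?thesis by simp
    next
      case False
      then have "\<epsilon> ^ m \<le> (1 - density m \<theta> t) ^ m" using \<epsilon> by (intro power_mono) auto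
      then have "\<kappa> \<le> \<theta> * (1 - density m \<theta> t) ^ m"
        unfolding \<kappa>_def using \<theta> \<theta>0 \<epsilon> by (intro mult_mono) auto
      moreover have "real t * \<kappa> \<le> density m \<theta> t" using Suc False by linarith
      ultimately show ?thesis by (simp add: algebra_simps)
    qed
  qed
  obtain T :: nat where "1 / \<kappa> \<le> real T" using real_arch_simple by blast
  then have "1 \<le> real T * \<kappa>" using \<kappa> by (simp add: field_simps)
  then have "1 - \<epsilon> \<le> density m \<theta> T" if "\<theta>0 \<le> \<theta>" "\<theta> \<le> 1" for \<theta>
    using step[OF that, of T] \<epsilon> by linarith
  then show ?thesis by (rule that)
qed

fun nibble_const :: "nat \<Rightarrow> nat \<Rightarrow> nat \<Rightarrow> real" where
  "nibble_const m 0 = (\<lambda>_. 0)"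
| "nibble_const m (Suc t) = round_const m (nibble_const m t)"

lemma nibble_const_nonneg: "0 \<le> nibble_const m t u"
  by (induction t arbitrary: u)
    (auto simp: round_const_def intro!: sum_nonneg add_nonneg_nonneg unc_const_nonneg mult_nonneg_nonneg)

context regular_hypergraph
begin

lemma nibble_stats:
  assumes "X \<in> matchings P e"
  shows "\<bar>real N ^ card X * nibble P e N t (\<lambda>S. of_bool (X \<subseteq> S)) - density m \<theta> t ^ card X\<bar>
    \<le> nibble_const m t (card X) * \<delta>"
  using assms
proof (induction t arbitrary: X)
  case 0
  \<comment> \<open>Before the first round only the empty set is contained in the matching; this
    agrees with \<open>0 ^ card X\<close> because \<open>0 ^ 0 = 1\<close>.\<close>
  then show ?case using mat_fin[OF 0] by (cases "X = {}") (auto simp: power_0_left card_eq_0_iff)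
next
  case (Suc t)
  show ?case
    using round_stats[OF averaging_nibble[OF finP N2] _ _ nibble_const_nonneg Suc.IH Suc.prems]
      density_bounds[OF m1 \<theta>_bounds] by simp
qed

lemma nibble_conflict:
  assumes "X \<notin> matchings P e" "X \<subseteq> P"
  shows "nibble P e N t (\<lambda>S. of_bool (X \<subseteq> S)) = 0"
proof (rule averaging.zero[OF averaging_nibble[OF finP N2]])
  fix S assume "S \<in> matchings P e"
  then show "of_bool (X \<subseteq> S) = (0::real)" using assms matchings_subset[of S P e X] by auto
qed

text \<open>Bernoulli's inequality with exponent \<open>N\<close> only gives 0. With exponent
  \<open>h\<close>, half of \<open>N\<close> rounded up, it gives at least 1/4, and squaring leads
  to 1/16.\<close>

lemma \<theta>_lower: "(1 / 16) ^ m \<le> \<theta>"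
proof -
  define h where "h = (N + 1) div 2"
  have h: "N \<le> 2 * h" "2 * h \<le> N + 1" unfolding h_def by linarith+
  have "4 * real h \<le> 3 * real N" using h N2 by linarith
  then have "1 / 4 \<le> 1 + real h * (- 1 / real N)" using N2 by (simp add: field_simps)
  also have "\<dots> \<le> (1 - 1 / real N) ^ h"
    using Bernoulli_inequality[of "- 1 / real N" h] N2 by simp
  finally have "(1 / 4) ^ 2 \<le> ((1 - 1 / real N) ^ h) ^ 2" by (rule power_mono) simp
  also have "\<dots> = (1 - 1 / real N) ^ (2 * h)" by (simp add: mult.commute flip: power_mult)
  also have "\<dots> \<le> (1 - 1 / real N) ^ N" using h N2 by (intro power_decreasing) auto
  finally have "(1 / 16) ^ m \<le> ((1 - 1 / real N) ^ N) ^ m"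
    by (intro power_mono) (auto simp: power2_eq_square)
  then show ?thesis by (simp add: \<theta>_def mult.commute flip: power_mult)
qed

end

text \<open>The order of the choices matters: the number of rounds \<open>T\<close> depends on
  \<open>m\<close> and \<open>\<epsilon>\<close>, the error constant \<open>K\<close> on
  \<open>T\<close> and \<open>U\<close>, and the admissible codegree ratio is fixed last.\<close>

theorem random_matching:
  assumes m: "1 \<le> m" and \<epsilon>: "0 < \<epsilon>"
  obtains \<delta>0 where "0 < \<delta>0"
    "\<And>(P :: 'a set) (e :: 'a \<Rightarrow> 'v set) N L. regular_hyp P e m N L \<Longrightarrow> real L \<le> \<delta>0 * real N \<Longrightarrow>
      \<exists>E. averaging (matchings P e) E \<and>
        (\<forall>x\<in>P. (1 - \<epsilon>) / real N \<le> E (\<lambda>S. of_bool (x \<in> S))) \<and>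
        (\<forall>Z. Z \<subseteq> P \<longrightarrow> card Z \<le> U \<longrightarrow> E (\<lambda>S. of_bool (Z \<subseteq> S)) \<le> (2 / real N) ^ card Z)"
proof -
  obtain T where T: "\<And>\<theta>. (1 / 16) ^ m \<le> \<theta> \<Longrightarrow> \<theta> \<le> 1 \<Longrightarrow> 1 - \<epsilon> / 2 \<le> density m \<theta> T"
    using density_large[of m "\<epsilon> / 2" "(1 / 16) ^ m"] m \<epsilon> by auto
  \<comment> \<open>One-point sets are included even if \<open>U = 0\<close>, for the sake of the
    lower bound.\<close>
  define K where "K = 1 + (\<Sum>u\<le>max 1 U. nibble_const m T u)"
  have K: "nibble_const m T u \<le> K" if "u \<le> max 1 U" for u
    using that nibble_const_nonneg
      member_le_sum[of u "{..max 1 U}" "nibble_const m T"] by (simp add: K_def)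
  have K1: "1 \<le> K" unfolding K_def using nibble_const_nonneg by (simp add: sum_nonneg)
  \<comment> \<open>An error of at most 1 is absorbed by the factor 2 per point in the upper bound.
    An error of at most \<open>\<epsilon> / 2\<close> serves the lower bound, the other half of
    \<open>\<epsilon>\<close> being lost in the density.\<close>
  define \<delta>0 where "\<delta>0 = min 1 (\<epsilon> / 2) / K"
  show ?thesis
  proof (rule that)
    show "0 < \<delta>0" using \<epsilon> K1 by (simp add: \<delta>0_def)
    fix P :: "'a set" and e :: "'a \<Rightarrow> 'v set" and N L
    assume H: "regular_hyp P e m N L" and L: "real L \<le> \<delta>0 * real N"
    interpret regular_hypergraph P e m N L by unfold_locales (rule H)
    let ?E = "nibble P e N T"
    let ?\<sigma> = "density m \<theta> T"
    have \<sigma>: "0 \<le> ?\<sigma>" "?\<sigma> \<le> 1" "1 - \<epsilon> / 2 \<le> ?\<sigma>"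
      using density_bounds[OF m1 \<theta>_bounds] T \<theta>_lower \<theta>_bounds by auto
    have "\<delta> \<le> \<delta>0" using L N_pos by (simp add: \<delta>_def field_simps)
    then have "K * \<delta> \<le> K * \<delta>0" using K1 by (intro mult_left_mono) auto
    then have K\<delta>: "K * \<delta> \<le> min 1 (\<epsilon> / 2)" using K1 by (simp add: \<delta>0_def)
    have stats: "\<bar>real N ^ card X * ?E (\<lambda>S. of_bool (X \<subseteq> S)) - ?\<sigma> ^ card X\<bar> \<le> min 1 (\<epsilon> / 2)"
      if "X \<in> matchings P e" "card X \<le> max 1 U" for X
    proof -
      have "nibble_const m T (card X) * \<delta> \<le> K * \<delta>" using K[OF that(2)] \<delta>_nonneg by (rule mult_right_mono)
      then show ?thesis using nibble_stats[OF that(1), of T] K\<delta> by linarith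
    qed
    have lower: "(1 - \<epsilon>) / real N \<le> ?E (\<lambda>S. of_bool (x \<in> S))" if "x \<in> P" for x
    proof -
      have "{x} \<in> matchings P e" using that by (simp add: matchings_def)
      then have "\<bar>real N * ?E (\<lambda>S. of_bool (x \<in> S)) - ?\<sigma>\<bar> \<le> \<epsilon> / 2" using stats[of "{x}"] by simp
      then have "1 - \<epsilon> \<le> real N * ?E (\<lambda>S. of_bool (x \<in> S))" using \<sigma> by linarith
      then show ?thesis using N_pos by (simp add: field_simps)
    qed
    have upper: "?E (\<lambda>S. of_bool (Z \<subseteq> S)) \<le> (2 / real N) ^ card Z" if Z: "Z \<subseteq> P" "card Z \<le> U" for Z
    proof (cases "Z \<in> matchings P e \<and> Z \<noteq> {}")
      case True
      have "real N ^ card Z * ?E (\<lambda>S. of_bool (Z \<subseteq> S)) \<le> 1 + ?\<sigma> ^ card Z"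
        using stats[of Z] True Z by force
      also have "\<dots> \<le> 2" using \<sigma> by (simp add: power_le_one)
      also have "\<dots> \<le> 2 ^ card Z"
      proof -
        have "1 \<le> card Z" using True mat_fin[of Z] by (metis One_nat_def Suc_leI card_gt_0_iff)
        then show ?thesis using power_increasing[of 1 "card Z" "2::real"] by simp
      qed
      finally show ?thesis using N_pos by (simp add: field_simps power_divide)
    next
      case False
      show ?thesis
      proof (cases "Z = {}")
        case True
        then show ?thesis using averaging.one[OF averaging_nibble[OF finP N2, of e T]] by simp
      next
        case F: False
        then show ?thesis using False nibble_conflict[of Z T] Z by simp
      qed
    qed
    show "\<exists>E. averaging (matchings P e) E \<and>
        (\<forall>x\<in>P. (1 - \<epsilon>) / real N \<le> E (\<lambda>S. of_bool (x \<in> S))) \<and>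
        (\<forall>Z. Z \<subseteq> P \<longrightarrow> card Z \<le> U \<longrightarrow> E (\<lambda>S. of_bool (Z \<subseteq> S)) \<le> (2 / real N) ^ card Z)"
      using averaging_nibble[OF finP N2] lower upper by blast
  qed
qed

section \<open>Short integer bases of rich flats\<close>

definition intvec :: "real ^ 'd \<Rightarrow> bool" where
  "intvec x \<longleftrightarrow> (\<forall>i. x $ i \<in> \<int>)"

definition diffs :: "(real ^ 'd) set \<Rightarrow> (real ^ 'd) set" where
  "diffs P = {x - y | x y. x \<in> P \<and> y \<in> P}"

lemma infnorm_bound:
  fixes x :: "real ^ 'd::finite"
  assumes "\<And>i. \<bar>x $ i\<bar> \<le> b"
  shows "infnorm x \<le> b"
  unfolding infnorm_cart using assms by (intro cSup_least) auto

lemma infnorm_attained: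
  fixes x :: "real ^ 'd::finite"
  obtains i where "\<bar>x $ i\<bar> = infnorm x"
proof -
  have "infnorm x \<in> {\<bar>x $ i\<bar> | i. i \<in> UNIV}"
  proof -
    have fin: "finite {\<bar>x $ i\<bar> | i. i \<in> UNIV}" and ne: "{\<bar>x $ i\<bar> | i. i \<in> UNIV} \<noteq> {}"
      by (auto simp: full_SetCompr_eq)
    show ?thesis using Max_in[OF fin ne] unfolding infnorm_cart cSup_eq_Max[OF fin ne] .
  qed
  then show ?thesis using that by auto
qed

text \<open>Take the largest coordinate \<open>i\<close> of some \<open>v\<close> in
  \<open>V\<close>. Subtracting the multiple of \<open>v\<close> that clears coordinate
  \<open>i\<close> leads into a smaller subspace, and by the choice of \<open>i\<close> the
  subtracted vector has norm \<open>\<bar>x $ i\<bar>\<close>. One step at most triples the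
  bound.\<close>

lemma dominating_coordinates:
  fixes V :: "(real ^ 'd::finite) set"
  assumes "subspace V" "dim V = j"
  shows "\<exists>I. card I \<le> j \<and> (\<forall>x\<in>V. \<forall>b\<ge>0. (\<forall>i\<in>I. \<bar>x $ i\<bar> \<le> b) \<longrightarrow> infnorm x \<le> 3 ^ j * b)"
  using assms
proof (induction j arbitrary: V rule: less_induct)
  case (less j)
  show ?case
  proof (cases "V \<subseteq> {0}")
    case True
    then have "infnorm x \<le> 3 ^ j * b" if "x \<in> V" "0 \<le> b" for x b
      using that by (auto simp: infnorm_0)
    then show ?thesis by (intro exI[of _ "{}"]) auto
  next
    case False
    then obtain v where v: "v \<in> V" "v \<noteq> 0" by auto
    obtain i where i: "\<bar>v $ i\<bar> = infnorm v" by (rule infnorm_attained)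
    have vi: "v $ i \<noteq> 0" using i v infnorm_eq_0[of v] by auto
    define V' where "V' = {x\<in>V. x $ i = 0}"
    have sV': "subspace V'"
      using less.prems(1) unfolding V'_def subspace_def by auto
    have "dim V' < dim V"
    proof -
      have "V' \<subseteq> V" "V' \<noteq> V" using v vi by (auto simp: V'_def)
      then show ?thesis
        using subspace_dim_equal[OF sV' less.prems(1)] dim_subset[of V' V] by fastforce
    qed
    then obtain I where I: "card I \<le> dim V'"
      "\<And>x b. x \<in> V' \<Longrightarrow> 0 \<le> b \<Longrightarrow> (\<forall>l\<in>I. \<bar>x $ l\<bar> \<le> b) \<Longrightarrow> infnorm x \<le> 3 ^ dim V' * b"
      using less.IH[OF _ sV' refl] less.prems(2) by blast
    have "infnorm x \<le> 3 ^ j * b" if x: "x \<in> V" and b: "0 \<le> b" "\<And>l. l \<in> insert i I \<Longrightarrow> \<bar>x $ l\<bar> \<le> b" for x b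
    proof -
      define t where "t = x $ i / v $ i"
      have tv: "\<bar>t\<bar> * infnorm v \<le> b" using b(2)[of i] vi by (simp add: t_def i[symmetric] abs_mult)
      have x': "x - t *\<^sub>R v \<in> V'"
        using x v less.prems(1) vi by (auto simp: V'_def t_def intro!: subspace_diff subspace_mul)
      have "\<bar>(x - t *\<^sub>R v) $ l\<bar> \<le> 2 * b" if "l \<in> I" for l
      proof -
        have "\<bar>t * v $ l\<bar> \<le> \<bar>t\<bar> * infnorm v"
          by (simp add: abs_mult mult_left_mono component_le_infnorm_cart)
        then show ?thesis using b(2)[of l] that tv by simp
      qed
      then have "infnorm (x - t *\<^sub>R v) \<le> 3 ^ dim V' * (2 * b)"
        using I(2)[OF x', of "2 * b"] b by simp
      moreover have "infnorm x \<le> infnorm (x - t *\<^sub>R v) + infnorm (t *\<^sub>R v)"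
        using infnorm_triangle[of "x - t *\<^sub>R v" "t *\<^sub>R v"] by simp
      moreover have "infnorm (t *\<^sub>R v) \<le> b" using tv by (simp add: infnorm_mul)
      moreover have "1 * b \<le> 3 ^ dim V' * b" using b by (intro mult_right_mono) auto
      ultimately have "infnorm x \<le> 3 ^ Suc (dim V') * b" by simp
      also have "\<dots> \<le> 3 ^ j * b"
        using \<open>dim V' < dim V\<close> less.prems(2) b by (intro mult_right_mono power_increasing) auto
      finally show ?thesis .
    qed
    moreover have "card (insert i I) \<le> j"
      using card_insert_le_m1[of j I i] I(1) \<open>dim V' < dim V\<close> less.prems(2) by simp
    ultimately show ?thesis by (intro exI[of _ "insert i I"]) auto
  qed
qed

lemma pigeonhole_class:
  assumes "finite P" "P \<noteq> {}" "finite K" "f ` P \<subseteq> K"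
  obtains y where "y \<in> f ` P" "card P \<le> card K * card {x\<in>P. f x = y}"
proof -
  define g where "g = (\<lambda>y. card {x\<in>P. f x = y})"
  have fin: "finite (f ` P)" "f ` P \<noteq> {}" using assms by auto
  have "Max (g ` f ` P) \<in> g ` f ` P" using fin by (intro Max_in) auto
  then obtain y where "y \<in> f ` P" "Max (g ` f ` P) = g y" by blast
  then have y: "y \<in> f ` P" "\<And>z. z \<in> f ` P \<Longrightarrow> g z \<le> g y"
    using fin Max_ge[of "g ` f ` P"] by auto
  have "card P = (\<Sum>z\<in>f ` P. g z)"
    unfolding g_def using sum.image_gen[OF assms(1), of "\<lambda>_. 1::nat" f] by simp
  also have "\<dots> \<le> (\<Sum>z\<in>f ` P. g y)" by (intro sum_mono y(2))
  also have "\<dots> \<le> card K * g y" using card_mono[OF assms(3,4)] by simp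
  finally show ?thesis using that y(1) by (simp add: g_def)
qed

text \<open>At most \<open>dim (diffs P)\<close> coordinates control all differences. Cutting only
  these into intervals makes the number of cells a power with exponent \<open>dim (diffs P)\<close>
  instead of \<open>CARD('d)\<close>; a fullest cell is the required piece.\<close>

lemma small_piece:
  fixes P :: "(real ^ 'd::finite) set"
  assumes fin: "finite P" "P \<noteq> {}" and L: "\<And>d. d \<in> diffs P \<Longrightarrow> infnorm d \<le> L"
    and l: "0 < l" "l \<le> L"
  obtains Q where "Q \<subseteq> P" "Q \<noteq> {}" "\<And>d. d \<in> diffs Q \<Longrightarrow> infnorm d < l"
    "real (card P) \<le> (10 * 3 ^ CARD('d) * L / l) ^ dim (diffs P) * real (card Q)"
proof -
  define j where "j = dim (diffs P)"
  define d where "d = CARD('d)"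
  obtain I where I: "card I \<le> j"
    "\<And>x b. x \<in> span (diffs P) \<Longrightarrow> 0 \<le> b \<Longrightarrow> (\<forall>i\<in>I. \<bar>x $ i\<bar> \<le> b) \<Longrightarrow> infnorm x \<le> 3 ^ j * b"
    using dominating_coordinates[OF subspace_span, of "diffs P" j] by (auto simp: j_def)
  have jd: "j \<le> d" using dim_subset_UNIV_cart[of "diffs P"] by (simp add: j_def d_def)
  obtain p where p: "p \<in> P" using fin by auto
  \<comment> \<open>The factor \<open>3 ^ d\<close> pays for the uncontrolled coordinates, and the
    factor 2 makes the final inequality strict.\<close>
  define h where "h = l / (2 * 3 ^ d)"
  have h: "0 < h" "h \<le> L"
  proof -
    have "(1::real) \<le> 2 * 3 ^ d" using one_le_power[of "3::real" d] by linarith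
    then have "l / (2 * 3 ^ d) \<le> l / 1" using l by (intro divide_left_mono) auto
    then show "0 < h" "h \<le> L" using l by (auto simp: h_def)
  qed
  define K where "K = \<lceil>L / h\<rceil>"
  define f where "f = (\<lambda>x. restrict (\<lambda>i. \<lfloor>(x $ i - p $ i) / h\<rfloor>) I)"
  have finI: "finite I" by simp
  have "f ` P \<subseteq> PiE I (\<lambda>_. {-K..K})"
  proof (clarsimp simp: f_def)
    fix x i assume x: "x \<in> P" "i \<in> I"
    have "\<bar>(x - p) $ i\<bar> \<le> infnorm (x - p)" by (rule component_le_infnorm_cart)
    also have "\<dots> \<le> L" using x p by (intro L) (auto simp: diffs_def)
    finally have "\<bar>(x $ i - p $ i) / h\<bar> \<le> L / h" using h by (simp add: abs_divide divide_right_mono)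
    then show "- K \<le> \<lfloor>(x $ i - p $ i) / h\<rfloor> \<and> \<lfloor>(x $ i - p $ i) / h\<rfloor> \<le> K"
      unfolding K_def by linarith
  qed
  moreover have "finite (PiE I (\<lambda>_. {-K..K}))" by (intro finite_PiE) auto
  ultimately obtain y where y: "y \<in> f ` P" "card P \<le> card (PiE I (\<lambda>_. {-K..K})) * card {x\<in>P. f x = y}"
    using fin by (elim pigeonhole_class[rotated 3])
  define Q where "Q = {x\<in>P. f x = y}"
  have "0 \<le> L / h" using h l by simp
  then have K0: "0 \<le> K" unfolding K_def by linarith
  have "real (card (PiE I (\<lambda>_. {-K..K}))) = real (nat (2 * K + 1)) ^ card I"
    by (simp add: card_PiE)
  \<comment> \<open>Here \<open>2 * K + 1 \<le> 2 * L / h + 3 \<le> 5 * L / h\<close>, since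
    \<open>h \<le> L\<close>. Together with the choice of \<open>h\<close> this is the origin of
    \<open>10 * 3 ^ CARD('d)\<close>.\<close>
  also have "\<dots> \<le> (5 * L / h) ^ card I"
  proof (rule power_mono)
    have "1 \<le> L / h" using h by (simp add: field_simps)
    moreover have "real_of_int K \<le> L / h + 1" unfolding K_def by linarith
    ultimately show "real (nat (2 * K + 1)) \<le> 5 * L / h" using K0 by simp
  qed simp
  also have "\<dots> \<le> (5 * L / h) ^ j"
  proof (rule power_increasing[OF I(1)])
    show "1 \<le> 5 * L / h" using h by (simp add: field_simps)
  qed
  finally have c: "real (card (PiE I (\<lambda>_. {-K..K}))) \<le> (5 * L / h) ^ j" .
  show ?thesis
  proof (rule that[of Q])
    show "Q \<subseteq> P" "Q \<noteq> {}" using y(1) by (auto simp: Q_def)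
    show "infnorm z < l" if "z \<in> diffs Q" for z
    proof -
      obtain a b where ab: "a \<in> P" "b \<in> P" "f a = f b" "z = a - b"
        using \<open>z \<in> diffs Q\<close> by (auto simp: diffs_def Q_def)
      have "\<bar>z $ i\<bar> \<le> h" if i: "i \<in> I" for i
      proof -
        have "\<lfloor>(a $ i - p $ i) / h\<rfloor> = \<lfloor>(b $ i - p $ i) / h\<rfloor>"
          using fun_cong[OF ab(3), of i] i by (simp add: f_def)
        then have "\<bar>(a $ i - p $ i) / h - (b $ i - p $ i) / h\<bar> \<le> 1" by linarith
        then have "\<bar>(a $ i - b $ i) / h\<bar> \<le> 1" by (simp add: diff_divide_distrib)
        moreover have "z $ i = a $ i - b $ i" using ab(4) by simp
        ultimately show ?thesis using h by (simp add: abs_divide field_simps)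
      qed
      moreover have "z \<in> span (diffs P)" using ab by (intro span_base) (auto simp: diffs_def)
      ultimately have "infnorm z \<le> 3 ^ j * h" using I(2)[of z h] h by auto
      also have "\<dots> \<le> 3 ^ d * h" using jd h by (intro mult_right_mono power_increasing) auto
      also have "\<dots> < l" using l by (simp add: h_def)
      finally show ?thesis .
    qed
    have "real (card P) \<le> real (card (PiE I (\<lambda>_. {-K..K})) * card Q)"
      using y(2) by (simp only: Q_def of_nat_le_iff)
    also have "\<dots> \<le> (5 * L / h) ^ j * real (card Q)" using c by (simp add: mult_right_mono)
    also have "5 * L / h = 10 * 3 ^ CARD('d) * L / l" using l by (simp add: h_def d_def field_simps)
    finally show "real (card P) \<le> (10 * 3 ^ CARD('d) * L / l) ^ dim (diffs P) * real (card Q)"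
      by (simp add: j_def)
  qed
qed

text \<open>Take the least \<open>l\<close> such that the differences of norm at most \<open>l\<close> span the same space as all
  differences. A piece of \<open>P\<close> of diameter less than \<open>l\<close> has smaller dimension, and its basis is completed by
  vectors of norm at most \<open>l\<close>.\<close>

lemma short_basis:
  fixes P :: "(real ^ 'd::finite) set"
  assumes "finite P" "P \<noteq> {}" "\<And>d. d \<in> diffs P \<Longrightarrow> infnorm d \<le> L"
  shows "\<exists>B. B \<subseteq> diffs P \<and> independent B \<and> card B = dim (diffs P) \<and>
    real (card P) * (\<Prod>b\<in>B. infnorm b) \<le> (10 * 3 ^ CARD('d)) ^ (CARD('d) * dim (diffs P)) * L ^ dim (diffs P)"
  using assms
proof (induction "dim (diffs P)" arbitrary: P L rule: less_induct)
  case less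
  define j where "j = dim (diffs P)"
  define c where "c = (10 * 3 ^ CARD('d) :: real)"
  have c1: "1 \<le> c" unfolding c_def using one_le_power[of "3::real" "CARD('d)"] by linarith
  define Sh where "Sh = (\<lambda>r. {d \<in> diffs P. infnorm d \<le> r})"
  have findiff: "finite (diffs P)"
  proof -
    have "diffs P = (\<lambda>(x, y). x - y) ` (P \<times> P)" by (auto simp: diffs_def)
    then show ?thesis using less.prems by simp
  qed
  have zero: "0 \<in> diffs P" using less.prems by (auto simp: diffs_def)
  show ?case
  proof (cases "j = 0")
    case True
    then have "diffs P \<subseteq> {0}" by (simp add: j_def)
    then have "\<forall>x\<in>P. \<forall>y\<in>P. x - y = 0" unfolding diffs_def by blast
    then have "\<forall>x\<in>P. \<forall>y\<in>P. x = y" by simp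
    then have "card P \<le> 1" by (metis card.infinite card_le_Suc0_iff_eq One_nat_def zero_le)
    then show ?thesis using True unfolding j_def[symmetric]
      by (intro exI[of _ "{}"]) (auto simp: independent_empty)
  next
    case False
    define R where "R = {r \<in> infnorm ` diffs P. dim (Sh r) = j}"
    have finR: "finite R" using findiff by (simp add: R_def)
    have "Max (infnorm ` diffs P) \<in> R"
    proof -
      have "Sh (Max (infnorm ` diffs P)) = diffs P" using findiff by (auto simp: Sh_def)
      moreover have "Max (infnorm ` diffs P) \<in> infnorm ` diffs P" using findiff zero by (intro Max_in) auto
      ultimately show ?thesis by (simp add: R_def j_def)
    qed
    then have Rne: "R \<noteq> {}" by auto
    define l where "l = Min R"
    have lR: "l \<in> R" unfolding l_def using finR Rne by (rule Min_in)
    have lmin: "l \<le> r" if "r \<in> R" for r unfolding l_def using finR that by (rule Min_le)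
    have dl: "dim (Sh l) = j" using lR by (simp add: R_def)
    have l0: "0 < l"
    proof (rule ccontr)
      assume "\<not> 0 < l"
      then have "Sh l \<subseteq> {0}" by (auto simp: Sh_def) (metis infnorm_eq_0 infnorm_pos_le order.trans antisym not_less)
      then have "dim (Sh l) = 0" by simp
      then show False using dl False by simp
    qed
    have lL: "l \<le> L" using lR less.prems(3) by (auto simp: R_def)
    obtain Q where Q: "Q \<subseteq> P" "Q \<noteq> {}" "\<And>d. d \<in> diffs Q \<Longrightarrow> infnorm d < l"
      "real (card P) \<le> (c * L / l) ^ j * real (card Q)"
      using small_piece[OF less.prems(1,2,3) l0 lL] unfolding c_def j_def by blast
    have dQ: "diffs Q \<subseteq> diffs P" using Q(1) unfolding diffs_def by blast
    have "0 \<in> diffs Q" using Q(2) by (auto simp: diffs_def)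
    define i where "i = dim (diffs Q)"
    \<comment> \<open>If \<open>diffs Q\<close> had full dimension, its largest norm would belong to
      \<open>R\<close> although it is smaller than \<open>l\<close>.\<close>
    have ij: "i < j"
    proof (rule ccontr)
      assume n: "\<not> i < j"
      define r where "r = Max (infnorm ` diffs Q)"
      have fQ: "finite (diffs Q)" using dQ findiff finite_subset by blast
      have r: "r \<in> infnorm ` diffs Q" unfolding r_def using fQ \<open>0 \<in> diffs Q\<close> by (intro Max_in) auto
      have "diffs Q \<subseteq> Sh r" using fQ dQ by (auto simp: Sh_def r_def)
      then have "i \<le> dim (Sh r)" unfolding i_def by (rule dim_subset)
      moreover have "dim (Sh r) \<le> j" unfolding j_def by (rule dim_subset) (auto simp: Sh_def)
      ultimately have "r \<in> R" using n r dQ by (auto simp: R_def)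
      then have "l \<le> r" by (rule lmin)
      moreover obtain z where "z \<in> diffs Q" "r = infnorm z" using r by blast
      ultimately show False using Q(3)[of z] by simp
    qed
    have finQ: "finite Q" using Q less.prems finite_subset by blast
    obtain B0 where B0: "B0 \<subseteq> diffs Q" "independent B0" "card B0 = i"
      "real (card Q) * (\<Prod>b\<in>B0. infnorm b) \<le> c ^ (CARD('d) * i) * l ^ i"
      using less.hyps[of Q l] ij finQ Q(2,3) less_imp_le unfolding j_def i_def c_def by blast
    have "B0 \<subseteq> Sh l" using B0(1) dQ Q(3) by (force simp: Sh_def)
    then obtain B where B: "B0 \<subseteq> B" "B \<subseteq> Sh l" "independent B" "Sh l \<subseteq> span B"
      using maximal_independent_subset_extend[of B0 "Sh l"] B0(2) by blast
    have cB: "card B = j" using dim_unique[OF B(2,4,3) refl] dl by simp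
    have finB: "finite B" using B(3) independent_imp_finite by blast
    have finB0: "finite B0" using B(1) finB finite_subset by blast
    have "(\<Prod>b\<in>B. infnorm b) = (\<Prod>b\<in>B - B0. infnorm b) * (\<Prod>b\<in>B0. infnorm b)"
      using finB B(1) by (rule prod.subset_diff[rotated])
    also have "\<dots> \<le> (\<Prod>b\<in>B - B0. l) * (\<Prod>b\<in>B0. infnorm b)"
      using B(2) by (intro mult_right_mono prod_mono prod_nonneg) (auto simp: infnorm_pos_le Sh_def)
    also have "(\<Prod>b\<in>B - B0. l) = l ^ (j - i)"
      using cB B0(3) B(1) finB0 by (simp add: card_Diff_subset)
    finally have pB: "(\<Prod>b\<in>B. infnorm b) \<le> l ^ (j - i) * (\<Prod>b\<in>B0. infnorm b)" .
    have L0: "0 < L" using l0 lL by simp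
    have "real (card P) * (\<Prod>b\<in>B. infnorm b) \<le>
        ((c * L / l) ^ j * real (card Q)) * (l ^ (j - i) * (\<Prod>b\<in>B0. infnorm b))"
      using Q(4) pB L0 l0 c1 by (intro mult_mono prod_nonneg) (auto simp: infnorm_pos_le)
    also have "\<dots> = (c * L / l) ^ j * l ^ (j - i) * (real (card Q) * (\<Prod>b\<in>B0. infnorm b))" by simp
    also have "\<dots> \<le> (c * L / l) ^ j * l ^ (j - i) * (c ^ (CARD('d) * i) * l ^ i)"
      using B0(4) L0 l0 c1 by (intro mult_left_mono) auto
    also have "\<dots> = c ^ (j + CARD('d) * i) * L ^ j"
    proof -
      have "l ^ (j - i) * l ^ i = l ^ j" using ij by (simp flip: power_add)
      then show ?thesis using l0 by (simp add: power_divide power_mult_distrib power_add field_simps)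
    qed
    \<comment> \<open>The exponent \<open>CARD('d) * j\<close> was chosen so that this induction
      closes: \<open>j \<le> CARD('d)\<close> and \<open>i + 1 \<le> j\<close>.\<close>
    also have "\<dots> \<le> c ^ (CARD('d) * j) * L ^ j"
    proof (intro mult_right_mono power_increasing)
      have "j \<le> CARD('d)" unfolding j_def by (rule dim_subset_UNIV_cart)
      moreover have "CARD('d) * Suc i \<le> CARD('d) * j" using ij by (intro mult_le_mono2) simp
      ultimately show "j + CARD('d) * i \<le> CARD('d) * j" by simp
    qed (use c1 L0 in auto)
    finally show ?thesis using B cB unfolding c_def j_def Sh_def by blast
  qed
qed

section \<open>Grid points on flats\<close>

definition flat :: "real ^ 'd \<Rightarrow> (real ^ 'd) set \<Rightarrow> (real ^ 'd) set" where
  "flat x B = {y. y - x \<in> span B}"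

definition dirs :: "nat \<Rightarrow> (real ^ 'd::finite) set set" where
  "dirs s = {B. independent B \<and> card B = s \<and> (\<forall>b\<in>B. intvec b)}"

lemma grid_eq: "grid n = (\<lambda>f. \<chi> i. real (f i)) ` PiE UNIV (\<lambda>_::'d::finite. {1..n})"
proof (rule set_eqI)
  fix x :: "real ^ 'd"
  have "x \<in> grid n \<longleftrightarrow> (\<exists>f. \<forall>i. f i \<in> {1..n} \<and> x $ i = real (f i))"
    unfolding grid_def image_iff mem_Collect_eq Bex_def by (rule choice_iff)
  also have "\<dots> \<longleftrightarrow> (\<exists>f \<in> PiE UNIV (\<lambda>_. {1..n}). x = (\<chi> i. real (f i)))"
    unfolding Bex_def PiE_UNIV_domain Pi_iff vec_eq_iff vec_lambda_beta by (simp add: all_conj_distrib)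
  finally show "x \<in> grid n \<longleftrightarrow> x \<in> (\<lambda>f. \<chi> i. real (f i)) ` PiE UNIV (\<lambda>_::'d::finite. {1..n})"
    by (simp only: image_iff)
qed

lemma finite_grid: "finite (grid n)"
  unfolding grid_eq by (intro finite_imageI finite_PiE) auto

lemma card_grid: "card (grid n :: (real ^ 'd::finite) set) = n ^ CARD('d)"
proof -
  have "inj_on (\<lambda>f. \<chi> i. real (f i) :: real ^ 'd) (PiE UNIV (\<lambda>_. {1..n}))"
    by (rule inj_onI) (auto simp: vec_eq_iff fun_eq_iff)
  then have "card (grid n :: (real ^ 'd) set) = card (PiE (UNIV :: 'd set) (\<lambda>_. {1..n}))"
    unfolding grid_eq by (rule card_image)
  then show ?thesis by (simp add: card_PiE)
qed

lemma grid_intvec: "x \<in> grid n \<Longrightarrow> intvec x"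
  unfolding grid_def intvec_def by (metis (mono_tags, lifting) Ints_of_nat imageE mem_Collect_eq)

lemma intvec_diff: "intvec x \<Longrightarrow> intvec y \<Longrightarrow> intvec (x - y)"
  by (simp add: intvec_def)

lemma grid_component: "x \<in> grid n \<Longrightarrow> 1 \<le> x $ i \<and> x $ i \<le> real n"
proof -
  assume "x \<in> grid n"
  then have "x $ i \<in> real ` {1..n}" by (simp add: grid_def)
  then show ?thesis by auto
qed

lemma grid_diff_infnorm:
  fixes x :: "real ^ 'd::finite"
  assumes "x \<in> grid n" "y \<in> grid n"
  shows "infnorm (x - y) \<le> real n"
proof (rule infnorm_bound)
  fix i
  show "\<bar>(x - y) $ i\<bar> \<le> real n"
    using grid_component[OF assms(1), of i] grid_component[OF assms(2), of i]
    unfolding vector_minus_component abs_le_iff by linarith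
qed

lemma grid_differences_span:
  fixes x :: "real ^ 'd::finite"
  assumes x: "x \<in> grid n" and n: "2 \<le> n"
  shows "span ((\<lambda>y. y - x) ` grid n) = UNIV"
proof -
  have "axis i 1 \<in> span ((\<lambda>y. y - x) ` grid n)" for i :: 'd
  proof -
    obtain k where k: "1 \<le> k" "k \<le> n" "x $ i = real k" using x unfolding grid_def by force
    have up: "(\<chi> j. if j = i then real l else x $ j) \<in> grid n" if "1 \<le> l" "l \<le> n" for l
      using x that by (auto simp: grid_def)
    show ?thesis
    proof (cases "k < n")
      case True
      have "(\<chi> j. if j = i then real (k + 1) else x $ j) - x = axis i 1"
        using k by (auto simp: vec_eq_iff axis_def)
      then show ?thesis using True by (intro span_base image_eqI[OF _ up[of "k + 1"]]) auto
    next
      case False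
      then have "(\<chi> j. if j = i then real (k - 1) else x $ j) - x = - axis i 1"
        using k n by (auto simp: vec_eq_iff axis_def of_nat_diff)
      moreover have "(\<chi> j. if j = i then real (k - 1) else x $ j) \<in> grid n"
        by (rule up) (use False k n in auto)
      ultimately have "- axis i 1 \<in> span ((\<lambda>y. y - x) ` grid n)"
        by (intro span_base image_eqI) auto
      then show ?thesis using span_neg[of "- axis i 1"] by simp
    qed
  qed
  then have "Basis \<subseteq> span ((\<lambda>y. y - x) ` grid n)" by (auto simp: Basis_vec_def)
  then have "span Basis \<subseteq> span ((\<lambda>y. y - x) ` grid n)" by (rule span_minimal[OF _ subspace_span])
  then show ?thesis by (intro antisym) auto
qed

lemma span_subset_extension:
  fixes A C :: "(real ^ 'd::finite) set"
  assumes "A \<subseteq> C" "span C = UNIV" "dim A \<le> s" "s \<le> CARD('d)"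
  obtains B where "B \<subseteq> C" "independent B" "card B = s" "A \<subseteq> span B"
proof -
  obtain B0 where B0: "B0 \<subseteq> A" "independent B0" "A \<subseteq> span B0" "card B0 = dim A"
    using basis_exists[of A] by blast
  obtain B1 where B1: "B0 \<subseteq> B1" "B1 \<subseteq> C" "independent B1" "C \<subseteq> span B1"
    using maximal_independent_subset_extend[of B0 C] B0 assms(1) by blast
  have "UNIV \<subseteq> span B1" using span_minimal[OF B1(4) subspace_span] assms(2) by simp
  then have "dim (UNIV :: (real ^ 'd) set) = card B1"
    by (rule dim_unique[OF subset_UNIV _ B1(3) refl])
  then have c1: "card B1 = CARD('d)" by simp
  have fin1: "finite B1" using B1(3) independent_imp_finite by blast
  obtain B where "B0 \<subseteq> B" "B \<subseteq> B1" "card B = s"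
    using exists_subset_between[OF _ _ B1(1) fin1, of s] B0(4) assms(3,4) c1 by auto
  show ?thesis
  proof (rule that)
    show "B \<subseteq> C" using \<open>B \<subseteq> B1\<close> B1(2) by (rule order.trans)
    show "independent B" using B1(3) \<open>B \<subseteq> B1\<close> by (rule independent_mono)
    show "card B = s" by fact
    show "A \<subseteq> span B" using B0(3) span_mono[OF \<open>B0 \<subseteq> B\<close>] by (rule order.trans)
  qed
qed

definition basis_const :: "nat \<Rightarrow> nat \<Rightarrow> real" where
  "basis_const d s = (10 * 3 ^ d) ^ (d * s)"

text \<open>\<open>A\<close> may have few grid points and an irrational direction. It is replaced by
  a flat through \<open>x\<close> that contains \<open>Q\<close> and is spanned by grid differences,
  padded to dimension \<open>s\<close> if \<open>Q\<close> spans less. Then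
  \<open>short_basis\<close> is applied to all grid points of the new flat, with
  \<open>L = n\<close>.\<close>

lemma rich_flat:
  fixes A :: "(real ^ 'd::finite) set"
  assumes n: "2 \<le> n" and s: "s \<le> CARD('d)" and A: "affine A" "aff_dim A = int s"
    and Q: "Q \<subseteq> A \<inter> grid n" and x: "x \<in> Q"
  obtains B where "B \<in> dirs s" "B \<subseteq> diffs (grid n)" "Q \<subseteq> flat x B"
    "real (card (grid n \<inter> flat x B)) * (\<Prod>b\<in>B. infnorm b) \<le> basis_const CARD('d) s * real n ^ s"
proof -
  have xA: "x \<in> A" "x \<in> grid n" using Q x by auto
  have "aff_dim A = int (dim ((\<lambda>y. -x + y) ` A))"
    using hull_inc[of x A affine] xA by (intro aff_dim_eq_dim) auto
  then have "dim ((\<lambda>y. -x + y) ` A) = s" using A by simp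
  moreover have "(\<lambda>y. y - x) ` Q \<subseteq> (\<lambda>y. -x + y) ` A" using Q by auto
  ultimately have dQ: "dim ((\<lambda>y. y - x) ` Q) \<le> s" by (metis dim_subset)
  obtain B0 where B0: "B0 \<subseteq> (\<lambda>y. y - x) ` grid n" "independent B0" "card B0 = s" "(\<lambda>y. y - x) ` Q \<subseteq> span B0"
    using span_subset_extension[of "(\<lambda>y. y - x) ` Q" "(\<lambda>y. y - x) ` grid n" s]
      grid_differences_span[OF xA(2) n] Q dQ s by (metis (no_types, lifting) Int_lower2 image_mono order.trans)
  define P where "P = grid n \<inter> flat x B0"
  have finP: "finite P" by (simp add: P_def finite_grid)
  have xP: "x \<in> P" using xA by (simp add: P_def flat_def span_zero)
  have sub: "diffs P \<subseteq> span B0"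
  proof
    fix z assume "z \<in> diffs P"
    then obtain a b where "a - x \<in> span B0" "b - x \<in> span B0" "z = (a - x) - (b - x)"
      by (auto simp: diffs_def P_def flat_def)
    then show "z \<in> span B0" using span_diff[of "a - x" B0 "b - x"] by simp
  qed
  have "B0 \<subseteq> diffs P"
  proof
    fix b assume b: "b \<in> B0"
    then obtain y where "y \<in> grid n" "b = y - x" using B0 by auto
    then have "y \<in> P" using b by (simp add: P_def flat_def span_base)
    then show "b \<in> diffs P" using \<open>b = y - x\<close> xP by (auto simp: diffs_def)
  qed
  then have "dim (diffs P) = s"
    by (rule dim_unique[OF _ sub B0(2,3)])
  moreover have "infnorm z \<le> real n" if "z \<in> diffs P" for z
    using that grid_diff_infnorm by (auto simp: diffs_def P_def)
  ultimately obtain B where B: "B \<subseteq> diffs P" "independent B" "card B = s"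
    "real (card P) * (\<Prod>b\<in>B. infnorm b) \<le> (10 * 3 ^ CARD('d)) ^ (CARD('d) * s) * real n ^ s"
    using short_basis[OF finP, of "real n"] xP by auto
  have "span B0 \<subseteq> span B"
  proof (rule card_ge_dim_independent)
    show "B \<subseteq> span B0" using B(1) sub by (rule order.trans)
    show "dim (span B0) \<le> card B" using B0(2,3) B(3) by (simp add: dim_eq_card_independent)
  qed (rule B(2))
  moreover have "span B \<subseteq> span B0"
    using B(1) sub by (meson span_minimal subspace_span order.trans)
  ultimately have eq: "flat x B = flat x B0" by (auto simp: flat_def)
  show ?thesis
  proof (rule that)
    have "intvec b" if "b \<in> B" for b
      using that B(1) grid_intvec intvec_diff by (fastforce simp: diffs_def P_def)
    then show "B \<in> dirs s" using B by (simp add: dirs_def)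
    show "B \<subseteq> diffs (grid n)" using B(1) unfolding diffs_def P_def by blast
    show "Q \<subseteq> flat x B" using B0(4) by (auto simp: eq) (auto simp: flat_def)
    show "real (card (grid n \<inter> flat x B)) * (\<Prod>b\<in>B. infnorm b) \<le> basis_const CARD('d) s * real n ^ s"
      using B(4) by (simp add: eq P_def basis_const_def)
  qed
qed

text \<open>With the bound 0, \<open>dominating_coordinates\<close> says that some \<open>s\<close>
  or fewer coordinates determine a point of the flat.\<close>

lemma card_grid_flat:
  fixes x :: "real ^ 'd::finite"
  assumes "B \<in> dirs s" "1 \<le> n"
  shows "card (grid n \<inter> flat x B) \<le> n ^ s"
proof -
  have "dim (span B) = s" using assms by (simp add: dirs_def dim_eq_card_independent)
  then obtain I where I: "card I \<le> s"
    "\<And>x b. x \<in> span B \<Longrightarrow> 0 \<le> b \<Longrightarrow> (\<forall>i\<in>I. \<bar>x $ i\<bar> \<le> b) \<Longrightarrow> infnorm x \<le> 3 ^ s * b"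
    using dominating_coordinates[OF subspace_span, of B s] by auto
  define f where "f = (\<lambda>y :: real ^ 'd. restrict (\<lambda>i. y $ i) I)"
  have "inj_on f (grid n \<inter> flat x B)"
  proof (rule inj_onI)
    fix y z assume yz: "y \<in> grid n \<inter> flat x B" "z \<in> grid n \<inter> flat x B" "f y = f z"
    have "(y - x) - (z - x) \<in> span B" by (rule span_diff) (use yz in \<open>auto simp: flat_def\<close>)
    then have "y - z \<in> span B" by simp
    moreover have "\<forall>i\<in>I. \<bar>(y - z) $ i\<bar> \<le> 0"
    proof
      fix i assume "i \<in> I"
      then show "\<bar>(y - z) $ i\<bar> \<le> 0" using fun_cong[OF yz(3), of i] by (simp add: f_def)
    qed
    ultimately have "infnorm (y - z) \<le> 0" using I(2)[of "y - z" 0] by simp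
    then show "y = z" using infnorm_pos_le[of "y - z"] infnorm_eq_0[of "y - z"] by simp
  qed
  moreover have "f ` (grid n \<inter> flat x B) \<subseteq> PiE I (\<lambda>_. real ` {1..n})"
    by (auto simp: f_def grid_def)
  moreover have "finite (PiE I (\<lambda>_. real ` {1..n}))" by (intro finite_PiE) auto
  ultimately have "card (grid n \<inter> flat x B) \<le> card (PiE I (\<lambda>_. real ` {1..n}))"
    by (rule card_inj_on_le)
  also have "\<dots> = n ^ card I" by (simp add: card_PiE card_image)
  also have "\<dots> \<le> n ^ s" using I(1) assms(2) by (intro power_increasing) auto
  finally show ?thesis .
qed

section \<open>Convergence of the sum over integer bases\<close>

lemma sum_int_powr_bounded:
  assumes "1 < a"
  obtains K where "0 \<le> K" "\<And>F. finite F \<Longrightarrow> (\<Sum>z\<in>F. max 1 \<bar>real_of_int z\<bar> powr - a) \<le> K"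
proof -
  define b where "b = (\<lambda>n::nat. max 1 (real n) powr - a)"
  have "summable (\<lambda>n. real n powr - a)" using assms by (simp add: summable_real_powr_iff)
  then have sb: "summable b"
    by (rule summable_cong[THEN iffD1, rotated])
      (auto simp: b_def eventually_sequentially max_def intro!: exI[of _ 1])
  have part: "(\<Sum>z\<in>F. max 1 \<bar>real_of_int z\<bar> powr - a) \<le> suminf b"
    if "finite F" "inj_on (\<lambda>z. nat \<bar>z\<bar>) F" for F
  proof -
    have "(\<Sum>z\<in>F. max 1 \<bar>real_of_int z\<bar> powr - a) = (\<Sum>n\<in>(\<lambda>z. nat \<bar>z\<bar>) ` F. b n)"
      by (subst sum.reindex[OF that(2)]) (auto simp: b_def intro!: sum.cong)
    also have "\<dots> \<le> suminf b" using that(1) by (intro sum_le_suminf sb) (auto simp: b_def)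
    finally show ?thesis .
  qed
  show ?thesis
  proof (rule that)
    show "0 \<le> 2 * suminf b" using suminf_nonneg[OF sb] by (simp add: b_def)
    fix F :: "int set" assume F: "finite F"
    have "F = {z\<in>F. 0 \<le> z} \<union> {z\<in>F. z < 0}" by auto
    then have "(\<Sum>z\<in>F. max 1 \<bar>real_of_int z\<bar> powr - a) =
        (\<Sum>z\<in>{z\<in>F. 0 \<le> z}. max 1 \<bar>real_of_int z\<bar> powr - a) + (\<Sum>z\<in>{z\<in>F. z < 0}. max 1 \<bar>real_of_int z\<bar> powr - a)"
      using F by (subst sum.union_disjoint[symmetric]) auto
    also have "\<dots> \<le> suminf b + suminf b"
      using F by (intro add_mono part) (auto simp: inj_on_def)
    finally show "(\<Sum>z\<in>F. max 1 \<bar>real_of_int z\<bar> powr - a) \<le> 2 * suminf b" by simp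
  qed
qed

lemma intvec_infnorm_ge:
  fixes v :: "real ^ 'd::finite"
  assumes "intvec v" "v \<noteq> 0"
  shows "1 \<le> infnorm v"
proof -
  obtain i where i: "v $ i \<noteq> 0" using assms(2) by (auto simp: vec_eq_iff)
  then have "1 \<le> \<bar>v $ i\<bar>" using assms(1) Ints_nonzero_abs_ge1 by (auto simp: intvec_def)
  also have "\<dots> \<le> infnorm v" by (rule component_le_infnorm_cart)
  finally show ?thesis .
qed

text \<open>The exponent \<open>d + 1\<close> is shared equally among the \<open>d\<close>
  coordinates. Each receives \<open>a = 1 + 1 / d\<close>, still larger than 1, so the sum is
  bounded by the \<open>d\<close>-th power of a convergent sum over the integers.\<close>

lemma sum_intvec_bounded:
  obtains K where "\<And>F :: (real ^ 'd::finite) set. finite F \<Longrightarrow> (\<And>v. v \<in> F \<Longrightarrow> intvec v \<and> v \<noteq> 0) \<Longrightarrow>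
    (\<Sum>v\<in>F. (1 / infnorm v) ^ (CARD('d) + 1)) \<le> K"
proof -
  define d where "d = CARD('d)"
  define a where "a = 1 + 1 / real d"
  have d0: "0 < d" by (simp add: d_def)
  have a0: "0 \<le> a" by (simp add: a_def add_nonneg_nonneg)
  obtain K where K: "0 \<le> K" "\<And>F. finite F \<Longrightarrow> (\<Sum>z\<in>F. max 1 \<bar>real_of_int z\<bar> powr - a) \<le> K"
    using sum_int_powr_bounded[of a] d0 by (auto simp: a_def)
  show ?thesis
  proof (rule that)
    fix F :: "(real ^ 'd) set"
    assume F: "finite F" "\<And>v. v \<in> F \<Longrightarrow> intvec v \<and> v \<noteq> 0"
    define w where "w = (\<lambda>z. max 1 \<bar>real_of_int z\<bar> powr - a)"
    define fl where "fl = (\<lambda>(v :: real ^ 'd) i. \<lfloor>v $ i\<rfloor>)"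
    define Z where "Z = (\<lambda>(v, i). \<lfloor>v $ i\<rfloor>) ` (F \<times> UNIV)"
    have finZ: "finite Z" using F(1) by (simp add: Z_def)
    have flr: "real_of_int (fl v i) = v $ i" if "v \<in> F" for v i
      using F(2)[OF that] by (metis fl_def intvec_def Ints_cases floor_of_int)
    have inj: "inj_on fl F"
    proof (rule inj_onI)
      fix v u assume "v \<in> F" "u \<in> F" "fl v = fl u"
      then show "v = u" using flr by (metis vec_eq_iff)
    qed
    have "(\<Sum>v\<in>F. (1 / infnorm v) ^ (d + 1)) \<le> (\<Sum>v\<in>F. \<Prod>i\<in>UNIV. w (fl v i))"
    proof (rule sum_mono)
      fix v assume v: "v \<in> F"
      have n1: "1 \<le> infnorm v" using F(2)[OF v] intvec_infnorm_ge by blast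
      have "real d * a = real (d + 1)" using d0 by (simp add: a_def field_simps)
      then have "(infnorm v powr - a) ^ d = infnorm v powr - real (d + 1)"
        using n1 by (simp add: powr_powr mult.commute flip: powr_realpow)
      also have "\<dots> = (1 / infnorm v) ^ (d + 1)"
        using n1 by (simp add: powr_minus_divide power_one_over powr_realpow del: of_nat_add of_nat_Suc power_Suc)
      finally have "(1 / infnorm v) ^ (d + 1) = (\<Prod>i\<in>(UNIV::'d set). infnorm v powr - a)" by (simp add: d_def)
      also have "\<dots> \<le> (\<Prod>i\<in>UNIV. w (fl v i))"
      proof (rule prod_mono)
        fix i :: 'd
        have "max 1 \<bar>real_of_int (fl v i)\<bar> \<le> infnorm v"
          using n1 component_le_infnorm_cart[of v i] by (simp add: flr[OF v])
        then show "0 \<le> infnorm v powr - a \<and> infnorm v powr - a \<le> w (fl v i)"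
          unfolding w_def using a0 by (auto intro!: powr_mono2')
      qed
      finally show "(1 / infnorm v) ^ (d + 1) \<le> (\<Prod>i\<in>UNIV. w (fl v i))" .
    qed
    also have "\<dots> = (\<Sum>f\<in>fl ` F. \<Prod>i\<in>UNIV. w (f i))" by (simp add: sum.reindex[OF inj])
    also have "\<dots> \<le> (\<Sum>f\<in>PiE UNIV (\<lambda>_::'d. Z). \<Prod>i\<in>UNIV. w (f i))"
      using finZ by (intro sum_mono2 finite_PiE prod_nonneg) (auto simp: fl_def Z_def w_def)
    also have "\<dots> = (\<Prod>i\<in>(UNIV::'d set). \<Sum>z\<in>Z. w z)"
      using finZ by (subst prod_sum_PiE) auto
    also have "\<dots> \<le> K ^ d"
      using K(2)[OF finZ] by (simp add: d_def w_def sum_nonneg power_mono)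
    finally show "(\<Sum>v\<in>F. (1 / infnorm v) ^ (CARD('d) + 1)) \<le> K ^ d" by (simp add: d_def)
  qed
qed

definition height :: "(real ^ 'd::finite) set \<Rightarrow> real" where
  "height B = (\<Prod>b\<in>B. infnorm b)"

lemma dirs_nonzero: "B \<in> dirs s \<Longrightarrow> b \<in> B \<Longrightarrow> intvec b \<and> b \<noteq> 0"
  by (auto simp: dirs_def dest: dependent_zero)

lemma dirs_finite: "B \<in> dirs s \<Longrightarrow> finite B"
  by (auto simp: dirs_def intro: independent_imp_finite)

lemma height_ge_1: "B \<in> dirs s \<Longrightarrow> 1 \<le> height B"
  unfolding height_def by (rule prod_ge_1) (use dirs_nonzero intvec_infnorm_ge in blast)

text \<open>Distinct bases are distinct subsets of a finite set of integer vectors. Hence the sum is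
  at most the product of all \<open>1 + g v\<close>, and so at most the exponential of the sum of
  all \<open>g v\<close>.\<close>

lemma height_sum_bounded:
  obtains K where "\<And>\<B> :: (real ^ 'd::finite) set set. finite \<B> \<Longrightarrow> \<B> \<subseteq> dirs s \<Longrightarrow>
    (\<Sum>B\<in>\<B>. (1 / height B) ^ (CARD('d) + 1)) \<le> K"
proof -
  obtain K where K: "\<And>F :: (real ^ 'd::finite) set. finite F \<Longrightarrow> (\<And>v. v \<in> F \<Longrightarrow> intvec v \<and> v \<noteq> 0) \<Longrightarrow>
    (\<Sum>v\<in>F. (1 / infnorm v) ^ (CARD('d) + 1)) \<le> K" by (rule sum_intvec_bounded[where 'd = 'd]) blast
  show ?thesis
  proof (rule that)
    fix \<B> :: "(real ^ 'd) set set" assume \<B>: "finite \<B>" "\<B> \<subseteq> dirs s"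
    define g where "g = (\<lambda>v :: real ^ 'd. (1 / infnorm v) ^ (CARD('d) + 1))"
    have g0: "0 \<le> g v" for v by (simp add: g_def infnorm_pos_le)
    have finF: "finite (\<Union>\<B>)" using \<B> dirs_finite by blast
    have "(\<Sum>B\<in>\<B>. (1 / height B) ^ (CARD('d) + 1)) = (\<Sum>B\<in>\<B>. \<Prod>b\<in>B. g b)"
    proof (rule sum.cong[OF refl])
      fix B :: "(real ^ 'd) set"
      have "1 / height B = (\<Prod>b\<in>B. 1 / infnorm b)" by (simp add: height_def prod_dividef)
      then show "(1 / height B) ^ (CARD('d) + 1) = (\<Prod>b\<in>B. g b)"
        by (simp only: g_def prod_power_distrib)
    qed
    also have "\<dots> \<le> (\<Sum>B\<in>Pow (\<Union>\<B>). \<Prod>b\<in>B. g b)"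
      using finF g0 by (intro sum_mono2 prod_nonneg) auto
    also have "\<dots> = (\<Prod>v\<in>\<Union>\<B>. g v + 1)" using prod_add[OF finF, of g "\<lambda>_. 1"] by simp
    also have "\<dots> \<le> (\<Prod>v\<in>\<Union>\<B>. exp (g v))"
      using g0 by (intro prod_mono) (auto simp: add.commute add_nonneg_nonneg intro!: exp_ge_add_one_self)
    also have "\<dots> = exp (\<Sum>v\<in>\<Union>\<B>. g v)" using finF by (simp add: exp_sum)
    also have "\<dots> \<le> exp K"
      unfolding exp_le_cancel_iff g_def using \<B> dirs_nonzero finF by (intro K) blast+
    finally show "(\<Sum>B\<in>\<B>. (1 / height B) ^ (CARD('d) + 1)) \<le> exp K" .
  qed
qed

text \<open>The source of the exceptional directions: a finite family whose sum is within
  \<open>\<epsilon>\<close> of the supremum leaves at most \<open>\<epsilon>\<close> for any finite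
  family disjoint from it.\<close>

lemma height_sum_tail:
  assumes "0 < \<epsilon>"
  obtains \<E> :: "(real ^ 'd::finite) set set" where "finite \<E>" "\<E> \<subseteq> dirs s"
    "\<And>\<B>. finite \<B> \<Longrightarrow> \<B> \<subseteq> dirs s - \<E> \<Longrightarrow> (\<Sum>B\<in>\<B>. (1 / height B) ^ (CARD('d) + 1)) \<le> \<epsilon>"
proof -
  let ?\<sigma> = "\<lambda>\<B> :: (real ^ 'd) set set. (\<Sum>B\<in>\<B>. (1 / height B) ^ (CARD('d) + 1))"
  define X where "X = ?\<sigma> ` {\<B>. finite \<B> \<and> \<B> \<subseteq> dirs s}"
  obtain K where K: "\<And>\<B> :: (real ^ 'd::finite) set set. finite \<B> \<Longrightarrow> \<B> \<subseteq> dirs s \<Longrightarrow> ?\<sigma> \<B> \<le> K"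
    by (rule height_sum_bounded[where 'd = 'd and s = s]) blast
  have bdd: "bdd_above X" unfolding X_def using K by (intro bdd_aboveI[of _ K]) auto
  have "X \<noteq> {}" by (auto simp: X_def)
  then obtain y where y: "y \<in> X" "Sup X - \<epsilon> < y"
    using less_cSupD[of X "Sup X - \<epsilon>"] assms by auto
  then obtain \<E> where \<E>: "finite \<E>" "\<E> \<subseteq> dirs s" "y = ?\<sigma> \<E>" by (auto simp: X_def)
  show ?thesis
  proof (rule that[OF \<E>(1,2)])
    fix \<B> assume \<B>: "finite \<B>" "\<B> \<subseteq> dirs s - \<E>"
    have "?\<sigma> \<E> + ?\<sigma> \<B> = ?\<sigma> (\<E> \<union> \<B>)"
      using \<E>(1) \<B> by (intro sum.union_disjoint[symmetric]) auto
    also have "\<dots> \<le> Sup X" using \<E> \<B> by (intro cSup_upper bdd) (auto simp: X_def)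
    finally show "?\<sigma> \<B> \<le> \<epsilon>" using y \<E>(3) by linarith
  qed
qed

section \<open>Deletion, and the case of large \<open>k\<close>\<close>

text \<open>The directions that \<open>rich_flat\<close> can return at \<open>x\<close>. The
  inclusion in \<open>diffs (grid n)\<close> makes their number finite, and the last condition says
  that flats of large height are poor in grid points.\<close>

definition short_dirs :: "nat \<Rightarrow> nat \<Rightarrow> real ^ 'd \<Rightarrow> (real ^ 'd::finite) set set" where
  "short_dirs n s x = {B \<in> dirs s. B \<subseteq> diffs (grid n) \<and>
     real (card (grid n \<inter> flat x B)) * height B \<le> basis_const CARD('d) s * real n ^ s}"

lemma finite_short_dirs: "finite (short_dirs n s x)"
proof (rule finite_subset)
  show "short_dirs n s x \<subseteq> Pow ((\<lambda>(a, b). a - b) ` (grid n \<times> grid n))"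
    by (auto simp: short_dirs_def diffs_def)
  show "finite (Pow ((\<lambda>(a, b). a - b) ` (grid n \<times> grid n)))"
    by (simp add: finite_grid)
qed

definition crowded :: "nat \<Rightarrow> real ^ 'd \<Rightarrow> (real ^ 'd::finite) set \<Rightarrow> (real ^ 'd) set \<Rightarrow> bool" where
  "crowded k x B S \<longleftrightarrow> x \<in> S \<and> k < card (S \<inter> flat x B)"

text \<open>Some outcome has size minus number of crowded pairs at least \<open>a - b\<close>; every
  point in a crowded pair is removed. If more than \<open>k\<close> survivors lay on
  \<open>A\<close>, then \<open>rich_flat\<close> would put them on a flat through any one of them,
  \<open>x\<close> say, and \<open>x\<close> would have been removed.\<close>

lemma deletion:
  fixes \<Omega> :: "(real ^ 'd::finite) set set"
  assumes E: "averaging \<Omega> E" and \<Omega>: "\<And>S. S \<in> \<Omega> \<Longrightarrow> S \<subseteq> grid n"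
    and n: "2 \<le> n" and s: "s \<le> CARD('d)"
    and size: "a \<le> (\<Sum>x\<in>grid n. E (\<lambda>S. of_bool (x \<in> S)))"
    and bad: "(\<Sum>x\<in>grid n. \<Sum>B\<in>short_dirs n s x. E (\<lambda>S. of_bool (crowded k x B S))) \<le> b"
  shows "\<exists>S \<subseteq> (grid n :: (real ^ 'd) set). a - b \<le> real (card S) \<and>
    (\<forall>A. affine A \<and> aff_dim A = int s \<longrightarrow> card (S \<inter> A) \<le> k)"
proof -
  interpret averaging \<Omega> E by (rule E)
  let ?bad = "\<lambda>S. \<Sum>x\<in>grid n. \<Sum>B\<in>short_dirs n s x. of_bool (crowded k x B S) :: real"
  have fin: "finite (grid n :: (real ^ 'd) set)" by (rule finite_grid)
  obtain S where S: "S \<in> \<Omega>"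
    "E (\<lambda>S. (\<Sum>x\<in>grid n. of_bool (x \<in> S)) - ?bad S) \<le> (\<Sum>x\<in>grid n. of_bool (x \<in> S)) - ?bad S"
    using ex_ge by blast
  have SP: "S \<subseteq> grid n" using S(1) by (rule \<Omega>)
  have "(\<Sum>x\<in>grid n. of_bool (x \<in> S)) = real (card S)"
    using fin SP by (simp add: Int_absorb1)
  moreover have "E (\<lambda>S. (\<Sum>x\<in>grid n. of_bool (x \<in> S)) - ?bad S) =
      (\<Sum>x\<in>grid n. E (\<lambda>S. of_bool (x \<in> S))) -
      (\<Sum>x\<in>grid n. \<Sum>B\<in>short_dirs n s x. E (\<lambda>S. of_bool (crowded k x B S)))"
    by (simp only: diff sum[OF fin] sum[OF finite_short_dirs])
  ultimately have main: "a - b \<le> real (card S) - ?bad S" using S(2) size bad by linarith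
  define D where "D = {x\<in>S. \<exists>B\<in>short_dirs n s x. crowded k x B S}"
  have finS: "finite S" using SP fin finite_subset by blast
  have "real (card D) = (\<Sum>x\<in>D. 1)" by simp
  also have "\<dots> \<le> (\<Sum>x\<in>D. \<Sum>B\<in>short_dirs n s x. of_bool (crowded k x B S))"
  proof (rule sum_mono)
    fix x assume "x \<in> D"
    then obtain B where B: "B \<in> short_dirs n s x" "crowded k x B S" by (auto simp: D_def)
    then have "(1::real) = of_bool (crowded k x B S)" by simp
    also have "\<dots> \<le> (\<Sum>B\<in>short_dirs n s x. of_bool (crowded k x B S))"
      using B(1) finite_short_dirs by (intro member_le_sum) auto
    finally show "1 \<le> (\<Sum>B\<in>short_dirs n s x. of_bool (crowded k x B S) :: real)" .
  qed
  also have "\<dots> \<le> ?bad S"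
    using fin SP by (intro sum_mono2 sum_nonneg) (auto simp: D_def)
  finally have cD: "real (card D) \<le> ?bad S" .
  have "D \<subseteq> S" by (auto simp: D_def)
  then have "card (S - D) = card S - card D" "card D \<le> card S"
    using finS by (auto simp: card_Diff_subset finite_subset card_mono)
  then have "a - b \<le> real (card (S - D))" using main cD by (simp add: of_nat_diff)
  moreover have "card ((S - D) \<inter> A) \<le> k" if A: "affine A" "aff_dim A = int s" for A
  proof (rule ccontr)
    assume n: "\<not> card ((S - D) \<inter> A) \<le> k"
    then have "(S - D) \<inter> A \<noteq> {}" by (metis card.empty le0)
    then obtain x where x: "x \<in> (S - D) \<inter> A" by blast
    have "(S - D) \<inter> A \<subseteq> A \<inter> grid n" using SP by auto
    from rich_flat[OF \<open>2 \<le> n\<close> s A this x] obtain B where B: "B \<in> dirs s" "B \<subseteq> diffs (grid n)"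
      "(S - D) \<inter> A \<subseteq> flat x B"
      "real (card (grid n \<inter> flat x B)) * (\<Prod>b\<in>B. infnorm b) \<le> basis_const CARD('d) s * real n ^ s" by blast
    have "card ((S - D) \<inter> A) \<le> card (S \<inter> flat x B)" using finS B(3) by (intro card_mono) auto
    then have "crowded k x B S" using n x by (simp add: crowded_def)
    moreover have "B \<in> short_dirs n s x" using B by (simp add: short_dirs_def height_def)
    ultimately show False using x by (auto simp: D_def)
  qed
  ultimately show ?thesis using SP by (intro exI[of _ "S - D"]) auto
qed

section \<open>Exponential tails and large k\<close>

lemma bern_member: "finite P \<Longrightarrow> x \<in> P \<Longrightarrow> bern P p (\<lambda>B. of_bool (x \<in> B)) = p"
  using bern_in_out[of P "{x}" "{}" p] by simp

text \<open>Chernoff's bound, with the presence of \<open>x\<close> split off as a factor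
  \<open>p\<close>. As \<open>x\<close> is itself counted in \<open>B \<inter> X\<close>, at least
  \<open>k\<close> of the other points are present, hence the power
  \<open>\<mu> ^ k\<close>.\<close>

lemma bern_tail:
  assumes P: "finite P" "X \<subseteq> P" "x \<in> X" and p: "0 \<le> p" "p \<le> 1" and \<mu>: "1 \<le> \<mu>"
  shows "bern P p (\<lambda>B. of_bool (x \<in> B \<and> k < card (B \<inter> X))) \<le>
    p * (exp (p * (\<mu> - 1) * real (card X)) / \<mu> ^ k)"
proof -
  have xP: "x \<in> P" and finX: "finite X" using P finite_subset by auto
  \<comment> \<open>\<open>w B\<close> is \<open>\<mu> ^ (card (B \<inter> X) - 1)\<close> if \<open>x \<in> B\<close>, and 0 otherwise\<close>
  define w where "w = (\<lambda>B. \<Prod>y\<in>P. if y \<in> B then (if y \<in> X - {x} then \<mu> else 1) else (if y = x then 0 else 1))"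
  have weight: "of_bool (x \<in> B \<and> k < card (B \<inter> X)) \<le> 1 / \<mu> ^ k * w B" if B: "B \<in> Pow P" for B
  proof (cases "x \<in> B \<and> k < card (B \<inter> X)")
    case True
    have "w B = (\<Prod>y\<in>P. if y \<in> B \<inter> X - {x} then \<mu> else 1)"
      unfolding w_def using True by (intro prod.cong) auto
    also have "\<dots> = \<mu> ^ card (B \<inter> X - {x})"
      using prod_if_subset[of P "B \<inter> X - {x}" \<mu> 1] P B by auto
    finally have wB: "w B = \<mu> ^ card (B \<inter> X - {x})" .
    have "card (B \<inter> X - {x}) = card (B \<inter> X) - 1"
      using True P(3) finX by (simp add: card_Diff_singleton)
    then have "k \<le> card (B \<inter> X - {x})" using True by arith
    then have "\<mu> ^ k \<le> w B" unfolding wB using \<mu> by (rule power_increasing)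
    then show ?thesis using True \<mu> by (simp add: field_simps)
  next
    case False
    have "0 \<le> w B" unfolding w_def using \<mu> by (intro prod_nonneg) auto
    moreover have "of_bool (x \<in> B \<and> k < card (B \<inter> X)) = (0::real)" using False by auto
    ultimately show ?thesis using \<mu> by (simp only:) simp
  qed
  interpret averaging "Pow P" "bern P p" using P p by (intro averaging_bern) auto
  have "bern P p (\<lambda>B. of_bool (x \<in> B \<and> k < card (B \<inter> X))) \<le> bern P p (\<lambda>B. 1 / \<mu> ^ k * w B)"
    using weight by (rule mono)
  also have "\<dots> = 1 / \<mu> ^ k * bern P p w" by (rule scale)
  also have "bern P p w = (\<Prod>y\<in>P. p * (if y \<in> X - {x} then \<mu> else 1) + (1 - p) * (if y = x then 0 else 1))"
    unfolding w_def by (rule bern_prod[OF P(1)])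
  also have "\<dots> = (\<Prod>y\<in>P. (if y \<in> {x} then p else 1) * (if y \<in> X - {x} then 1 + p * (\<mu> - 1) else 1))"
    by (intro prod.cong) (auto simp: algebra_simps)
  also have "\<dots> = p * (1 + p * (\<mu> - 1)) ^ card (X - {x})"
    using P xP prod_if_subset[of P "{x}" p 1] prod_if_subset[of P "X - {x}" "1 + p * (\<mu> - 1)" 1]
    unfolding prod.distrib by auto
  also have "\<dots> \<le> p * exp (p * (\<mu> - 1) * real (card X))"
  proof (intro mult_left_mono p)
    have "(1 + p * (\<mu> - 1)) ^ card (X - {x}) \<le> (1 + p * (\<mu> - 1)) ^ card X"
      using p \<mu> finX by (intro power_increasing card_mono) auto
    also have "\<dots> \<le> exp (p * (\<mu> - 1)) ^ card X"
      using p \<mu> by (intro power_mono exp_ge_add_one_self) auto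
    also have "\<dots> = exp (p * (\<mu> - 1) * real (card X))" by (simp add: mult.commute flip: exp_of_nat_mult)
    finally show "(1 + p * (\<mu> - 1)) ^ card (X - {x}) \<le> exp (p * (\<mu> - 1) * real (card X))" .
  qed
  finally show ?thesis using \<mu> by (simp add: field_simps)
qed

lemma basis_const_pos: "0 < basis_const d s"
  by (simp add: basis_const_def)

text \<open>A single random set of density slightly below \<open>k / n ^ s\<close>, with one tilt
  \<open>\<mu>\<close> for the exceptional directions and another for the rest. Every bound carries
  the factor \<open>p\<close>, so the loss is a small proportion of the set.\<close>

lemma large_k:
  fixes \<eta> :: real
  assumes \<eta>: "0 < \<eta>" "\<eta> < 1" and s: "s \<le> CARD('d::finite)"
  obtains K0 where "\<And>n k. 2 \<le> n \<Longrightarrow> K0 \<le> k \<Longrightarrow> CARD('d) + 1 \<le> k \<Longrightarrow> k \<le> n ^ s \<Longrightarrow>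
    \<exists>S \<subseteq> (grid n :: (real ^ 'd) set). (1 - \<eta>) * real k * real n ^ (CARD('d) - s) \<le> real (card S) \<and>
      (\<forall>A. affine A \<and> aff_dim A = int s \<longrightarrow> card (S \<inter> A) \<le> k)"
proof -
  define d where "d = CARD('d)"
  define C where "C = basis_const d s"
  define t where "t = \<eta> / 2"
  have t: "0 < t" "t < 1" using \<eta> by (auto simp: t_def)
  have C: "0 < C" by (simp add: C_def basis_const_pos)
  \<comment> \<open>The minimum with 1 forces \<open>exp 1 * C \<le> height B\<close> for every
    single \<open>B\<close> outside \<open>\<E>\<close>; the minimum with \<open>\<eta> / 4\<close>
    bounds the total loss in these directions.\<close>
  define \<epsilon> where "\<epsilon> = min 1 (\<eta> / 4) / (exp 1 * C) ^ (d + 1)"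
  have \<epsilon>: "0 < \<epsilon>" using \<eta> C by (simp add: \<epsilon>_def)
  obtain \<E> :: "(real ^ 'd) set set" where \<E>: "finite \<E>" "\<E> \<subseteq> dirs s"
    "\<And>\<B>. finite \<B> \<Longrightarrow> \<B> \<subseteq> dirs s - \<E> \<Longrightarrow> (\<Sum>B\<in>\<B>. (1 / height B) ^ (CARD('d) + 1)) \<le> \<epsilon>"
    using height_sum_tail[OF \<epsilon>] by blast
  \<comment> \<open>Chernoff's factor per unit of \<open>k\<close> when the mean is
    \<open>(1 - t) * k\<close> and the tilt is the optimal \<open>1 / (1 - t)\<close>.\<close>
  define \<gamma> where "\<gamma> = (1 - t) * exp t"
  have \<gamma>: "0 \<le> \<gamma>" "\<gamma> < 1"
  proof -
    show "0 \<le> \<gamma>" using t by (simp add: \<gamma>_def)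
    have "1 - t < (1 - t / 2)\<^sup>2" using t by (simp add: power2_eq_square algebra_simps)
    also have "\<dots> \<le> (exp (- t / 2))\<^sup>2" using t exp_ge_add_one_self[of "- t / 2"] by (intro power_mono) auto
    also have "\<dots> = exp (- t)" by (simp add: power2_eq_square flip: exp_add)
    finally show "\<gamma> < 1" by (simp add: \<gamma>_def exp_minus field_simps)
  qed
  \<comment> \<open>From this \<open>K0\<close> on, all exceptional directions together lose at most
    the proportion \<open>\<eta> / 4\<close>; adding 1 avoids a zero denominator.\<close>
  obtain K0 where K0: "\<gamma> ^ K0 < \<eta> / 4 / (real (card \<E>) + 1)"
    using real_arch_pow_inv[of "\<eta> / 4 / (real (card \<E>) + 1)" \<gamma>] \<gamma> \<eta> by auto
  show ?thesis
  proof (rule that)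
    fix n k :: nat
    assume n: "2 \<le> n" and k: "K0 \<le> k" "CARD('d) + 1 \<le> k" "k \<le> n ^ s"
    define p where "p = (1 - t) * real k / real n ^ s"
    have kn: "real k \<le> real n ^ s" using k(3) by (metis of_nat_le_iff of_nat_power)
    have ns: "0 < real n ^ s" using n by simp
    have "(1 - t) * real k \<le> 1 * real n ^ s" using t kn by (intro mult_mono) auto
    moreover have "0 \<le> (1 - t) * real k" using t by simp
    ultimately have p: "0 \<le> p" "p \<le> 1" using ns by (simp_all add: p_def)
    have "p * real n ^ d = (1 - t) * real k * real n ^ (d - s)"
    proof -
      have "real n ^ d = real n ^ (d - s) * real n ^ s" using s by (simp add: d_def flip: power_add)
      then show ?thesis using n by (simp add: p_def)
    qed
    have fin: "finite (grid n :: (real ^ 'd) set)" by (rule finite_grid)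
    let ?E = "bern (grid n :: (real ^ 'd) set) p"
    have bound: "?E (\<lambda>S. of_bool (crowded k x B S)) \<le> p * (exp (p * (\<mu> - 1) * M) / \<mu> ^ k)"
      if "x \<in> grid n" "1 \<le> \<mu>" "real (card (grid n \<inter> flat x B)) \<le> M" for x B \<mu> M
    proof -
      let ?X = "grid n \<inter> flat x B"
      interpret averaging "Pow (grid n)" ?E using fin p by (rule averaging_bern)
      have "?E (\<lambda>S. of_bool (crowded k x B S)) = ?E (\<lambda>S. of_bool (x \<in> S \<and> k < card (S \<inter> ?X)))"
        by (rule cong) (auto simp: crowded_def Int_absorb2 Int_assoc[symmetric])
      also have "\<dots> \<le> p * (exp (p * (\<mu> - 1) * real (card ?X)) / \<mu> ^ k)"
        using that p by (intro bern_tail fin) (auto simp: flat_def span_zero)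
      also have "\<dots> \<le> p * (exp (p * (\<mu> - 1) * M) / \<mu> ^ k)"
        using that p by (intro mult_left_mono divide_right_mono exp_le_cancel_iff[THEN iffD2]) auto
      finally show ?thesis .
    qed
    have exceptional: "?E (\<lambda>S. of_bool (crowded k x B S)) \<le> p * \<gamma> ^ k" if "x \<in> grid n" "B \<in> \<E>" for x B
    proof -
      have "card (grid n \<inter> flat x B) \<le> n ^ s" using that \<E> n by (intro card_grid_flat) auto
      then have "real (card (grid n \<inter> flat x B)) \<le> real n ^ s" by (metis of_nat_le_iff of_nat_power)
      then have "?E (\<lambda>S. of_bool (crowded k x B S)) \<le> p * (exp (p * (1 / (1 - t) - 1) * real n ^ s) / (1 / (1 - t)) ^ k)"
        using that t by (intro bound) auto
      also have "p * (1 / (1 - t) - 1) * real n ^ s = real k * t"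
        using t ns by (simp add: p_def field_simps)
      also have "exp (real k * t) / (1 / (1 - t)) ^ k = \<gamma> ^ k"
        using t exp_of_nat_mult[of k t] by (simp add: \<gamma>_def power_mult_distrib power_one_over mult.commute)
      finally show ?thesis .
    qed
    have tail: "?E (\<lambda>S. of_bool (crowded k x B S)) \<le> p * ((exp 1 * C) ^ (d + 1) * (1 / height B) ^ (d + 1))"
      if "x \<in> grid n" "B \<in> short_dirs n s x - \<E>" for x B
    proof -
      define h where "h = height B"
      have B: "B \<in> dirs s - \<E>" "real (card (grid n \<inter> flat x B)) * h \<le> C * real n ^ s"
        using that by (auto simp: short_dirs_def h_def C_def d_def)
      have h1: "1 \<le> h" using B height_ge_1 by (auto simp: h_def)
      \<comment> \<open>The tail bound for the family that consists of \<open>B\<close>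
        alone.\<close>
      have "(1 / h) ^ (d + 1) \<le> \<epsilon>" using \<E>(3)[of "{B}"] B by (simp add: h_def d_def)
      also have "\<epsilon> \<le> 1 / (exp 1 * C) ^ (d + 1)" using C by (simp add: \<epsilon>_def divide_right_mono)
      finally have "(exp 1 * C) ^ (d + 1) \<le> h ^ (d + 1)" using C h1
        by (simp add: power_one_over divide_simps del: power_Suc)
      then have Ch: "exp 1 * C \<le> h" using power_le_imp_le_base[of "exp 1 * C" d h] h1 by simp
      have "1 * C \<le> exp 1 * C" using C by (intro mult_right_mono) auto
      then have "C \<le> h" using Ch by linarith
      then have "1 \<le> h / C" using C by simp
      moreover have "real (card (grid n \<inter> flat x B)) \<le> C * real n ^ s / h" using B h1 by (simp add: field_simps)
      \<comment> \<open>The tilt is \<open>h / C\<close>. The mean is at most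
        \<open>k * C / h\<close>, so the exponential stays below \<open>exp k\<close>.\<close>
      ultimately have "?E (\<lambda>S. of_bool (crowded k x B S)) \<le> p * (exp (p * (h / C - 1) * (C * real n ^ s / h)) / (h / C) ^ k)"
        using that by (intro bound) auto
      also have "\<dots> \<le> p * (exp (real k) / (h / C) ^ k)"
      proof (intro mult_left_mono divide_right_mono p)
        have "p * (h / C - 1) * (C * real n ^ s / h) \<le> p * (h / C) * (C * real n ^ s / h)"
          using p C h1 by (intro mult_right_mono mult_left_mono) auto
        also have "\<dots> = (1 - t) * real k" using C h1 n by (simp add: p_def)
        also have "\<dots> \<le> 1 * real k" using t by (intro mult_right_mono) auto
        finally show "exp (p * (h / C - 1) * (C * real n ^ s / h)) \<le> exp (real k)" by simp
      qed (use C h1 in auto)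
      also have "exp (real k) / (h / C) ^ k = (exp 1 * C / h) ^ k"
        using C h1 exp_of_nat_mult[of k "1::real"] by (simp add: power_divide power_mult_distrib)
      \<comment> \<open>The ratio is at most 1, so its power may be lowered to the summable
        exponent; this is where \<open>d + 1 \<le> k\<close> enters.\<close>
      also have "p * (exp 1 * C / h) ^ k \<le> p * (exp 1 * C / h) ^ (d + 1)"
        using Ch C h1 k(2) p by (intro mult_left_mono power_decreasing) (auto simp: d_def field_simps)
      also have "(exp 1 * C / h) ^ (d + 1) = (exp 1 * C) ^ (d + 1) * (1 / h) ^ (d + 1)"
        by (simp only: power_mult_distrib[symmetric]) simp
      finally show ?thesis by (simp add: h_def)
    qed
    have per_point: "(\<Sum>B\<in>short_dirs n s x. ?E (\<lambda>S. of_bool (crowded k x B S))) \<le> p * (\<eta> / 2)"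
      if x: "x \<in> grid n" for x
    proof -
      let ?f = "\<lambda>B. ?E (\<lambda>S. of_bool (crowded k x B S))"
      have fsd: "finite (short_dirs n s x)" by (rule finite_short_dirs)
      have "(\<Sum>B\<in>short_dirs n s x. ?f B) = (\<Sum>B\<in>short_dirs n s x \<inter> \<E>. ?f B) + (\<Sum>B\<in>short_dirs n s x - \<E>. ?f B)"
        using fsd by (subst sum.union_disjoint[symmetric]) (auto intro!: sum.cong)
      also have "(\<Sum>B\<in>short_dirs n s x \<inter> \<E>. ?f B) \<le> (\<Sum>B\<in>\<E>. p * \<gamma> ^ K0)"
      proof -
        have "(\<Sum>B\<in>short_dirs n s x \<inter> \<E>. ?f B) \<le> (\<Sum>B\<in>short_dirs n s x \<inter> \<E>. p * \<gamma> ^ K0)"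
        proof (rule sum_mono)
          fix B assume "B \<in> short_dirs n s x \<inter> \<E>"
          then have "?f B \<le> p * \<gamma> ^ k" using exceptional x by auto
          also have "\<dots> \<le> p * \<gamma> ^ K0" using p \<gamma> k(1) by (intro mult_left_mono power_decreasing) auto
          finally show "?f B \<le> p * \<gamma> ^ K0" .
        qed
        also have "\<dots> \<le> (\<Sum>B\<in>\<E>. p * \<gamma> ^ K0)" using p \<gamma> \<E> by (intro sum_mono2) auto
        finally show ?thesis .
      qed
      also have "(\<Sum>B\<in>\<E>. p * \<gamma> ^ K0) = p * (real (card \<E>) * \<gamma> ^ K0)" by simp
      also have "\<dots> \<le> p * (\<eta> / 4)"
      proof (intro mult_left_mono p)
        have "real (card \<E>) * \<gamma> ^ K0 + \<gamma> ^ K0 \<le> \<eta> / 4" using K0 by (simp add: field_simps)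
        then show "real (card \<E>) * \<gamma> ^ K0 \<le> \<eta> / 4" using zero_le_power[OF \<gamma>(1), of K0] by linarith
      qed
      also have "(\<Sum>B\<in>short_dirs n s x - \<E>. ?f B) \<le> (\<Sum>B\<in>short_dirs n s x - \<E>. p * ((exp 1 * C) ^ (d + 1) * (1 / height B) ^ (d + 1)))"
        using tail x by (intro sum_mono) auto
      also have "\<dots> = p * (exp 1 * C) ^ (d + 1) * (\<Sum>B\<in>short_dirs n s x - \<E>. (1 / height B) ^ (d + 1))"
        by (simp only: sum_distrib_left mult.assoc)
      also have "\<dots> \<le> p * (exp 1 * C) ^ (d + 1) * \<epsilon>"
        using p C fsd unfolding d_def by (intro mult_left_mono \<E>(3)) (auto simp: short_dirs_def)
      also have "\<dots> = p * ((exp 1 * C) ^ (d + 1) * \<epsilon>)" by simp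
      also have "(exp 1 * C) ^ (d + 1) * \<epsilon> = min 1 (\<eta> / 4)" using C by (simp add: \<epsilon>_def del: power_Suc)
      also have "p * min 1 (\<eta> / 4) \<le> p * (\<eta> / 4)" using p by (intro mult_left_mono) auto
      finally show ?thesis by (simp add: algebra_simps)
    qed
    have "\<exists>S \<subseteq> grid n. p * real n ^ d - p * (\<eta> / 2) * real n ^ d \<le> real (card S) \<and>
        (\<forall>A :: (real ^ 'd) set. affine A \<and> aff_dim A = int s \<longrightarrow> card (S \<inter> A) \<le> k)"
    proof (rule deletion[OF averaging_bern[OF fin p] _ n s])
      show "p * real n ^ d \<le> (\<Sum>x\<in>(grid n :: (real ^ 'd) set). ?E (\<lambda>S. of_bool (x \<in> S)))"
        by (simp add: bern_member fin card_grid d_def)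
      have "(\<Sum>x\<in>grid n. \<Sum>B\<in>short_dirs n s x. ?E (\<lambda>S. of_bool (crowded k x B S))) \<le> (\<Sum>x\<in>(grid n :: (real ^ 'd) set). p * (\<eta> / 2))"
        by (intro sum_mono per_point)
      then show "(\<Sum>x\<in>grid n. \<Sum>B\<in>short_dirs n s x. ?E (\<lambda>S. of_bool (crowded k x B S))) \<le> p * (\<eta> / 2) * real n ^ d"
        by (simp add: card_grid d_def mult_ac)
    qed auto
    \<comment> \<open>Thinning and deletion each cost a factor \<open>1 - \<eta> / 2\<close>, and
      their product is at least \<open>1 - \<eta>\<close>.\<close>
    moreover have "(1 - \<eta>) * real k * real n ^ (CARD('d) - s) \<le> p * real n ^ d - p * (\<eta> / 2) * real n ^ d"
    proof -
      have "p * real n ^ d - p * (\<eta> / 2) * real n ^ d = (1 - t) * (p * real n ^ d)" by (simp add: t_def algebra_simps)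
      also have "\<dots> = ((1 - t) * (1 - t)) * (real k * real n ^ (d - s))" unfolding \<open>p * real n ^ d = _\<close> by simp
      also have "\<dots> \<ge> (1 - \<eta>) * (real k * real n ^ (d - s))"
        by (intro mult_right_mono) (auto simp: t_def algebra_simps)
      finally show ?thesis by (simp add: d_def mult_ac)
    qed
    ultimately show "\<exists>S \<subseteq> (grid n :: (real ^ 'd) set). (1 - \<eta>) * real k * real n ^ (CARD('d) - s) \<le> real (card S) \<and>
      (\<forall>A. affine A \<and> aff_dim A = int s \<longrightarrow> card (S \<inter> A) \<le> k)"
      by (meson order.trans)
  qed
qed

section \<open>Residue classes of flats\<close>

lemma intvec_add: "intvec x \<Longrightarrow> intvec y \<Longrightarrow> intvec (x + y)"
  by (simp add: intvec_def)

lemma intvec_minus: "intvec x \<Longrightarrow> intvec (- x)"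
  by (simp add: intvec_def)

lemma intvec_scale: "c \<in> \<int> \<Longrightarrow> intvec x \<Longrightarrow> intvec (c *\<^sub>R x)"
  by (simp add: intvec_def)

lemma intvec_0: "intvec 0"
  by (simp add: intvec_def)

lemma intvec_sum: "(\<And>a. a \<in> A \<Longrightarrow> intvec (f a)) \<Longrightarrow> intvec (\<Sum>a\<in>A. f a)"
  by (induction A rule: infinite_finite_induct) (auto intro: intvec_add intvec_0)

lemma intvec_inner: "intvec x \<Longrightarrow> intvec y \<Longrightarrow> x \<bullet> y \<in> \<int>"
  by (auto simp: intvec_def inner_vec_def intro!: Ints_sum Ints_mult)

text \<open>The Gram-Schmidt residue of \<open>v\<close>, multiplied by the product of all
  \<open>a \<bullet> a\<close> to clear its denominators.\<close>

lemma integral_projection: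
  fixes A :: "(real ^ 'd::finite) set"
  assumes A: "finite A" "pairwise orthogonal A" "0 \<notin> A" "\<And>a. a \<in> A \<Longrightarrow> intvec a" and v: "intvec v"
  obtains c where "0 < c" "intvec (c *\<^sub>R (v - (\<Sum>a\<in>A. (a \<bullet> v / (a \<bullet> a)) *\<^sub>R a)))"
    "\<And>x. x \<in> span A \<Longrightarrow> orthogonal x (c *\<^sub>R (v - (\<Sum>a\<in>A. (a \<bullet> v / (a \<bullet> a)) *\<^sub>R a)))"
proof -
  define c where "c = (\<Prod>a\<in>A. a \<bullet> a)"
  have nz: "a \<bullet> a \<noteq> 0" if "a \<in> A" for a using that A(3) by auto
  have "c *\<^sub>R (v - (\<Sum>a\<in>A. (a \<bullet> v / (a \<bullet> a)) *\<^sub>R a)) =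
      c *\<^sub>R v - (\<Sum>a\<in>A. ((\<Prod>b\<in>A - {a}. b \<bullet> b) * (a \<bullet> v)) *\<^sub>R a)"
    unfolding scaleR_diff_right scaleR_sum_right
  proof (intro arg_cong2[where f = "(-)"] sum.cong refl)
    fix a assume a: "a \<in> A"
    have "c = (a \<bullet> a) * (\<Prod>b\<in>A - {a}. b \<bullet> b)" unfolding c_def using A(1) a by (rule prod.remove)
    then show "c *\<^sub>R (a \<bullet> v / (a \<bullet> a)) *\<^sub>R a = ((\<Prod>b\<in>A - {a}. b \<bullet> b) * (a \<bullet> v)) *\<^sub>R a"
      using nz[OF a] by simp
  qed
  moreover have "intvec \<dots>"
    unfolding c_def using A(4) v
    by (intro intvec_diff intvec_scale intvec_sum Ints_mult Ints_prod intvec_inner) auto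
  moreover have "0 < c" unfolding c_def using A(3) by (intro prod_pos) auto
  moreover have "orthogonal x (c *\<^sub>R (v - (\<Sum>a\<in>A. (a \<bullet> v / (a \<bullet> a)) *\<^sub>R a)))" if "x \<in> span A" for x
    using Gram_Schmidt_step[OF A(2) that, of v] by (simp add: orthogonal_def)
  ultimately show ?thesis using that by simp
qed

lemma integral_orthogonal_basis:
  fixes A :: "(real ^ 'd::finite) set"
  assumes "finite A" "\<And>a. a \<in> A \<Longrightarrow> intvec a"
  shows "\<exists>A'. finite A' \<and> pairwise orthogonal A' \<and> 0 \<notin> A' \<and> (\<forall>a\<in>A'. intvec a) \<and> span A' = span A"
  using assms
proof (induction A rule: finite_induct)
  case empty
  then show ?case by (intro exI[of _ "{}"]) auto
next
  case (insert v A)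
  then obtain A' where A': "finite A'" "pairwise orthogonal A'" "0 \<notin> A'" "\<And>a. a \<in> A' \<Longrightarrow> intvec a" "span A' = span A"
    by auto
  define p where "p = (\<Sum>a\<in>A'. (a \<bullet> v / (a \<bullet> a)) *\<^sub>R a)"
  obtain c where c: "0 < c" "intvec (c *\<^sub>R (v - p))" "\<And>x. x \<in> span A' \<Longrightarrow> orthogonal x (c *\<^sub>R (v - p))"
    using integral_projection[OF A'(1-4), of v] insert.prems unfolding p_def by blast
  have p: "p \<in> span A'" unfolding p_def by (intro span_sum span_scale span_base)
  have sp: "span (insert v A) = span (insert v A')"
    using A'(5) by (simp add: span_insert)
  show ?case
  proof (cases "v = p")
    case True
    then have "span (insert v A') = span A'" using p by (simp add: span_redundant)
    then show ?thesis using A' sp by auto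
  next
    case False
    define r where "r = c *\<^sub>R (v - p)"
    have r0: "r \<noteq> 0" using False c by (simp add: r_def)
    have "span (insert r A') = span (insert v A')"
    proof (rule antisym; rule span_minimal[OF _ subspace_span]; rule insert_subsetI)
      show "r \<in> span (insert v A')" unfolding r_def
        using p span_mono[of A' "insert v A'"] by (intro span_scale span_diff) (auto intro: span_base)
      show "A' \<subseteq> span (insert v A')" "A' \<subseteq> span (insert r A')" by (auto intro: span_base)
      have "v = (1 / c) *\<^sub>R r + p" using c by (simp add: r_def)
      moreover have "(1 / c) *\<^sub>R r + p \<in> span (insert r A')"
        using p span_mono[of A' "insert r A'"] by (intro span_add span_scale) (auto intro: span_base)
      ultimately show "v \<in> span (insert r A')" by simp
    qed
    moreover have "pairwise orthogonal (insert r A')"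
      using A'(2) c(3) unfolding pairwise_insert r_def[symmetric] by (auto intro: span_base simp: orthogonal_commute)
    ultimately show ?thesis using A' sp c(2) r0 by (intro exI[of _ "insert r A'"]) (auto simp: r_def[symmetric])
  qed
qed

text \<open>\<open>q\<close> is a positive multiple of the component of \<open>v\<close> orthogonal
  to \<open>span A\<close>, hence pairs positively with \<open>v\<close>.\<close>

lemma integral_separation:
  fixes A :: "(real ^ 'd::finite) set"
  assumes "finite A" "\<And>a. a \<in> A \<Longrightarrow> intvec a" and v: "intvec v" "v \<notin> span A"
  obtains q where "intvec q" "\<And>a. a \<in> span A \<Longrightarrow> q \<bullet> a = 0" "0 < q \<bullet> v"
proof -
  obtain A' where A': "finite A'" "pairwise orthogonal A'" "0 \<notin> A'" "\<And>a. a \<in> A' \<Longrightarrow> intvec a" "span A' = span A"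
    using integral_orthogonal_basis[OF assms(1,2)] by auto
  define p where "p = (\<Sum>a\<in>A'. (a \<bullet> v / (a \<bullet> a)) *\<^sub>R a)"
  obtain c where c: "0 < c" "intvec (c *\<^sub>R (v - p))" "\<And>x. x \<in> span A' \<Longrightarrow> orthogonal x (c *\<^sub>R (v - p))"
    using integral_projection[OF A'(1-4) v(1)] unfolding p_def by blast
  have p: "p \<in> span A'" unfolding p_def by (intro span_sum span_scale span_base)
  then have ne: "v - p \<noteq> 0" using v(2) A'(5) by auto
  show ?thesis
  proof (rule that[OF c(2)])
    show "c *\<^sub>R (v - p) \<bullet> a = 0" if "a \<in> span A" for a
      using c(3)[of a] that A'(5) by (simp add: orthogonal_def inner_commute)
    have "(v - p) \<bullet> p = 0" using c(3)[OF p] c(1) by (simp add: orthogonal_def inner_commute)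
    then have "(v - p) \<bullet> v = (v - p) \<bullet> (v - p)" by (simp add: inner_diff_right)
    also have "\<dots> > 0" using ne by (subst inner_gt_zero_iff)
    finally show "0 < c *\<^sub>R (v - p) \<bullet> v" using c(1) by simp
  qed
qed

lemma integral_dual_basis:
  fixes B :: "(real ^ 'd::finite) set"
  assumes "finite B" "independent B" "\<And>b. b \<in> B \<Longrightarrow> intvec b"
  obtains D :: nat and u where "0 < D" "\<And>b. b \<in> B \<Longrightarrow> intvec (u b)"
    "\<And>w. w \<in> span B \<Longrightarrow> real D *\<^sub>R w = (\<Sum>b\<in>B. (u b \<bullet> w) *\<^sub>R b)"
    "\<And>b b'. b \<in> B \<Longrightarrow> b' \<in> B \<Longrightarrow> u b \<bullet> b' = (if b = b' then real D else 0)"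
proof -
  have "\<exists>q. intvec q \<and> (\<forall>a\<in>B - {b}. q \<bullet> a = 0) \<and> 0 < q \<bullet> b" if "b \<in> B" for b
  proof -
    have "b \<notin> span (B - {b})" using assms(2) that by (auto simp: dependent_def)
    then show ?thesis using integral_separation[of "B - {b}" b] assms that by (metis Diff_iff finite_Diff span_base)
  qed
  then obtain q where q: "\<And>b. b \<in> B \<Longrightarrow> intvec (q b)" "\<And>b a. b \<in> B \<Longrightarrow> a \<in> B \<Longrightarrow> a \<noteq> b \<Longrightarrow> q b \<bullet> a = 0"
    "\<And>b. b \<in> B \<Longrightarrow> 0 < q b \<bullet> b"
    by (metis Diff_iff singletonD)
  \<comment> \<open>Multiplying each \<open>q b\<close> by the values of all the others gives every
    functional the same value \<open>D\<close> on its own basis vector.\<close>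
  define c where "c = (\<Prod>b\<in>B. q b \<bullet> b)"
  define u where "u = (\<lambda>b. (\<Prod>a\<in>B - {b}. q a \<bullet> a) *\<^sub>R q b)"
  have "c \<in> \<int>" "0 < c" unfolding c_def using q assms by (auto intro!: Ints_prod intvec_inner prod_pos)
  then obtain D :: nat where D: "c = real D" "0 < D"
    by (metis Ints_cases of_int_0_less_iff of_int_of_nat_eq of_nat_0_less_iff zero_less_imp_eq_int)
  have ub: "u b \<bullet> b' = (if b = b' then real D else 0)" if "b \<in> B" "b' \<in> B" for b b'
  proof (cases "b = b'")
    case True
    have "c = (q b \<bullet> b) * (\<Prod>a\<in>B - {b}. q a \<bullet> a)" unfolding c_def using assms(1) that(1) by (rule prod.remove)
    then show ?thesis using True D by (simp add: u_def)
  qed (use q(2) that in \<open>auto simp: u_def\<close>)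
  show ?thesis
  proof (rule that[OF D(2), of u])
    show "intvec (u b)" if "b \<in> B" for b
      unfolding u_def using q that assms by (intro intvec_scale Ints_prod intvec_inner) auto
    show "u b \<bullet> b' = (if b = b' then real D else 0)" if "b \<in> B" "b' \<in> B" for b b' using ub that .
    fix w assume "w \<in> span B"
    then obtain t where w: "w = (\<Sum>b\<in>B. t b *\<^sub>R b)" using span_finite[OF assms(1)] by auto
    have "u b \<bullet> w = real D * t b" if "b \<in> B" for b
    proof -
      have "u b \<bullet> w = (\<Sum>a\<in>B. if b = a then t a * real D else 0)"
        unfolding w inner_sum_right using ub that by (intro sum.cong) auto
      then show ?thesis using assms(1) that by simp
    qed
    then show "real D *\<^sub>R w = (\<Sum>b\<in>B. (u b \<bullet> w) *\<^sub>R b)" by (simp add: w scaleR_sum_right)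
  qed
qed

section \<open>Congruence modulo a subspace and an integer\<close>

text \<open>Congruence modulo the group generated by the integer points of \<open>W\<close> and
  \<open>M\<close> times the integer vectors.\<close>

definition lat_cong :: "nat \<Rightarrow> (real ^ 'd) set \<Rightarrow> real ^ 'd \<Rightarrow> real ^ 'd::finite \<Rightarrow> bool" where
  "lat_cong M W y x \<longleftrightarrow> (\<exists>w\<in>W. intvec w \<and> intvec ((1 / real M) *\<^sub>R (y - x - w)))"

definition fibre :: "nat \<Rightarrow> (real ^ 'd::finite) set \<Rightarrow> real ^ 'd \<Rightarrow> (real ^ 'd) set" where
  "fibre M W x = {y \<in> grid M. lat_cong M W y x}"

text \<open>The tag \<open>W\<close> keeps the classes of different directions apart, so that each
  edge has exactly one vertex per direction.\<close>

definition torus_edges :: "nat \<Rightarrow> (real ^ 'd) set set \<Rightarrow> real ^ 'd::finite \<Rightarrow> ((real ^ 'd) set \<times> (real ^ 'd) set) set" where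
  "torus_edges M \<W> x = (\<lambda>W. (W, fibre M W x)) ` \<W>"

lemma lat_cong_refl: "subspace W \<Longrightarrow> lat_cong M W x x"
  unfolding lat_cong_def by (intro bexI[of _ 0]) (auto simp: intvec_0 subspace_0)

lemma lat_cong_sym:
  assumes "subspace W" "lat_cong M W y x"
  shows "lat_cong M W x y"
proof -
  obtain w where w: "w \<in> W" "intvec w" "intvec ((1 / real M) *\<^sub>R (y - x - w))"
    using assms(2) by (auto simp: lat_cong_def)
  have "(1 / real M) *\<^sub>R (x - y - - w) = - ((1 / real M) *\<^sub>R (y - x - w))"
    by (simp add: algebra_simps)
  then show ?thesis using w assms(1) unfolding lat_cong_def
    by (intro bexI[of _ "- w"]) (auto simp: intvec_minus subspace_neg)
qed

lemma lat_cong_trans: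
  assumes "subspace W" "lat_cong M W z y" "lat_cong M W y x"
  shows "lat_cong M W z x"
proof -
  obtain w where w: "w \<in> W" "intvec w" "intvec ((1 / real M) *\<^sub>R (y - x - w))"
    using assms(3) by (auto simp: lat_cong_def)
  obtain v where v: "v \<in> W" "intvec v" "intvec ((1 / real M) *\<^sub>R (z - y - v))"
    using assms(2) by (auto simp: lat_cong_def)
  have "(1 / real M) *\<^sub>R (z - x - (v + w)) = (1 / real M) *\<^sub>R (z - y - v) + (1 / real M) *\<^sub>R (y - x - w)"
    by (simp add: algebra_simps)
  then show ?thesis using w v assms(1) unfolding lat_cong_def
    by (intro bexI[of _ "v + w"]) (auto simp: intvec_add subspace_add)
qed

lemma fibre_eq_iff:
  assumes "subspace W" "y \<in> grid M"
  shows "fibre M W y = fibre M W x \<longleftrightarrow> y \<in> fibre M W x"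
  using assms lat_cong_refl[of W M y] lat_cong_sym[of W M] lat_cong_trans[of W M]
  unfolding fibre_def by blast

lemma grid_representative:
  fixes z :: "real ^ 'd::finite"
  assumes "intvec z" "0 < M"
  obtains y where "y \<in> grid M" "intvec ((1 / real M) *\<^sub>R (y - z))"
proof -
  \<comment> \<open>The two shifts by 1 turn the residues from 0 to \<open>M - 1\<close> into
    representatives from 1 to \<open>M\<close>.\<close>
  define y where "y = (\<chi> i. real (nat ((\<lfloor>z $ i\<rfloor> - 1) mod int M) + 1))"
  show ?thesis
  proof (rule that)
    have "nat ((\<lfloor>z $ i\<rfloor> - 1) mod int M) + 1 \<in> {1..M}" for i
    proof -
      have "nat ((\<lfloor>z $ i\<rfloor> - 1) mod int M) < M" using assms(2) by (simp add: nat_less_iff)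
      then show ?thesis by simp
    qed
    then have "real (nat ((\<lfloor>z $ i\<rfloor> - 1) mod int M) + 1) \<in> real ` {1..M}" for i by (rule imageI)
    then show "y \<in> grid M" unfolding grid_def y_def mem_Collect_eq vec_lambda_beta by blast
    show "intvec ((1 / real M) *\<^sub>R (y - z))"
      unfolding intvec_def
    proof
      fix i
      define a where "a = \<lfloor>z $ i\<rfloor>"
      have z: "z $ i = real_of_int a" using assms(1) by (auto simp: intvec_def a_def elim!: Ints_cases)
      define k r where "k = (a - 1) div int M" and "r = (a - 1) mod int M"
      have "a = 1 + (int M * k + r)" unfolding k_def r_def by simp
      then have "real_of_int a = real_of_int (1 + (int M * k + r))" by (rule arg_cong)
      moreover have "real (nat r) = real_of_int r" using assms(2) by (simp add: r_def of_nat_nat)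
      moreover have "y $ i = real (nat r) + 1" by (simp add: y_def r_def a_def)
      ultimately have "(y - z) $ i = real M * real_of_int (- k)" by (simp add: z)
      then have "((1 / real M) *\<^sub>R (y - z)) $ i = real_of_int (- k)"
        using assms(2) by simp
      then show "((1 / real M) *\<^sub>R (y - z)) $ i \<in> \<int>" by (metis Ints_of_int)
    qed
  qed
qed

lemma grid_congruent_eq:
  fixes y :: "real ^ 'd::finite"
  assumes "y \<in> grid M" "z \<in> grid M" "intvec ((1 / real M) *\<^sub>R (y - z))" "0 < M"
  shows "y = z"
proof -
  have "y $ i = z $ i" for i
  proof -
    have "(y $ i - z $ i) / real M \<in> \<int>" using assms(3) by (auto simp: intvec_def dest: spec[of _ i])
    moreover have "\<bar>y $ i - z $ i\<bar> < real M"
      using grid_component[OF assms(1), of i] grid_component[OF assms(2), of i] by linarith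
    then have "\<bar>(y $ i - z $ i) / real M\<bar> < 1" using assms(4) by (simp add: abs_divide)
    ultimately show ?thesis using Ints_nonzero_abs_less1 assms(4) by force
  qed
  then show ?thesis by (simp add: vec_eq_iff)
qed

text \<open>The hypothesis makes \<open>- q\<close> an inverse of \<open>D\<close> modulo \<open>M\<close>, so coprimality never has to be mentioned.\<close>

lemma Ints_div_coprime:
  assumes "M = 1 + D * q" "0 < M" "x \<in> \<int>" "real D * x / real M \<in> \<int>"
  shows "x / real M \<in> \<int>"
proof -
  have "x / real M = (x * (real M - real D * real q)) / real M" using assms(1) by simp
  also have "\<dots> = x - real q * (real D * x / real M)" using assms(2) by (simp add: field_simps)
  finally have eq: "x / real M = x - real q * (real D * x / real M)" .
  show ?thesis unfolding eq using assms(3,4) by (intro Ints_diff Ints_mult) auto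
qed

lemma mod_floor_eq:
  assumes "x \<in> \<int>" "y \<in> \<int>" "0 < M" "\<lfloor>x\<rfloor> mod int M = \<lfloor>y\<rfloor> mod int M"
  shows "(x - y) / real M \<in> \<int>"
proof -
  obtain a b where ab: "x = of_int a" "y = of_int b" using assms(1,2) by (auto elim!: Ints_cases)
  then have "a mod int M = b mod int M" using assms(4) by simp
  then obtain k where "a - b = int M * k" by (auto simp: mod_eq_dvd_iff)
  then have "x - y = real M * of_int k" unfolding ab by (metis of_int_diff of_int_mult of_int_of_nat_eq)
  then show ?thesis using assms(3) by simp
qed

section \<open>Coordinates on a residue class\<close>

locale residue_flat =
  fixes B :: "(real ^ 'd::finite) set" and D M q s :: nat and u :: "real ^ 'd \<Rightarrow> real ^ 'd"
  assumes B: "B \<in> dirs s" and u: "\<And>b. b \<in> B \<Longrightarrow> intvec (u b)"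
    and dual: "\<And>w. w \<in> span B \<Longrightarrow> real D *\<^sub>R w = (\<Sum>b\<in>B. (u b \<bullet> w) *\<^sub>R b)"
    and dual_basis: "\<And>b b'. b \<in> B \<Longrightarrow> b' \<in> B \<Longrightarrow> u b \<bullet> b' = (if b = b' then real D else 0)"
    and M: "M = 1 + D * q" "0 < M"
begin

definition res :: "real ^ 'd \<Rightarrow> real ^ 'd \<Rightarrow> real ^ 'd \<Rightarrow> int" where
  "res x y = (\<lambda>b\<in>B. \<lfloor>u b \<bullet> (y - x)\<rfloor> mod int M)"

lemma Bint: "b \<in> B \<Longrightarrow> intvec b" and finB: "finite B" and cardB: "card B = s"
  using B dirs_finite by (auto simp: dirs_def)

lemma cong_inner:
  assumes "intvec v" "intvec ((1 / real M) *\<^sub>R (y - w))"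
  shows "(v \<bullet> y - v \<bullet> w) / real M \<in> \<int>"
proof -
  have eq: "v \<bullet> ((1 / real M) *\<^sub>R (y - w)) = (v \<bullet> y - v \<bullet> w) / real M" by (simp add: inner_diff_right)
  show ?thesis using intvec_inner[OF assms] unfolding eq .
qed

text \<open>Modulo \<open>M\<close>, \<open>y - z\<close> equals an integer vector \<open>w\<close>
  of \<open>span B\<close>. If all \<open>u b \<bullet> w\<close> vanish modulo \<open>M\<close>, so
  does \<open>D *\<^sub>R w\<close> by the expansion in \<open>B\<close>, and \<open>D\<close> can
  be cancelled. Congruent grid points are equal.\<close>

lemma fibre_separated:
  assumes x: "intvec x" and y: "y \<in> fibre M (span B) x" and z: "z \<in> fibre M (span B) x"
    and eq: "\<And>b. b \<in> B \<Longrightarrow> (u b \<bullet> (y - z)) / real M \<in> \<int>"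
  shows "y = z"
proof -
  have g: "y \<in> grid M" "z \<in> grid M" using y z by (auto simp: fibre_def)
  have "lat_cong M (span B) y z"
    using y z by (auto simp: fibre_def intro: lat_cong_trans lat_cong_sym)
  then obtain w where w: "w \<in> span B" "intvec w" "intvec ((1 / real M) *\<^sub>R (y - z - w))"
    by (auto simp: lat_cong_def)
  have uw: "(u b \<bullet> w) / real M \<in> \<int>" if "b \<in> B" for b
  proof -
    have "(u b \<bullet> w) / real M = (u b \<bullet> (y - z)) / real M - (u b \<bullet> (y - z) - u b \<bullet> w) / real M"
      by (simp add: diff_divide_distrib)
    then show ?thesis using eq[OF that] cong_inner[OF u[OF that] w(3)] Ints_diff by metis
  qed
  have "real D *\<^sub>R ((1 / real M) *\<^sub>R w) = (1 / real M) *\<^sub>R (real D *\<^sub>R w)" by simp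
  also have "\<dots> = (\<Sum>b\<in>B. ((u b \<bullet> w) / real M) *\<^sub>R b)"
    unfolding dual[OF w(1)] scaleR_sum_right by simp
  finally have "real D *\<^sub>R ((1 / real M) *\<^sub>R w) = (\<Sum>b\<in>B. ((u b \<bullet> w) / real M) *\<^sub>R b)" .
  then have Dw: "intvec (real D *\<^sub>R ((1 / real M) *\<^sub>R w))"
    using uw Bint by (auto intro!: intvec_sum intvec_scale)
  have "w $ i / real M \<in> \<int>" for i
  proof (rule Ints_div_coprime[OF M])
    show "w $ i \<in> \<int>" using w(2) by (simp add: intvec_def)
    show "real D * w $ i / real M \<in> \<int>" using Dw by (auto simp: intvec_def dest: spec[of _ i])
  qed
  then have "intvec ((1 / real M) *\<^sub>R w)" by (simp add: intvec_def)
  then have "intvec ((1 / real M) *\<^sub>R (y - z - w) + (1 / real M) *\<^sub>R w)" using w(3) by (rule intvec_add[rotated])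
  then have "intvec ((1 / real M) *\<^sub>R (y - z))" by (simp add: algebra_simps)
  then show ?thesis using grid_congruent_eq g M(2) by blast
qed

lemma inner_int: "b \<in> B \<Longrightarrow> y \<in> grid M \<Longrightarrow> intvec x \<Longrightarrow> u b \<bullet> (y - x) \<in> \<int>"
  using u grid_intvec intvec_diff intvec_inner by blast

lemma res_eqD:
  assumes x: "intvec x" and "y \<in> grid M" "z \<in> grid M" "b \<in> B"
    and "\<lfloor>u b \<bullet> (y - x)\<rfloor> mod int M = \<lfloor>u b \<bullet> (z - x)\<rfloor> mod int M"
  shows "(u b \<bullet> (y - z)) / real M \<in> \<int>"
  using mod_floor_eq[OF inner_int[OF assms(4,2) x] inner_int[OF assms(4,3) x] M(2) assms(5)]
  by (simp add: inner_diff_right)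

text \<open>The residues \<open>res x\<close> are coordinates: \<open>fibre_separated\<close> makes
  them injective, and invertibility of \<open>D\<close> modulo \<open>M\<close> makes every tuple of
  residues occur.\<close>

lemma card_fibre:
  assumes x: "intvec x"
  shows "card (fibre M (span B) x) = M ^ s"
proof -
  have "bij_betw (res x) (fibre M (span B) x) (PiE B (\<lambda>_. {0..<int M}))"
    unfolding bij_betw_def
  proof
    show "inj_on (res x) (fibre M (span B) x)"
    proof (rule inj_onI)
      fix y z assume yz: "y \<in> fibre M (span B) x" "z \<in> fibre M (span B) x" "res x y = res x z"
      show "y = z"
      proof (rule fibre_separated[OF x yz(1,2)])
        fix b assume b: "b \<in> B"
        then have "\<lfloor>u b \<bullet> (y - x)\<rfloor> mod int M = \<lfloor>u b \<bullet> (z - x)\<rfloor> mod int M"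
          using fun_cong[OF yz(3), of b] by (simp add: res_def)
        then show "(u b \<bullet> (y - z)) / real M \<in> \<int>"
          using yz b x by (intro res_eqD) (auto simp: fibre_def)
      qed
    qed
    show "res x ` fibre M (span B) x = PiE B (\<lambda>_. {0..<int M})"
    proof (intro antisym subsetI)
      fix r assume "r \<in> res x ` fibre M (span B) x"
      then show "r \<in> PiE B (\<lambda>_. {0..<int M})" using M(2) by (auto simp: res_def)
    next
      fix r assume r: "r \<in> PiE B (\<lambda>_. {0..<int M})"
      \<comment> \<open>Since \<open>- q\<close> inverts \<open>D\<close> modulo \<open>M\<close>,
        this \<open>w\<close> satisfies \<open>u b \<bullet> w = r b * (1 - M)\<close>, which is
        \<open>r b\<close> modulo \<open>M\<close>.\<close>
      define w where "w = (\<Sum>b\<in>B. (- real q * real_of_int (r b)) *\<^sub>R b)"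
      have w: "w \<in> span B" "intvec w"
      proof -
        show "w \<in> span B" unfolding w_def by (intro span_sum span_scale) (rule span_base)
        show "intvec w" unfolding w_def
          by (intro intvec_sum intvec_scale Bint Ints_mult Ints_minus Ints_of_nat Ints_of_int)
      qed
      obtain y where y: "y \<in> grid M" "intvec ((1 / real M) *\<^sub>R (y - (x + w)))"
        by (rule grid_representative[OF intvec_add[OF x w(2)] M(2)])
      have "intvec ((1 / real M) *\<^sub>R (y - x - w))" using y(2) by (simp only: diff_diff_eq)
      then have yf: "y \<in> fibre M (span B) x"
        unfolding fibre_def lat_cong_def using y(1) w by blast
      have "res x y = r"
      proof (rule ext)
        fix b
        show "res x y b = r b"
        proof (cases "b \<in> B")
          case True
          have "u b \<bullet> w = (\<Sum>a\<in>B. if b = a then - real q * real_of_int (r a) * real D else 0)"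
            unfolding w_def inner_sum_right using dual_basis[OF True] by (intro sum.cong) auto
          then have uw: "u b \<bullet> w = - real q * real_of_int (r b) * real D" using finB True by simp
          have "(u b \<bullet> y - u b \<bullet> (x + w)) / real M \<in> \<int>" using cong_inner[OF u[OF True] y(2)] .
          then obtain k where "(u b \<bullet> y - u b \<bullet> (x + w)) / real M = real_of_int k" by (rule Ints_cases)
          then have "u b \<bullet> (y - x) = - real q * real_of_int (r b) * real D + real M * real_of_int k"
            using M(2) uw by (simp add: inner_diff_right inner_add_right field_simps)
          also have "\<dots> = real_of_int (r b + int M * (k - r b))"
          proof -
            have "real M = 1 + real D * real q" using M(1) by simp
            then show ?thesis by (simp add: algebra_simps)
          qed
          finally have "\<lfloor>u b \<bullet> (y - x)\<rfloor> = r b + int M * (k - r b)" by (simp only: floor_of_int)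
          moreover have "0 \<le> r b" "r b < int M" using r True by (auto simp: PiE_iff)
          ultimately show ?thesis using True by (simp add: res_def)
        next
          case False
          then show ?thesis using r by (auto simp: res_def PiE_iff extensional_def)
        qed
      qed
      then show "r \<in> res x ` fibre M (span B) x" using yf by auto
    qed
  qed
  then have "card (fibre M (span B) x) = card (PiE B (\<lambda>_. {0..<int M}))" by (rule bij_betw_same_card)
  also have "\<dots> = M ^ s" using finB cardB by (simp add: card_PiE)
  finally show ?thesis .
qed

text \<open>As \<open>v\<close> vanishes on \<open>W\<close>, it vanishes modulo \<open>M\<close> on
  differences within the intersection. Expanding \<open>v \<bullet> (D *\<^sub>R w)\<close> in
  \<open>B\<close> expresses \<open>D' * (u b0 \<bullet> w)\<close> through the other residues, and
  \<open>D'\<close> is invertible. So the residue at \<open>b0\<close> is determined, and one factor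
  \<open>M\<close> is lost.\<close>

lemma card_fibre_inter:
  assumes x: "intvec x" and b0: "b0 \<in> B" and v: "intvec v" "\<And>w. w \<in> W \<Longrightarrow> v \<bullet> w = 0"
    and sW: "subspace W" and v0: "v \<bullet> b0 = real D'" and M': "M = 1 + D' * q'"
  shows "card (fibre M (span B) x \<inter> fibre M W x) \<le> M ^ (s - 1)"
proof -
  define f where "f = (\<lambda>y. restrict (res x y) (B - {b0}))"
  have "inj_on f (fibre M (span B) x \<inter> fibre M W x)"
  proof (rule inj_onI)
    fix y z assume yz: "y \<in> fibre M (span B) x \<inter> fibre M W x" "z \<in> fibre M (span B) x \<inter> fibre M W x" "f y = f z"
    have g: "y \<in> grid M" "z \<in> grid M" using yz by (auto simp: fibre_def)
    have ub: "(u b \<bullet> (y - z)) / real M \<in> \<int>" if "b \<in> B" "b \<noteq> b0" for b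
    proof (rule res_eqD[OF x g that(1)])
      show "\<lfloor>u b \<bullet> (y - x)\<rfloor> mod int M = \<lfloor>u b \<bullet> (z - x)\<rfloor> mod int M"
        using fun_cong[OF yz(3), of b] that by (simp add: f_def res_def)
    qed
    have "lat_cong M (span B) y z" "lat_cong M W y z"
      using yz sW by (auto simp: fibre_def intro: lat_cong_trans lat_cong_sym)
    then obtain w w' where w: "w \<in> span B" "intvec w" "intvec ((1 / real M) *\<^sub>R (y - z - w))"
      and w': "w' \<in> W" "intvec w'" "intvec ((1 / real M) *\<^sub>R (y - z - w'))"
      by (auto simp: lat_cong_def)
    have vyz: "(v \<bullet> (y - z)) / real M \<in> \<int>" using cong_inner[OF v(1) w'(3)] v(2)[OF w'(1)] by simp
    have vw: "(v \<bullet> w) / real M \<in> \<int>"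
    proof -
      have "(v \<bullet> w) / real M = (v \<bullet> (y - z)) / real M - (v \<bullet> (y - z) - v \<bullet> w) / real M"
        by (simp add: diff_divide_distrib)
      then show ?thesis using vyz cong_inner[OF v(1) w(3)] Ints_diff by metis
    qed
    have uw: "(u b \<bullet> w) / real M \<in> \<int>" if "b \<in> B" "b \<noteq> b0" for b
    proof -
      have "(u b \<bullet> w) / real M = (u b \<bullet> (y - z)) / real M - (u b \<bullet> (y - z) - u b \<bullet> w) / real M"
        by (simp add: diff_divide_distrib)
      then show ?thesis using ub[OF that] cong_inner[OF u[OF that(1)] w(3)] Ints_diff by metis
    qed
    have "v \<bullet> (real D *\<^sub>R w) = (\<Sum>b\<in>B. (u b \<bullet> w) * (v \<bullet> b))"
      unfolding dual[OF w(1)] by (simp add: inner_sum_right)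
    also have "\<dots> = (u b0 \<bullet> w) * real D' + (\<Sum>b\<in>B - {b0}. (u b \<bullet> w) * (v \<bullet> b))"
      using sum.remove[OF finB b0, of "\<lambda>b. (u b \<bullet> w) * (v \<bullet> b)"] v0 by simp
    finally have "real D' * (u b0 \<bullet> w) / real M =
        real D * ((v \<bullet> w) / real M) - (\<Sum>b\<in>B - {b0}. ((u b \<bullet> w) / real M) * (v \<bullet> b))"
      by (simp add: sum_divide_distrib[symmetric] diff_divide_distrib[symmetric] mult.commute)
    also have "\<dots> \<in> \<int>"
      using vw uw Bint v(1) by (intro Ints_diff Ints_mult Ints_sum intvec_inner) auto
    finally have "(u b0 \<bullet> w) / real M \<in> \<int>"
      using Ints_div_coprime[OF M' M(2)] intvec_inner[OF u[OF b0] w(2)] by blast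
    moreover have "(u b0 \<bullet> (y - z)) / real M = (u b0 \<bullet> (y - z) - u b0 \<bullet> w) / real M + (u b0 \<bullet> w) / real M"
      by (simp add: diff_divide_distrib)
    ultimately have "(u b0 \<bullet> (y - z)) / real M \<in> \<int>"
      using cong_inner[OF u[OF b0] w(3)] Ints_add by metis
    then have "(u b \<bullet> (y - z)) / real M \<in> \<int>" if "b \<in> B" for b using ub that by (cases "b = b0") auto
    then show "y = z" using fibre_separated[OF x] yz by blast
  qed
  moreover have "f ` (fibre M (span B) x \<inter> fibre M W x) \<subseteq> PiE (B - {b0}) (\<lambda>_. {0..<int M})"
  proof (rule image_subsetI)
    fix y show "f y \<in> PiE (B - {b0}) (\<lambda>_. {0..<int M})"
      using M(2) by (simp add: f_def res_def PiE_iff extensional_def)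
  qed
  moreover have "finite (PiE (B - {b0}) (\<lambda>_. {0..<int M}))" using finB by (intro finite_PiE) auto
  ultimately have "card (fibre M (span B) x \<inter> fibre M W x) \<le> card (PiE (B - {b0}) (\<lambda>_. {0..<int M}))"
    by (rule card_inj_on_le)
  also have "\<dots> = M ^ (s - 1)" using finB cardB b0 by (simp add: card_PiE)
  finally show ?thesis .
qed

end

section \<open>A common modulus and the torus hypergraph\<close>

lemma fibre_card_modulus:
  fixes B :: "(real ^ 'd::finite) set"
  assumes B: "B \<in> dirs s"
  shows "\<exists>D>0. \<forall>q x. intvec x \<longrightarrow> card (fibre (1 + D * q) (span B) x) = (1 + D * q) ^ s"
proof -
  obtain D :: nat and u where D: "0 < D" "\<And>b. b \<in> B \<Longrightarrow> intvec (u b)"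
    "\<And>w. w \<in> span B \<Longrightarrow> real D *\<^sub>R w = (\<Sum>b\<in>B. (u b \<bullet> w) *\<^sub>R b)"
    "\<And>b b'. b \<in> B \<Longrightarrow> b' \<in> B \<Longrightarrow> u b \<bullet> b' = (if b = b' then real D else 0)"
    using integral_dual_basis[OF dirs_finite[OF B]] B by (auto simp: dirs_def)
  have "card (fibre (1 + D * q) (span B) x) = (1 + D * q) ^ s" if "intvec x" for q x
  proof -
    interpret residue_flat B D "1 + D * q" q s u
      by unfold_locales (use B D in auto)
    show ?thesis using card_fibre[OF that] .
  qed
  then show ?thesis using D(1) by blast
qed

text \<open>Two distinct spans of equal dimension: some \<open>b0\<close> in \<open>B\<close> lies
  outside \<open>span B'\<close>, and an integral \<open>v\<close> separates it from that span. A
  modulus that is 1 modulo \<open>D * D'\<close> makes both \<open>D\<close> and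
  \<open>D' = v \<bullet> b0\<close> invertible.\<close>

lemma fibre_inter_modulus:
  fixes B B' :: "(real ^ 'd::finite) set"
  assumes B: "B \<in> dirs s" and B': "B' \<in> dirs s" and ne: "span B \<noteq> span B'"
  shows "\<exists>D>0. \<forall>q x. intvec x \<longrightarrow>
    card (fibre (1 + D * q) (span B) x \<inter> fibre (1 + D * q) (span B') x) \<le> (1 + D * q) ^ (s - 1)"
proof -
  obtain D :: nat and u where D: "0 < D" "\<And>b. b \<in> B \<Longrightarrow> intvec (u b)"
    "\<And>w. w \<in> span B \<Longrightarrow> real D *\<^sub>R w = (\<Sum>b\<in>B. (u b \<bullet> w) *\<^sub>R b)"
    "\<And>b b'. b \<in> B \<Longrightarrow> b' \<in> B \<Longrightarrow> u b \<bullet> b' = (if b = b' then real D else 0)"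
    using integral_dual_basis[OF dirs_finite[OF B]] B by (auto simp: dirs_def)
  have "\<not> B \<subseteq> span B'"
  proof
    assume sub: "B \<subseteq> span B'"
    have "independent B" "dim (span B') \<le> card B"
      using B B' by (auto simp: dirs_def dim_eq_card_independent)
    with sub have "span B' \<subseteq> span B" by (rule card_ge_dim_independent)
    moreover have "span B \<subseteq> span B'" using sub by (rule span_minimal[OF _ subspace_span])
    ultimately show False using ne by auto
  qed
  then obtain b0 where b0: "b0 \<in> B" "b0 \<notin> span B'" by auto
  have "intvec b0" using b0(1) B by (simp add: dirs_def)
  then obtain v where v: "intvec v" "\<And>a. a \<in> span B' \<Longrightarrow> v \<bullet> a = 0" "0 < v \<bullet> b0"
    using integral_separation[OF dirs_finite[OF B'] _ _ b0(2)] B' by (auto simp: dirs_def)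
  have "v \<bullet> b0 \<in> \<int>" using v(1) \<open>intvec b0\<close> by (rule intvec_inner)
  then obtain a where a: "v \<bullet> b0 = real_of_int a" by (auto elim: Ints_cases)
  define D' where "D' = nat a"
  have D': "v \<bullet> b0 = real D'" "0 < D'" using a v(3) by (auto simp: D'_def)
  have "card (fibre (1 + D * D' * q) (span B) x \<inter> fibre (1 + D * D' * q) (span B') x) \<le> (1 + D * D' * q) ^ (s - 1)"
    if "intvec x" for q x
  proof -
    interpret residue_flat B D "1 + D * D' * q" "D' * q" s u
      by unfold_locales (use B D in \<open>auto simp: mult.assoc\<close>)
    show ?thesis
      using card_fibre_inter[OF that b0(1) v(1,2) subspace_span D'(1), where q' = "D * q"] by (simp add: mult_ac)
  qed
  then show ?thesis using D(1) D'(2) by (intro exI[of _ "D * D'"]) auto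
qed

text \<open>Moduli of the form \<open>1 + D * q\<close> with arbitrary \<open>q\<close> are stable
  under this combination: \<open>1 + D * D' * q\<close> has the required form for both
  \<open>D\<close> and \<open>D'\<close>.\<close>

lemma common_modulus:
  assumes "finite I" "\<And>i. i \<in> I \<Longrightarrow> \<exists>D>0::nat. \<forall>q. \<Phi> i (1 + D * q)"
  shows "\<exists>D>0. \<forall>i\<in>I. \<forall>q. \<Phi> i (1 + D * q)"
  using assms
proof (induction I rule: finite_induct)
  case empty
  then show ?case by auto
next
  case (insert i I)
  obtain D where D: "0 < D" "\<forall>j\<in>I. \<forall>q. \<Phi> j (1 + D * q)" using insert by auto
  obtain D' where D': "0 < D'" "\<forall>q. \<Phi> i (1 + D' * q)" using insert.prems[of i] by auto
  have "\<Phi> j (1 + D * D' * q)" if "j \<in> insert i I" for j q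
  proof (cases "j = i")
    case True
    then show ?thesis using D'(2)[rule_format, of "D * q"] by (simp add: mult_ac)
  next
    case False
    then show ?thesis using that D(2)[rule_format, of j "D' * q"] by (simp add: mult_ac)
  qed
  then show ?case using D(1) D'(1) by (intro exI[of _ "D * D'"]) auto
qed

text \<open>The degree of the vertex \<open>(W, F)\<close> is the size of the class
  \<open>F\<close>. Two different vertices on a common edge have different directions, so their
  codegree is the size of an intersection of two classes.\<close>

lemma torus_regular:
  fixes \<E> :: "(real ^ 'd::finite) set set"
  assumes fin: "finite \<E>" and \<E>: "\<E> \<subseteq> dirs s" "\<E> \<noteq> {}" and s: "1 \<le> s"
  obtains Q where "0 < Q" "\<And>q. 1 \<le> q \<Longrightarrow> regular_hyp (grid (1 + Q * q)) (torus_edges (1 + Q * q) (span ` \<E>))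
    (card (span ` \<E>)) ((1 + Q * q) ^ s) ((1 + Q * q) ^ (s - 1))"
proof -
  define \<Phi> where "\<Phi> = (\<lambda>(B :: (real ^ 'd) set, B' :: (real ^ 'd) set) M. \<forall>x. intvec x \<longrightarrow>
    card (fibre M (span B) x) = M ^ s \<and> (span B \<noteq> span B' \<longrightarrow> card (fibre M (span B) x \<inter> fibre M (span B') x) \<le> M ^ (s - 1)))"
  have "\<exists>D>0. \<forall>i\<in>\<E> \<times> \<E>. \<forall>q. \<Phi> i (1 + D * q)"
  proof (rule common_modulus)
    show "finite (\<E> \<times> \<E>)" using fin by simp
    fix i assume "i \<in> \<E> \<times> \<E>"
    then obtain B B' where i: "i = (B, B')" "B \<in> dirs s" "B' \<in> dirs s" using \<E> by auto
    obtain D1 where D1: "D1 > 0" "\<And>q x. intvec x \<Longrightarrow> card (fibre (1 + D1 * q) (span B) x) = (1 + D1 * q) ^ s"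
      using fibre_card_modulus[OF i(2)] by blast
    obtain D2 where D2: "D2 > 0" "\<And>q x. intvec x \<Longrightarrow> span B \<noteq> span B' \<Longrightarrow>
      card (fibre (1 + D2 * q) (span B) x \<inter> fibre (1 + D2 * q) (span B') x) \<le> (1 + D2 * q) ^ (s - 1)"
    proof (cases "span B = span B'")
      case True
      then show ?thesis using that[of 1] by simp
    next
      case False
      then show ?thesis using fibre_inter_modulus[OF i(2,3)] that by blast
    qed
    have "\<Phi> i (1 + D1 * D2 * q)" for q
      using D1(2)[of _ "D2 * q"] D2(2)[of _ "D1 * q"] by (simp add: \<Phi>_def i(1) mult_ac)
    then show "\<exists>D>0. \<forall>q. \<Phi> i (1 + D * q)" using D1(1) D2(1) by (intro exI[of _ "D1 * D2"]) auto
  qed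
  then obtain Q where Q: "0 < Q" "\<And>B B' q. B \<in> \<E> \<Longrightarrow> B' \<in> \<E> \<Longrightarrow> \<Phi> (B, B') (1 + Q * q)" by auto
  show ?thesis
  proof (rule that[OF Q(1)])
    fix q :: nat assume "1 \<le> q"
    define M where "M = 1 + Q * q"
    have M2: "2 \<le> M" using \<open>1 \<le> q\<close> Q(1) by (simp add: M_def Suc_le_eq)
    have fibc: "card (fibre M W x) = M ^ s" if "W \<in> span ` \<E>" "intvec x" for W x
      using that Q(2)[of _ _ q] unfolding \<Phi>_def M_def by auto
    have fibi: "card (fibre M W x \<inter> fibre M W' x) \<le> M ^ (s - 1)"
      if "W \<in> span ` \<E>" "W' \<in> span ` \<E>" "W \<noteq> W'" "intvec x" for W W' x
      using that Q(2)[of _ _ q] unfolding \<Phi>_def M_def by auto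
    have sub: "subspace W" if "W \<in> span ` \<E>" for W using that by auto
    have mem: "(W, F) \<in> torus_edges M (span ` \<E>) x \<longleftrightarrow> W \<in> span ` \<E> \<and> F = fibre M W x" for W F x
      by (auto simp: torus_edges_def)
    show "regular_hyp (grid (1 + Q * q)) (torus_edges (1 + Q * q) (span ` \<E>))
      (card (span ` \<E>)) ((1 + Q * q) ^ s) ((1 + Q * q) ^ (s - 1))"
      unfolding M_def[symmetric] regular_hyp_def
    proof (intro conjI ballI allI impI)
      show "finite (grid M)" by (rule finite_grid)
      show "1 \<le> card (span ` \<E>)" using fin \<E>(2) by (simp add: Suc_le_eq card_gt_0_iff)
      show "2 \<le> M ^ s" using M2 s power_increasing[of 1 s M] by simp
      show "1 \<le> M ^ (s - 1)" using M2 by simp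
      fix x :: "real ^ 'd" assume "x \<in> grid M"
      show "finite (torus_edges M (span ` \<E>) x)" using fin by (simp add: torus_edges_def)
      show "card (torus_edges M (span ` \<E>) x) = card (span ` \<E>)"
        unfolding torus_edges_def by (rule card_image) (auto simp: inj_on_def)
    next
      fix v assume "v \<in> \<Union> (torus_edges M (span ` \<E>) ` grid M)"
      then obtain x0 W where x0: "x0 \<in> grid M" "W \<in> span ` \<E>" "v = (W, fibre M W x0)"
        by (auto simp: torus_edges_def)
      have "{y \<in> grid M. v \<in> torus_edges M (span ` \<E>) y} = fibre M W x0"
        using x0 fibre_eq_iff[OF sub[OF x0(2)], of _ M x0] unfolding x0(3) mem by (auto simp: fibre_def)
      then show "card {y \<in> grid M. v \<in> torus_edges M (span ` \<E>) y} = M ^ s"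
        using fibc[OF x0(2) grid_intvec[OF x0(1)]] by simp
    next
      fix v w :: "(real ^ 'd) set \<times> (real ^ 'd) set" assume vw: "v \<noteq> w"
      let ?X = "{y \<in> grid M. v \<in> torus_edges M (span ` \<E>) y \<and> w \<in> torus_edges M (span ` \<E>) y}"
      show "card ?X \<le> M ^ (s - 1)"
      proof (cases "?X = {}")
        case False
        then obtain x0 where x0: "x0 \<in> grid M" "v \<in> torus_edges M (span ` \<E>) x0" "w \<in> torus_edges M (span ` \<E>) x0" by blast
        obtain W W' where W: "v = (W, fibre M W x0)" "w = (W', fibre M W' x0)" "W \<in> span ` \<E>" "W' \<in> span ` \<E>"
          using x0(2,3) by (auto simp: torus_edges_def)
        have "?X \<subseteq> fibre M W x0 \<inter> fibre M W' x0"
        proof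
          fix y assume "y \<in> ?X"
          then have "y \<in> grid M" "fibre M W y = fibre M W x0" "fibre M W' y = fibre M W' x0"
            unfolding W(1,2) mem by auto
          then show "y \<in> fibre M W x0 \<inter> fibre M W' x0"
            using fibre_eq_iff[OF sub[OF W(3)]] fibre_eq_iff[OF sub[OF W(4)]] by blast
        qed
        moreover have "finite (fibre M W x0 \<inter> fibre M W' x0)" 
          by (rule finite_subset[OF _ finite_grid[of M]]) (auto simp: fibre_def)
        ultimately have "card ?X \<le> card (fibre M W x0 \<inter> fibre M W' x0)" by (intro card_mono)
        also have "\<dots> \<le> M ^ (s - 1)" using W vw x0(1) grid_intvec by (intro fibi) auto
        finally show ?thesis .
      next
        case True
        show ?thesis unfolding True by simp
      qed
    qed
  qed
qed

section \<open>Unions of independent matchings\<close>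

fun unions :: "(('a set \<Rightarrow> real) \<Rightarrow> real) \<Rightarrow> nat \<Rightarrow> ('a set \<Rightarrow> real) \<Rightarrow> real" where
  "unions E 0 f = f {}"
| "unions E (Suc j) f = unions E j (\<lambda>S. E (\<lambda>M. f (S \<union> M)))"

definition bounded_sets :: "'a set \<Rightarrow> ('a \<Rightarrow> 'v set) \<Rightarrow> nat \<Rightarrow> 'a set set" where
  "bounded_sets P e j = {S. S \<subseteq> P \<and> (\<forall>v. card {x\<in>S. v \<in> e x} \<le> j)}"

lemma finite_bounded_sets: "finite P \<Longrightarrow> finite (bounded_sets P e j)"
  by (rule finite_subset[of _ "Pow P"]) (auto simp: bounded_sets_def)

lemma bounded_sets_Un:
  assumes "finite P" "S \<in> bounded_sets P e j" and M: "M \<in> matchings P e"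
  shows "S \<union> M \<in> bounded_sets P e (Suc j)"
proof -
  have MP: "M \<subseteq> P" using M by (simp add: matchings_def)
  then have finM: "finite M" using assms(1) by (rule finite_subset)
  have "card {x\<in>S \<union> M. v \<in> e x} \<le> Suc j" for v
  proof -
    have "{x\<in>S \<union> M. v \<in> e x} = {x\<in>S. v \<in> e x} \<union> {x\<in>M. v \<in> e x}" by blast
    then have "card {x\<in>S \<union> M. v \<in> e x} \<le> card {x\<in>S. v \<in> e x} + card {x\<in>M. v \<in> e x}"
      by (simp only: card_Un_le)
    moreover have "card {x\<in>M. v \<in> e x} \<le> Suc 0"
    proof -
      have "\<forall>x\<in>{x\<in>M. v \<in> e x}. \<forall>y\<in>{x\<in>M. v \<in> e x}. x = y"
        using matchings_disjnt[OF M] by blast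
      moreover have "finite {x\<in>M. v \<in> e x}" using finM by simp
      ultimately show ?thesis using card_le_Suc0_iff_eq by blast
    qed
    moreover have "card {x\<in>S. v \<in> e x} \<le> j" using assms(2) by (simp add: bounded_sets_def)
    ultimately show ?thesis by linarith
  qed
  then show ?thesis using assms(2) MP by (simp add: bounded_sets_def)
qed

lemma averaging_unions:
  assumes P: "finite P" and E: "averaging (matchings P e) E"
  shows "averaging (bounded_sets P e j) (unions E j)"
proof (induction j)
  case 0
  have "{} \<in> bounded_sets P e 0" by (simp add: bounded_sets_def)
  then show ?case using finite_bounded_sets[OF P] by unfold_locales auto
next
  case (Suc j)
  have "averaging (bounded_sets P e (Suc j)) (\<lambda>f. unions E j (\<lambda>S. E (\<lambda>M. f (S \<union> M))))"
    by (rule averaging.compose[OF Suc, where F = "\<lambda>_. E" and h = "(\<union>)"])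
      (rule E, rule bounded_sets_Un[OF P], assumption+, rule finite_bounded_sets[OF P])
  moreover have "unions E (Suc j) = (\<lambda>f. unions E j (\<lambda>S. E (\<lambda>M. f (S \<union> M))))"
    by (rule ext) simp
  ultimately show ?case by (simp only:)
qed

text \<open>Split \<open>Y\<close> into the part \<open>Z\<close> already contained in the earlier
  union and the rest, which the new matching must supply. Summing the product bound over all
  \<open>Z\<close> is the binomial expansion of \<open>((j + 1) * a) ^ card Y\<close>.\<close>

lemma unions_contains_le:
  assumes P: "finite P" and E: "averaging (matchings P e) E" and a: "0 \<le> a"
    and Z: "\<And>Z. Z \<subseteq> Y \<Longrightarrow> E (\<lambda>S. of_bool (Z \<subseteq> S)) \<le> a ^ card Z" and Y: "finite Y"
  shows "unions E j (\<lambda>S. of_bool (Y \<subseteq> S)) \<le> (real j * a) ^ card Y"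
  using Z Y
proof (induction j arbitrary: Y)
  case 0
  then show ?case by (auto simp: power_0_left card_eq_0_iff)
next
  case (Suc j)
  interpret U: averaging "bounded_sets P e j" "unions E j" by (rule averaging_unions[OF P E])
  interpret M: averaging "matchings P e" E by (rule E)
  have "unions E (Suc j) (\<lambda>S. of_bool (Y \<subseteq> S)) = unions E j (\<lambda>S. E (\<lambda>M. of_bool (Y \<subseteq> S \<union> M)))" by simp
  also have "\<dots> \<le> unions E j (\<lambda>S. \<Sum>Z\<in>Pow Y. E (\<lambda>M. of_bool (Y - Z \<subseteq> M)) * of_bool (Z \<subseteq> S))"
  proof (rule U.mono)
    fix S
    have "E (\<lambda>M. of_bool (Y \<subseteq> S \<union> M)) = E (\<lambda>M. of_bool (Y - Y \<inter> S \<subseteq> M)) * of_bool (Y \<inter> S \<subseteq> S)"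
      by (simp, rule M.cong) auto
    also have "\<dots> \<le> (\<Sum>Z\<in>Pow Y. E (\<lambda>M. of_bool (Y - Z \<subseteq> M)) * of_bool (Z \<subseteq> S))"
      using Suc.prems(2) by (intro member_le_sum) (auto intro!: mult_nonneg_nonneg M.nonneg)
    finally show "E (\<lambda>M. of_bool (Y \<subseteq> S \<union> M)) \<le> (\<Sum>Z\<in>Pow Y. E (\<lambda>M. of_bool (Y - Z \<subseteq> M)) * of_bool (Z \<subseteq> S))" .
  qed
  also have "\<dots> = (\<Sum>Z\<in>Pow Y. E (\<lambda>M. of_bool (Y - Z \<subseteq> M)) * unions E j (\<lambda>S. of_bool (Z \<subseteq> S)))"
    using Suc.prems(2) by (simp only: U.sum finite_Pow_iff U.scale)
  also have "\<dots> \<le> (\<Sum>Z\<in>Pow Y. a ^ card (Y - Z) * (real j * a) ^ card Z)"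
  proof (rule sum_mono)
    fix Z assume "Z \<in> Pow Y"
    then have "unions E j (\<lambda>S. of_bool (Z \<subseteq> S)) \<le> (real j * a) ^ card Z"
      using Suc.prems finite_subset by (intro Suc.IH) auto
    moreover have "E (\<lambda>M. of_bool (Y - Z \<subseteq> M)) \<le> a ^ card (Y - Z)" by (intro Suc.prems) auto
    ultimately show "E (\<lambda>M. of_bool (Y - Z \<subseteq> M)) * unions E j (\<lambda>S. of_bool (Z \<subseteq> S)) \<le> a ^ card (Y - Z) * (real j * a) ^ card Z"
      using a by (intro mult_mono U.nonneg) auto
  qed
  also have "\<dots> = (\<Prod>y\<in>Y. real j * a + a)"
    using prod_add[OF Suc.prems(2), of "\<lambda>_. real j * a" "\<lambda>_. a"] by (simp add: mult.commute)
  also have "real j * a + a = real (Suc j) * a" by (simp add: algebra_simps)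
  finally show ?case by simp
qed

text \<open>Independence turns the probability \<open>y\<close> of \<open>x\<close> into
  \<open>c + y - c * y\<close>. The overlap \<open>c * y\<close> is at most
  \<open>a * (j * a)\<close>, and over \<open>j\<close> steps these overlaps stay below
  \<open>(j * a)\<^sup>2\<close>.\<close>

lemma unions_member_ge:
  assumes P: "finite P" and E: "averaging (matchings P e) E"
    and lower: "b \<le> E (\<lambda>S. of_bool (x \<in> S))" and upper: "E (\<lambda>S. of_bool (x \<in> S)) \<le> a"
  shows "real j * b - (real j * a)\<^sup>2 \<le> unions E j (\<lambda>S. of_bool (x \<in> S))"
proof (induction j)
  case (Suc j)
  interpret U: averaging "bounded_sets P e j" "unions E j" by (rule averaging_unions[OF P E])
  interpret M: averaging "matchings P e" E by (rule E)
  define c where "c = E (\<lambda>S. of_bool (x \<in> S))"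
  define y where "y = unions E j (\<lambda>S. of_bool (x \<in> S))"
  have c: "0 \<le> c" "b \<le> c" "c \<le> a" using lower upper by (auto simp: c_def intro: M.nonneg)
  have y: "0 \<le> y" "y \<le> real j * a"
  proof -
    show "0 \<le> y" unfolding y_def by (rule U.nonneg) simp
    have "E (\<lambda>S. of_bool (Z \<subseteq> S)) \<le> a ^ card Z" if "Z \<subseteq> {x}" for Z
      using that upper M.one by (cases "Z = {}") (auto simp: subset_singleton_iff)
    then show "y \<le> real j * a"
      using unions_contains_le[OF P E, of a "{x}" j] c by (auto simp: y_def)
  qed
  have "unions E (Suc j) (\<lambda>S. of_bool (x \<in> S)) = unions E j (\<lambda>S. c + (1 - c) * of_bool (x \<in> S))"
    unfolding unions.simps
  proof (rule U.cong)
    fix S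
    show "E (\<lambda>M. of_bool (x \<in> S \<union> M)) = c + (1 - c) * of_bool (x \<in> S)"
      by (cases "x \<in> S") (auto simp: c_def M.one)
  qed
  also have "\<dots> = c + (1 - c) * y" by (simp only: U.add U.const U.scale y_def)
  finally have step: "unions E (Suc j) (\<lambda>S. of_bool (x \<in> S)) = c + y - c * y" by (simp add: algebra_simps)
  have "c * y \<le> a * (real j * a)" using c y by (intro mult_mono) auto
  moreover have "real j * b - (real j * a)\<^sup>2 \<le> y" using Suc by (simp add: y_def)
  moreover have "(real (Suc j) * a)\<^sup>2 = (real j * a)\<^sup>2 + a * (real j * a) + (real j + 1) * a\<^sup>2"
    by (simp add: power2_eq_square algebra_simps)
  moreover have "0 \<le> (real j + 1) * a\<^sup>2" by simp
  moreover have "real (Suc j) * b = real j * b + b" by (simp add: algebra_simps)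
  ultimately show ?case unfolding step using c by linarith
qed simp

section \<open>The case of bounded \<open>k\<close>\<close>

lemma dirs_nonempty:
  assumes "s \<le> CARD('d)"
  obtains B :: "(real ^ 'd::finite) set" where "B \<in> dirs s"
proof -
  have "s \<le> card (Basis :: (real ^ 'd) set)" using assms by simp
  then obtain B :: "(real ^ 'd) set" where B: "B \<subseteq> Basis" "card B = s"
    by (metis obtain_subset_with_card_n)
  have "independent B" using independent_Basis B(1) by (rule independent_mono)
  moreover have "intvec b" if "b \<in> B" for b
    using that B(1) by (auto simp: Basis_vec_def intvec_def axis_def)
  ultimately show ?thesis using B(2) that by (auto simp: dirs_def)
qed

lemma grid_mono: "n \<le> M \<Longrightarrow> grid n \<subseteq> grid M"
  unfolding grid_def by fastforce

text \<open>Grid points on one flat of direction \<open>span B\<close> are congruent, so as edges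
  they all share the vertex given by the class of \<open>x\<close>, which lies on at most
  \<open>k\<close> edges of \<open>S\<close>.\<close>

lemma crowded_exceptional:
  fixes x :: "real ^ 'd::finite"
  assumes S: "S \<in> bounded_sets (grid M) (torus_edges M \<W>) k" and W: "span B \<in> \<W>"
    and x: "x \<in> grid n" and n: "n \<le> M"
  shows "\<not> crowded k x B (S \<inter> grid n)"
proof -
  define v where "v = (span B, fibre M (span B) x)"
  have "S \<inter> grid n \<inter> flat x B \<subseteq> {y \<in> S. v \<in> torus_edges M \<W> y}"
  proof
    fix y assume y: "y \<in> S \<inter> grid n \<inter> flat x B"
    have yM: "y \<in> grid M" using y grid_mono[OF n] by auto
    have "intvec (y - x)" using y x grid_intvec[of y n] grid_intvec[of x n] by (intro intvec_diff) auto
    then have "lat_cong M (span B) y x" unfolding lat_cong_def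
      using y by (intro bexI[of _ "y - x"]) (auto simp: flat_def intvec_0)
    then have "fibre M (span B) y = fibre M (span B) x"
      using yM fibre_eq_iff[OF subspace_span yM, of B x] by (simp add: fibre_def)
    then show "y \<in> {y \<in> S. v \<in> torus_edges M \<W> y}"
      using y W unfolding v_def torus_edges_def by auto
  qed
  moreover have "finite {y \<in> S. v \<in> torus_edges M \<W> y}"
    using S finite_grid[of M] by (auto simp: bounded_sets_def intro: finite_subset)
  ultimately have "card (S \<inter> grid n \<inter> flat x B) \<le> card {y \<in> S. v \<in> torus_edges M \<W> y}"
    by (rule card_mono[rotated])
  also have "\<dots> \<le> k" using S unfolding bounded_sets_def by blast
  finally show ?thesis by (simp add: crowded_def)
qed

text \<open>Union bound over the \<open>k\<close>-subsets of the flat without \<open>x\<close>: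
  together with \<open>x\<close> each has \<open>k + 1\<close> points, so the moment bound of that
  order suffices.\<close>

lemma crowded_tail:
  fixes x :: "real ^ 'd::finite"
  assumes E: "averaging \<Omega> E" and p: "0 \<le> p"
    and contains: "\<And>Y. Y \<subseteq> grid n \<Longrightarrow> card Y = k + 1 \<Longrightarrow> E (\<lambda>S. of_bool (Y \<subseteq> S)) \<le> p ^ (k + 1)"
    and x: "x \<in> grid n"
  shows "E (\<lambda>S. of_bool (crowded k x B (S \<inter> grid n))) \<le> real (card (grid n \<inter> flat x B)) ^ k * p ^ (k + 1)"
proof -
  interpret averaging \<Omega> E by (rule E)
  define X where "X = grid n \<inter> flat x B - {x}"
  define \<Y> where "\<Y> = {Y. Y \<subseteq> X \<and> card Y = k}"
  have finX: "finite X" by (simp add: X_def finite_grid)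
  have fin\<Y>: "finite \<Y>" by (rule finite_subset[of _ "Pow X"]) (auto simp: \<Y>_def finX)
  have "E (\<lambda>S. of_bool (crowded k x B (S \<inter> grid n))) \<le> E (\<lambda>S. \<Sum>Y\<in>\<Y>. of_bool (insert x Y \<subseteq> S))"
  proof (rule mono)
    fix S
    show "of_bool (crowded k x B (S \<inter> grid n)) \<le> (\<Sum>Y\<in>\<Y>. of_bool (insert x Y \<subseteq> S) :: real)"
    proof (cases "crowded k x B (S \<inter> grid n)")
      case True
      have "S \<inter> grid n \<inter> flat x B - {x} = S \<inter> X" by (auto simp: X_def)
      moreover have "x \<in> S \<inter> grid n \<inter> flat x B" using True x by (auto simp: crowded_def flat_def span_zero)
      ultimately have "card (S \<inter> X) = card (S \<inter> grid n \<inter> flat x B) - 1" by (metis card_Diff_singleton)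
      then have "k \<le> card (S \<inter> X)" using True unfolding crowded_def by arith
      then obtain Y where Y: "Y \<subseteq> S \<inter> X" "card Y = k" by (metis obtain_subset_with_card_n)
      then have "Y \<in> \<Y>" "insert x Y \<subseteq> S" using True by (auto simp: \<Y>_def crowded_def)
      then have "(1::real) = of_bool (insert x Y \<subseteq> S)" by simp
      also have "\<dots> \<le> (\<Sum>Y\<in>\<Y>. of_bool (insert x Y \<subseteq> S))"
        using \<open>Y \<in> \<Y>\<close> fin\<Y> by (intro member_le_sum) auto
      finally show ?thesis using True by simp
    next
      case False
      then show ?thesis by (simp add: sum_nonneg)
    qed
  qed
  also have "\<dots> = (\<Sum>Y\<in>\<Y>. E (\<lambda>S. of_bool (insert x Y \<subseteq> S)))" by (rule sum[OF fin\<Y>])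
  also have "\<dots> \<le> (\<Sum>Y\<in>\<Y>. p ^ (k + 1))"
  proof (rule sum_mono)
    fix Y assume "Y \<in> \<Y>"
    then have Y: "Y \<subseteq> X" "card Y = k" by (auto simp: \<Y>_def)
    have "finite Y" using Y(1) finX by (rule finite_subset)
    moreover have "x \<notin> Y" using Y by (auto simp: X_def)
    ultimately have "card (insert x Y) = k + 1" using Y(2) by simp
    moreover have "insert x Y \<subseteq> grid n" using Y(1) x by (auto simp: X_def)
    ultimately show "E (\<lambda>S. of_bool (insert x Y \<subseteq> S)) \<le> p ^ (k + 1)" by (intro contains)
  qed
  also have "\<dots> = real (card \<Y>) * p ^ (k + 1)" by simp
  also have "\<dots> \<le> real (card (grid n \<inter> flat x B)) ^ k * p ^ (k + 1)"
  proof (intro mult_right_mono)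
    have "card \<Y> = card X choose k" unfolding \<Y>_def using finX by (rule n_subsets)
    also have "\<dots> \<le> card X ^ k"
      by (cases "k \<le> card X") (auto simp: binomial_le_pow binomial_eq_0)
    also have "\<dots> \<le> card (grid n \<inter> flat x B) ^ k"
      unfolding X_def by (intro power_mono card_mono) (auto simp: finite_grid)
    finally show "real (card \<Y>) \<le> real (card (grid n \<inter> flat x B)) ^ k" by (metis of_nat_le_iff of_nat_power)
  qed (use p in simp)
  finally show ?thesis .
qed

text \<open>As \<open>k\<close> is fixed, the exceptional family, the modulus and the admissible
  codegree ratio may all depend on it. Exceptional directions produce no crowded pair at all, so
  only the tail of the height sum is paid for by deletion.\<close>

lemma small_k:
  fixes \<eta> :: real
  assumes \<eta>: "0 < \<eta>" "\<eta> < 1" and s: "1 \<le> s" "s \<le> CARD('d::finite)" and k: "CARD('d) + 1 \<le> k"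
  obtains n1 where "\<And>n. n1 \<le> n \<Longrightarrow>
    \<exists>S \<subseteq> (grid n :: (real ^ 'd) set). (1 - \<eta>) * real k * real n ^ (CARD('d) - s) \<le> real (card S) \<and>
      (\<forall>A. affine A \<and> aff_dim A = int s \<longrightarrow> card (S \<inter> A) \<le> k)"
proof -
  define d where "d = CARD('d)"
  define C where "C = basis_const d s"
  have C: "0 < C" by (simp add: C_def basis_const_pos)
  have k0: "0 < k" using k by simp
  \<comment> \<open>Of \<open>(C * n ^ s / h) ^ k\<close> choices and
    \<open>(2 * k / n ^ s) ^ (k + 1)\<close> for the probability, \<open>G / n ^ s\<close> remains
    besides \<open>1 / h ^ k\<close>.\<close>
  define G where "G = C ^ k * (2 * real k) ^ (k + 1)"
  have G: "0 < G" using C k0 by (simp add: G_def)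
  define \<epsilon> where "\<epsilon> = \<eta> / 4 / G"
  have \<epsilon>: "0 < \<epsilon>" using \<eta> G by (simp add: \<epsilon>_def)
  obtain \<E>0 :: "(real ^ 'd) set set" where \<E>0: "finite \<E>0" "\<E>0 \<subseteq> dirs s"
    "\<And>\<B>. finite \<B> \<Longrightarrow> \<B> \<subseteq> dirs s - \<E>0 \<Longrightarrow> (\<Sum>B\<in>\<B>. (1 / height B) ^ (CARD('d) + 1)) \<le> \<epsilon>"
    using height_sum_tail[OF \<epsilon>] by blast
  obtain B1 :: "(real ^ 'd) set" where B1: "B1 \<in> dirs s" using dirs_nonempty[OF s(2)] .
  \<comment> \<open>One more direction is added because the exceptional family may be empty, whereas
    the edges of the hypergraph must not be.\<close>
  define \<E> where "\<E> = insert B1 \<E>0"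
  have \<E>: "finite \<E>" "\<E> \<subseteq> dirs s" "\<E> \<noteq> {}" using \<E>0 B1 by (auto simp: \<E>_def)
  define \<W> where "\<W> = span ` \<E>"
  define m where "m = card \<W>"
  have m: "1 \<le> m" using \<E> by (simp add: m_def \<W>_def Suc_le_eq card_gt_0_iff)
  obtain Q where Q: "0 < Q" "\<And>q. 1 \<le> q \<Longrightarrow>
      regular_hyp (grid (1 + Q * q)) (torus_edges (1 + Q * q) \<W>) m ((1 + Q * q) ^ s) ((1 + Q * q) ^ (s - 1))"
    using torus_regular[OF \<E> s(1)] unfolding m_def \<W>_def by blast
  have "0 < \<eta> / 8" using \<eta> by simp
  from random_matching[OF m this, where ?'a = "real ^ 'd" and ?'v = "(real ^ 'd) set \<times> (real ^ 'd) set" and U = "k + 1"]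
  obtain \<delta>0 where \<delta>0: "0 < \<delta>0"
    "\<And>(P :: (real ^ 'd) set) (e :: real ^ 'd \<Rightarrow> ((real ^ 'd) set \<times> (real ^ 'd) set) set) N L.
      regular_hyp P e m N L \<Longrightarrow> real L \<le> \<delta>0 * real N \<Longrightarrow>
      \<exists>E. averaging (matchings P e) E \<and>
        (\<forall>x\<in>P. (1 - \<eta> / 8) / real N \<le> E (\<lambda>S. of_bool (x \<in> S))) \<and>
        (\<forall>Z. Z \<subseteq> P \<longrightarrow> card Z \<le> k + 1 \<longrightarrow> E (\<lambda>S. of_bool (Z \<subseteq> S)) \<le> (2 / real N) ^ card Z)"
    by blast
  \<comment> \<open>In order: \<open>deletion\<close> wants \<open>n\<close> at least 2; the
    codegree ratio \<open>1 / M\<close> must be at most \<open>\<delta>0\<close>; overlaps among the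
    \<open>k\<close> matchings must be negligible; and \<open>(n / M) ^ s\<close> must be close to
    1.\<close>
  obtain n1 :: nat where n1: "2 + 1 / \<delta>0 + 16 * real k / \<eta> + 8 * real s * real (Q + 1) / \<eta> \<le> real n1"
    using real_arch_simple by blast
  show ?thesis
  proof (rule that)
    fix n assume "n1 \<le> n"
    have nb: "2 + 1 / \<delta>0 + 16 * real k / \<eta> + 8 * real s * real (Q + 1) / \<eta> \<le> real n"
      using n1 \<open>n1 \<le> n\<close> by (meson of_nat_mono order.trans)
    have pos: "0 \<le> 1 / \<delta>0" "0 \<le> 16 * real k / \<eta>" "0 \<le> 8 * real s * real (Q + 1) / \<eta>"
      using \<delta>0(1) \<eta> by auto
    have n: "2 \<le> real n" "1 / \<delta>0 \<le> real n" "16 * real k / \<eta> \<le> real n" "8 * real s * real (Q + 1) / \<eta> \<le> real n"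
      using nb pos by linarith+
    \<comment> \<open>The first admissible modulus above \<open>n\<close>; it exceeds
      \<open>n\<close> by at most \<open>Q + 1\<close>.\<close>
    define M where "M = 1 + Q * (n div Q + 1)"
    have nM: "n \<le> M" "M \<le> n + (Q + 1)"
    proof -
      have "n = Q * (n div Q) + n mod Q" "n mod Q < Q" using Q(1) by auto
      then show "n \<le> M" "M \<le> n + (Q + 1)" unfolding M_def add_mult_distrib2 by linarith+
    qed
    define N where "N = real M ^ s"
    have nMr: "real n \<le> real M" "real M \<le> real n + real (Q + 1)" using nM by linarith+
    have M0: "0 < real M" using nMr n by linarith
    have ns: "0 < real n ^ s" using n by simp
    have nN: "real n ^ s \<le> N" unfolding N_def using nMr by (intro power_mono) auto
    have N0: "0 < N" using nN ns by linarith
    let ?P = "grid M :: (real ^ 'd) set" and ?e = "torus_edges M \<W> :: real ^ 'd \<Rightarrow> _"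
    have reg: "regular_hyp ?P ?e m (M ^ s) (M ^ (s - 1))" unfolding M_def by (rule Q(2)) simp
    have "1 \<le> \<delta>0 * real M"
    proof -
      have "1 / \<delta>0 \<le> real M" using n nMr by linarith
      then show ?thesis using \<delta>0(1) by (simp add: field_simps)
    qed
    then have "1 * real M ^ (s - 1) \<le> (\<delta>0 * real M) * real M ^ (s - 1)" by (intro mult_right_mono) auto
    also have "\<dots> = \<delta>0 * (real M * real M ^ (s - 1))" by simp
    also have "real M * real M ^ (s - 1) = real M ^ s" using s(1) by (cases s) auto
    finally have "real (M ^ (s - 1)) \<le> \<delta>0 * real (M ^ s)" by simp
    from \<delta>0(2)[OF reg this] obtain E where E: "averaging (matchings ?P ?e) E"
      "\<And>x. x \<in> ?P \<Longrightarrow> (1 - \<eta> / 8) / N \<le> E (\<lambda>S. of_bool (x \<in> S))"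
      "\<And>Z. Z \<subseteq> ?P \<Longrightarrow> card Z \<le> k + 1 \<Longrightarrow> E (\<lambda>S. of_bool (Z \<subseteq> S)) \<le> (2 / N) ^ card Z"
      unfolding N_def by auto
    have finP: "finite ?P" by (rule finite_grid)
    interpret U: averaging "bounded_sets ?P ?e k" "unions E k" by (rule averaging_unions[OF finP E(1)])
    have gsub: "(grid n :: (real ^ 'd) set) \<subseteq> ?P" by (rule grid_mono[OF nM(1)])
    define \<Omega> where "\<Omega> = Pow (grid n :: (real ^ 'd) set)"
    \<comment> \<open>The random subset of the torus is cut down to the grid.\<close>
    define E' where "E' = (\<lambda>f. unions E k (\<lambda>S. f (S \<inter> (grid n :: (real ^ 'd) set))))"
    have E': "averaging \<Omega> E'"
      unfolding E'_def by (rule U.map) (auto simp: \<Omega>_def finite_grid)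
    define a where "a = real n ^ d * (real k * ((1 - \<eta> / 8) / N) - (real k * (2 / N))\<^sup>2)"
    define b where "b = real n ^ d * (\<eta> / 4 / real n ^ s)"
    have size: "a \<le> (\<Sum>x\<in>grid n. E' (\<lambda>S. of_bool (x \<in> S)))"
    proof -
      have "real k * ((1 - \<eta> / 8) / N) - (real k * (2 / N))\<^sup>2 \<le> E' (\<lambda>S. of_bool (x \<in> S))" if x: "x \<in> grid n" for x
      proof -
        have xP: "x \<in> ?P" using x gsub by auto
        have "E (\<lambda>S. of_bool (x \<in> S)) \<le> 2 / N" using E(3)[of "{x}"] xP by simp
        then have "real k * ((1 - \<eta> / 8) / N) - (real k * (2 / N))\<^sup>2 \<le> unions E k (\<lambda>S. of_bool (x \<in> S))"
          by (rule unions_member_ge[OF finP E(1) E(2)[OF xP]])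
        also have "\<dots> = E' (\<lambda>S. of_bool (x \<in> S))" unfolding E'_def using x by simp
        finally show ?thesis .
      qed
      then have "(\<Sum>x\<in>(grid n :: (real ^ 'd) set). real k * ((1 - \<eta> / 8) / N) - (real k * (2 / N))\<^sup>2) \<le>
          (\<Sum>x\<in>grid n. E' (\<lambda>S. of_bool (x \<in> S)))" by (intro sum_mono)
      then show ?thesis by (simp add: a_def card_grid d_def)
    qed
    have contains: "unions E k (\<lambda>S. of_bool (Y \<subseteq> S)) \<le> (real k * (2 / N)) ^ (k + 1)"
      if "Y \<subseteq> grid n" "card Y = k + 1" for Y
    proof -
      have finY: "finite Y" using that finite_grid finite_subset by blast
      have "E (\<lambda>S. of_bool (Z \<subseteq> S)) \<le> (2 / N) ^ card Z" if "Z \<subseteq> Y" for Z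
      proof (rule E(3))
        show "Z \<subseteq> ?P" using that \<open>Y \<subseteq> grid n\<close> gsub by blast
        show "card Z \<le> k + 1" using card_mono[OF finY that] \<open>card Y = k + 1\<close> by simp
      qed
      then have "unions E k (\<lambda>S. of_bool (Y \<subseteq> S)) \<le> (real k * (2 / N)) ^ card Y"
        using N0 finY by (intro unions_contains_le[OF finP E(1)]) auto
      then show ?thesis using that(2) by simp
    qed
    have exceptional: "E' (\<lambda>S. of_bool (crowded k x B S)) = 0" if "x \<in> grid n" "B \<in> \<E>" for x B
      unfolding E'_def
    proof (rule U.zero)
      fix S assume "S \<in> bounded_sets ?P ?e k"
      then have "\<not> crowded k x B (S \<inter> grid n)"
        using crowded_exceptional[of S M \<W> k B x n] that nM(1) by (auto simp: \<W>_def)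
      then show "of_bool (crowded k x B (S \<inter> grid n)) = (0::real)" by simp
    qed
    have tail: "E' (\<lambda>S. of_bool (crowded k x B S)) \<le> G / real n ^ s * (1 / height B) ^ (d + 1)"
      if x: "x \<in> grid n" and B: "B \<in> short_dirs n s x - \<E>" for x B
    proof -
      let ?c = "real (card (grid n \<inter> flat x B))"
      have h1: "1 \<le> height B" using B height_ge_1 by (auto simp: short_dirs_def)
      have "?c * height B \<le> C * real n ^ s" using B by (simp add: short_dirs_def C_def d_def)
      then have c: "?c \<le> C * real n ^ s * (1 / height B)" using h1 by (simp add: field_simps)
      have "E' (\<lambda>S. of_bool (crowded k x B S)) \<le> ?c ^ k * (real k * (2 / N)) ^ (k + 1)"
        unfolding E'_def using N0 contains x by (intro crowded_tail[OF U.averaging_axioms]) auto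
      also have "\<dots> \<le> (C * real n ^ s * (1 / height B)) ^ k * (real k * (2 / real n ^ s)) ^ (k + 1)"
      proof (rule mult_mono)
        show "?c ^ k \<le> (C * real n ^ s * (1 / height B)) ^ k" using c by (rule power_mono) simp
        have "2 / N \<le> 2 / real n ^ s" using nN ns by (intro divide_left_mono mult_pos_pos N0) auto
        then have "real k * (2 / N) \<le> real k * (2 / real n ^ s)" by (rule mult_left_mono) simp
        moreover have p0: "0 \<le> real k * (2 / N)" using N0 by simp
        ultimately show "(real k * (2 / N)) ^ (k + 1) \<le> (real k * (2 / real n ^ s)) ^ (k + 1)" by (rule power_mono)
        show "0 \<le> (real k * (2 / N)) ^ (k + 1)" using p0 by (rule zero_le_power)
        show "0 \<le> (C * real n ^ s * (1 / height B)) ^ k" using C h1 by (intro zero_le_power mult_nonneg_nonneg) auto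
      qed
      also have "\<dots> = G / real n ^ s * (1 / height B) ^ k"
      proof -
        have "(real k * (2 / real n ^ s)) ^ (k + 1) = (2 * real k / real n ^ s) ^ (k + 1)" by (simp only: times_divide_eq_right mult.commute)
        also have "\<dots> = (2 * real k) ^ (k + 1) / ((real n ^ s) ^ k * real n ^ s)"
          unfolding power_divide by (simp only: power_add power_one_right)
        finally have 1: "(real k * (2 / real n ^ s)) ^ (k + 1) = (2 * real k) ^ (k + 1) / ((real n ^ s) ^ k * real n ^ s)" .
        have 2: "c * zk * h * (K / (zk * z)) = c * K / z * h" if "zk \<noteq> 0" for c zk h K z :: real
          using that by simp
        show ?thesis
          unfolding G_def 1 power_mult_distrib[of "C * real n ^ s"] power_mult_distrib[of C]
          by (rule 2) (use ns in auto)
      qed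
      also have "\<dots> \<le> G / real n ^ s * (1 / height B) ^ (d + 1)"
        proof (intro mult_left_mono power_decreasing)
        show "d + 1 \<le> k" using k by (simp add: d_def)
        show "0 \<le> G / real n ^ s" using G ns by (intro divide_nonneg_nonneg) auto
      qed (use h1 in auto)
      finally show ?thesis .
    qed
    have per_point: "(\<Sum>B\<in>short_dirs n s x. E' (\<lambda>S. of_bool (crowded k x B S))) \<le> \<eta> / 4 / real n ^ s"
      if x: "x \<in> grid n" for x
    proof -
      let ?f = "\<lambda>B. E' (\<lambda>S. of_bool (crowded k x B S))"
      have fsd: "finite (short_dirs n s x)" by (rule finite_short_dirs)
      have "(\<Sum>B\<in>short_dirs n s x. ?f B) = (\<Sum>B\<in>short_dirs n s x - \<E>. ?f B)"
        using fsd exceptional[OF x] by (intro sum.mono_neutral_right) auto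
      also have "\<dots> \<le> (\<Sum>B\<in>short_dirs n s x - \<E>. G / real n ^ s * (1 / height B) ^ (d + 1))"
        using tail[OF x] by (intro sum_mono) auto
      also have "\<dots> = G / real n ^ s * (\<Sum>B\<in>short_dirs n s x - \<E>. (1 / height B) ^ (d + 1))"
        by (simp only: sum_distrib_left)
      also have "\<dots> \<le> G / real n ^ s * \<epsilon>"
      proof (rule mult_left_mono)
        show "(\<Sum>B\<in>short_dirs n s x - \<E>. (1 / height B) ^ (d + 1)) \<le> \<epsilon>"
          unfolding d_def using fsd by (intro \<E>0(3)) (auto simp: short_dirs_def \<E>_def)
        show "0 \<le> G / real n ^ s" using G ns by (intro divide_nonneg_nonneg) auto
      qed
      also have "\<dots> = \<eta> / 4 / real n ^ s" using G by (simp add: \<epsilon>_def)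
      finally show ?thesis .
    qed
    have bad: "(\<Sum>x\<in>grid n. \<Sum>B\<in>short_dirs n s x. E' (\<lambda>S. of_bool (crowded k x B S))) \<le> b"
    proof -
      have "(\<Sum>x\<in>grid n. \<Sum>B\<in>short_dirs n s x. E' (\<lambda>S. of_bool (crowded k x B S))) \<le>
          (\<Sum>x\<in>(grid n :: (real ^ 'd) set). \<eta> / 4 / real n ^ s)" by (intro sum_mono per_point)
      then show ?thesis by (simp add: b_def card_grid d_def)
    qed
    have "2 \<le> n" using n(1) by linarith
    have "\<exists>S \<subseteq> (grid n :: (real ^ 'd) set). a - b \<le> real (card S) \<and>
        (\<forall>A. affine A \<and> aff_dim A = int s \<longrightarrow> card (S \<inter> A) \<le> k)"
      by (rule deletion[OF E' _ \<open>2 \<le> n\<close> s(2) size bad]) (auto simp: \<Omega>_def)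
    moreover have "(1 - \<eta>) * real k * real n ^ (CARD('d) - s) \<le> a - b"
    proof -
      \<comment> \<open>The matchings have density about \<open>1 / N\<close> although
        \<open>1 / n ^ s\<close> is wanted; \<open>\<rho>\<close> is the resulting loss
        factor.\<close>
      define \<rho> where "\<rho> = real n ^ s / N"
      have \<rho>: "1 - \<eta> / 8 \<le> \<rho>" "\<rho> \<le> 1"
      proof -
        show "\<rho> \<le> 1" using nN N0 by (simp add: \<rho>_def)
        have "real s * real (Q + 1) / real M \<le> real s * real (Q + 1) / real n"
          using nMr n M0 by (intro divide_left_mono) auto
        also have "\<dots> \<le> \<eta> / 8" using n \<eta> by (simp add: field_simps)
        finally have "real s * real (Q + 1) / real M \<le> \<eta> / 8" .
        moreover have "real s * (- (real (Q + 1) / real M)) \<le> real s * (real n / real M - 1)"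
        proof (rule mult_left_mono)
          have "(real M - real (Q + 1)) / real M \<le> real n / real M"
            by (rule divide_right_mono) (use nMr in linarith, simp)
          moreover have "(real M - real (Q + 1)) / real M = 1 - real (Q + 1) / real M"
            using M0 by (simp only: diff_divide_distrib) simp
          ultimately show "- (real (Q + 1) / real M) \<le> real n / real M - 1" by linarith
        qed simp
        moreover have "real s * (- (real (Q + 1) / real M)) = - (real s * real (Q + 1) / real M)" by simp
        moreover have "1 + real s * (real n / real M - 1) \<le> (1 + (real n / real M - 1)) ^ s"
          using M0 by (intro Bernoulli_inequality) simp
        moreover have "(1 + (real n / real M - 1)) ^ s = \<rho>" by (simp add: \<rho>_def N_def power_divide)
        ultimately show "1 - \<eta> / 8 \<le> \<rho>" by linarith
      qed
      have nd: "real n ^ d = real n ^ (d - s) * real n ^ s" using s by (simp add: d_def flip: power_add)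
      have eq: "a - b = real n ^ (d - s) * (real k * ((1 - \<eta> / 8) * \<rho>) - 4 * (real k)\<^sup>2 * (\<rho> / N) - \<eta> / 4)"
      proof -
        have id: "x * z * (\<kappa> * (\<beta> / N) - (\<kappa> * (2 / N))\<^sup>2) - x * z * (\<eta> / 4 / z) =
            x * (\<kappa> * (\<beta> * (z / N)) - 4 * \<kappa>\<^sup>2 * (z / N / N) - \<eta> / 4)" if "z \<noteq> 0" for x z \<kappa> \<beta> :: real
          using that by (simp add: power2_eq_square algebra_simps)
        show ?thesis unfolding a_def b_def nd \<rho>_def by (rule id) (use ns in simp)
      qed
      \<comment> \<open>The losses, relative to \<open>k\<close>: \<open>\<eta> / 4\<close> from the
        nibble and \<open>\<rho>\<close> together, \<open>\<eta> / 4\<close> from overlaps, and at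
        most \<open>\<eta> / 4\<close> from deletion because \<open>k \<ge> 1\<close>.\<close>
      have le: "(1 - \<eta>) * real k \<le> real k * ((1 - \<eta> / 8) * \<rho>) - 4 * (real k)\<^sup>2 * (\<rho> / N) - \<eta> / 4"
      proof -
        have "(1 - \<eta> / 8) * (1 - \<eta> / 8) \<le> (1 - \<eta> / 8) * \<rho>" using \<rho> \<eta> by (intro mult_left_mono) auto
        moreover have "1 - \<eta> / 4 \<le> (1 - \<eta> / 8) * (1 - \<eta> / 8)" by (simp add: algebra_simps)
        ultimately have "1 - \<eta> / 4 \<le> (1 - \<eta> / 8) * \<rho>" by linarith
        then have main: "real k * (1 - \<eta> / 4) \<le> real k * ((1 - \<eta> / 8) * \<rho>)" by (rule mult_left_mono) simp
        have err: "4 * (real k)\<^sup>2 * (\<rho> / N) \<le> real k * (\<eta> / 4)"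
        proof -
          have "real n \<le> real n ^ s" using n s(1) power_increasing[of 1 s "real n"] by simp
          then have "16 * real k / \<eta> \<le> N" using n nN by linarith
          then have "16 * real k / N \<le> \<eta>" using N0 \<eta> by (simp add: field_simps)
          have "\<rho> / N \<le> 1 / N" using \<rho> N0 by (intro divide_right_mono) auto
          then have "4 * (real k)\<^sup>2 * (\<rho> / N) \<le> 4 * (real k)\<^sup>2 * (1 / N)" by (intro mult_left_mono) auto
          also have "\<dots> = real k * (16 * real k / N / 4)" by (simp add: power2_eq_square)
          also have "\<dots> \<le> real k * (\<eta> / 4)" using \<open>16 * real k / N \<le> \<eta>\<close> by (intro mult_left_mono divide_right_mono) auto
          finally show ?thesis .
        qed
        have "(1 - \<eta>) * real k \<le> x - y - \<eta> / 4"
          if "real k * (1 - \<eta> / 4) \<le> x" "y \<le> real k * (\<eta> / 4)" for x y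
        proof -
          define w where "w = \<eta> * real k"
          have "\<eta> * 1 \<le> w" unfolding w_def using k0 \<eta> by (intro mult_left_mono) auto
          moreover have "real k - w / 4 \<le> x" "y \<le> w / 4"
            using that by (simp_all add: w_def algebra_simps)
          ultimately have "real k - w \<le> x - y - \<eta> / 4" using \<eta>(1) by linarith
          then show ?thesis by (simp add: w_def algebra_simps)
        qed
        from this[OF main err] show ?thesis .
      qed
      have "real n ^ (d - s) * ((1 - \<eta>) * real k) \<le> a - b"
        unfolding eq using le by (rule mult_left_mono) simp
      then show ?thesis by (simp only: d_def mult_ac)
    qed
    ultimately show "\<exists>S \<subseteq> (grid n :: (real ^ 'd) set). (1 - \<eta>) * real k * real n ^ (CARD('d) - s) \<le> real (card S) \<and>
      (\<forall>A. affine A \<and> aff_dim A = int s \<longrightarrow> card (S \<inter> A) \<le> k)"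
      by (meson order.trans)
  qed
qed

section \<open>Assembling the threshold\<close>

text \<open>The bound \<open>K0\<close> of \<open>large_k\<close> does not depend on
  \<open>n\<close>, so only finitely many \<open>k\<close> are left to \<open>small_k\<close>, and
  their separate thresholds have a maximum.\<close>

lemma all_k:
  fixes \<eta> :: real
  assumes \<eta>: "0 < \<eta>" "\<eta> < 1" and s: "1 \<le> s" "s \<le> CARD('d::finite)"
  shows "\<forall>\<^sub>F n in sequentially. \<forall>k. CARD('d) + 1 \<le> k \<and> k \<le> n ^ s \<longrightarrow>
    (\<exists>S \<subseteq> (grid n :: (real ^ 'd) set). (1 - \<eta>) * real k * real n ^ (CARD('d) - s) \<le> real (card S) \<and>
      (\<forall>A. affine A \<and> aff_dim A = int s \<longrightarrow> card (S \<inter> A) \<le> k))"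
proof -
  let ?good = "\<lambda>n k. \<exists>S \<subseteq> (grid n :: (real ^ 'd) set).
    (1 - \<eta>) * real k * real n ^ (CARD('d) - s) \<le> real (card S) \<and>
      (\<forall>A. affine A \<and> aff_dim A = int s \<longrightarrow> card (S \<inter> A) \<le> k)"
  obtain K0 where K0: "\<And>n k. 2 \<le> n \<Longrightarrow> K0 \<le> k \<Longrightarrow> CARD('d) + 1 \<le> k \<Longrightarrow> k \<le> n ^ s \<Longrightarrow> ?good n k"
    using large_k[OF \<eta> s(2)] by blast
  have "\<forall>\<^sub>F n in sequentially. \<forall>k\<in>{CARD('d) + 1..<K0}. ?good n k"
  proof (rule eventually_ball_finite)
    show "\<forall>k\<in>{CARD('d) + 1..<K0}. \<forall>\<^sub>F n in sequentially. ?good n k"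
    proof
      fix k assume "k \<in> {CARD('d) + 1..<K0}"
      then have "CARD('d) + 1 \<le> k" by simp
      from small_k[OF \<eta> s this] obtain n1 where "\<And>n. n1 \<le> n \<Longrightarrow> ?good n k" by blast
      then show "\<forall>\<^sub>F n in sequentially. ?good n k" by (auto simp: eventually_sequentially)
    qed
  qed simp
  then show ?thesis
    using eventually_ge_at_top[of 2]
  proof eventually_elim
    case (elim n)
    show ?case
    proof (intro allI impI)
      fix k assume k: "CARD('d) + 1 \<le> k \<and> k \<le> n ^ s"
      show "?good n k"
      proof (cases "k < K0")
        case True
        then show ?thesis using elim(1) k by auto
      next
        case False
        then show ?thesis using K0[OF elim(2), of k] k by auto
      qed
    qed
  qed
qed

theorem theorem1p4:
  fixes \<eta> :: real
  assumes "\<eta> > 0"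
  shows "\<exists>n0::nat. \<forall>s::nat. 1 \<le> s \<and> s \<le> CARD('d::finite) - 1 \<longrightarrow>
           (\<forall>n::nat. n \<ge> n0 \<longrightarrow>
             (\<forall>k::nat. CARD('d) + 1 \<le> k \<and> k \<le> n ^ s \<longrightarrow>
               (\<exists>S :: (real ^ 'd) set. S \<subseteq> grid n \<and>
                  real (card S) \<ge> (1 - \<eta>) * real k * real n ^ (CARD('d) - s) \<and>
                  (\<forall>A :: (real ^ 'd) set. affine A \<and> aff_dim A = int s \<longrightarrow>
                     card (S \<inter> A) \<le> k))))"
proof -
  \<comment> \<open>The previous results need a parameter below 1, and decreasing the parameter only
    strengthens the bound.\<close>
  define \<eta>' where "\<eta>' = min \<eta> (1 / 2)"
  have \<eta>': "0 < \<eta>'" "\<eta>' < 1" "\<eta>' \<le> \<eta>" using assms by (auto simp: \<eta>'_def)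
  have "\<forall>\<^sub>F n in sequentially. \<forall>s\<in>{1..CARD('d) - 1}. \<forall>k. CARD('d) + 1 \<le> k \<and> k \<le> n ^ s \<longrightarrow>
    (\<exists>S \<subseteq> (grid n :: (real ^ 'd) set). (1 - \<eta>') * real k * real n ^ (CARD('d) - s) \<le> real (card S) \<and>
      (\<forall>A. affine A \<and> aff_dim A = int s \<longrightarrow> card (S \<inter> A) \<le> k))"
  proof (rule eventually_ball_finite, simp, rule ballI)
    fix s assume "s \<in> {1..CARD('d) - 1}"
    then have "1 \<le> s" "s \<le> CARD('d)" by auto
    then show "\<forall>\<^sub>F n in sequentially. \<forall>k. CARD('d) + 1 \<le> k \<and> k \<le> n ^ s \<longrightarrow>
      (\<exists>S \<subseteq> (grid n :: (real ^ 'd) set). (1 - \<eta>') * real k * real n ^ (CARD('d) - s) \<le> real (card S) \<and>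
        (\<forall>A. affine A \<and> aff_dim A = int s \<longrightarrow> card (S \<inter> A) \<le> k))"
      by (rule all_k[OF \<eta>'(1,2)])
  qed
  then obtain n0 where n0: "\<forall>n\<ge>n0. \<forall>s\<in>{1..CARD('d) - 1}. \<forall>k. CARD('d) + 1 \<le> k \<and> k \<le> n ^ s \<longrightarrow>
    (\<exists>S \<subseteq> (grid n :: (real ^ 'd) set). (1 - \<eta>') * real k * real n ^ (CARD('d) - s) \<le> real (card S) \<and>
      (\<forall>A. affine A \<and> aff_dim A = int s \<longrightarrow> card (S \<inter> A) \<le> k))"
    unfolding eventually_sequentially by (rule exE)
  show ?thesis
  proof (intro exI[of _ n0] allI impI)
    fix s n k :: nat
    assume s: "1 \<le> s \<and> s \<le> CARD('d) - 1" and n: "n0 \<le> n" and k: "CARD('d) + 1 \<le> k \<and> k \<le> n ^ s"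
    have "s \<in> {1..CARD('d) - 1}" using s by simp
    from n0[rule_format, OF n this k] obtain S :: "(real ^ 'd) set" where S: "S \<subseteq> grid n"
      "(1 - \<eta>') * real k * real n ^ (CARD('d) - s) \<le> real (card S)"
      "\<forall>A. affine A \<and> aff_dim A = int s \<longrightarrow> card (S \<inter> A) \<le> k" by blast
    have "(1 - \<eta>) * real k * real n ^ (CARD('d) - s) \<le> (1 - \<eta>') * real k * real n ^ (CARD('d) - s)"
      using \<eta>'(3) by (intro mult_right_mono) auto
    then show "\<exists>S :: (real ^ 'd) set. S \<subseteq> grid n \<and>
        real (card S) \<ge> (1 - \<eta>) * real k * real n ^ (CARD('d) - s) \<and>
        (\<forall>A. affine A \<and> aff_dim A = int s \<longrightarrow> card (S \<inter> A) \<le> k)"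
      using S by (intro exI[of _ S]) auto
  qed
qed

end
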